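(* Let $n\ge0$ be an integer. If $E$ is an infinite-dimensional Banach space satisfying any of the following properties, then there is a continuous linear surjection from the Banach space $\mathrm{Lip}_0(E)$ onto $\ell_1$: (1) $E=C_0(Y)^{*(n)}$ for some locally compact space $Y$; (2) $E=L_\infty(\Omega,\Sigma,\mu)^{*(n)}$ for some $\sigma$-finite measure space $(\Omega,\Sigma,\mu)$; (3) $E$ is a predual space of the space $C(K)$ for some compact space $K$; (4) $E=L_1(\Omega,\Sigma,\mu)$ for some $\sigma$-finite measure space $(\Omega,\Sigma,\mu)$; (5) $E=\mathcal{L}(Y,Z)$ for some infinite-dimensional normed space $Y$ and some Banach space $Z$ containing a copy of $c_0$; (6) $E=\mathrm{Bil}(Y\times W,Z)$ for some infinite-dimensional Banach spaces $Y$, $W$, and $Z$ such that $Z$ contains a copy of $c_0$; (7) $E=\mathrm{Lip}_0(M)^{*(n)}$ for some metric space $M$; (8) $E=\mathcal{F}(M)$ for some metric space $M$.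
   Context: All vector spaces are real and all topological spaces are Tychonoff (in particular Hausdorff). For a Banach space $E$: $E^{*(0)}=E$ and $E^{*(n+1)}=(E^{*(n)})^*$. A Banach space $E$ is a predual of a Banach space $F$ if $F$ is isometrically isomorphic to $E^*$. $C(K)$ is the Banach space of continuous real functions on a compact space $K$ and $C_0(Y)$ that of continuous real functions on a locally compact space $Y$ vanishing at infinity, both with the supremum norm. $\mathcal{L}(Y,Z)$ is the Banach space of all continuous linear operators from a normed space $Y$ into a Banach space $Z$; $\mathrm{Bil}(Y\times W,Z)$ is the Banach space of all continuous bilinear mappings $Y\times W\to Z$. A copy of $c_0$ means an isomorphic copy. For a metric space $(M,\rho)$ with a distinguished base point $e$ (in particular for a Banach space regarded as a metric space), $\mathrm{Lip}_0(M)$ is the Banach space of all Lipschitz functions $f\colon M\to\mathbb{R}$ with $f(e)=0$, with norm $\|f\|=\mathrm{Lip}(f)=\sup_{x\neq y}|f(x)-f(y)|/\rho(x,y)$. The Lipschitz-free space $\mathcal{F}(M)$ is the norm closure in $\mathrm{Lip}_0(M)^*$ of the linear span of the evaluation functionals $\delta_x\colon f\mapsto f(x)$, $x\in M$. *)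

theory Defs
  imports "HOL-Analysis.Analysis" "HOL-Probability.Essential_Supremum"
begin

section \<open>Normed spaces with an explicit carrier\<close>

text \<open>
  Iterated duals, \<open>Lip\<^sub>0\<close>-spaces (which depend on a base point) and \<open>L\<^sub>p\<close>-spaces (which depend on a
  measure) cannot be types of class \<open>real_normed_vector\<close>, so they are records with a carrier.
  Spaces that are library types enter through \<open>space_of\<close> and \<open>type_space\<close>.
\<close>

record 'a nspace =
  carr :: "'a set"
  vadd :: "'a \<Rightarrow> 'a \<Rightarrow> 'a"
  vzero :: 'a
  vscale :: "real \<Rightarrow> 'a \<Rightarrow> 'a"
  vnorm :: "'a \<Rightarrow> real"

locale normed_space =
  fixes X :: "'a nspace"
  assumes add_closed: "\<lbrakk>x \<in> carr X; y \<in> carr X\<rbrakk> \<Longrightarrow> vadd X x y \<in> carr X"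
    and zero_closed: "vzero X \<in> carr X"
    and scale_closed: "x \<in> carr X \<Longrightarrow> vscale X a x \<in> carr X"
    and add_assoc: "\<lbrakk>x \<in> carr X; y \<in> carr X; z \<in> carr X\<rbrakk>
          \<Longrightarrow> vadd X (vadd X x y) z = vadd X x (vadd X y z)"
    and add_commute: "\<lbrakk>x \<in> carr X; y \<in> carr X\<rbrakk> \<Longrightarrow> vadd X x y = vadd X y x"
    and add_zero: "x \<in> carr X \<Longrightarrow> vadd X x (vzero X) = x"
    and add_neg: "x \<in> carr X \<Longrightarrow> vadd X x (vscale X (-1) x) = vzero X"
    and scale_add_right: "\<lbrakk>x \<in> carr X; y \<in> carr X\<rbrakk>
          \<Longrightarrow> vscale X a (vadd X x y) = vadd X (vscale X a x) (vscale X a y)"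
    and scale_add_left: "x \<in> carr X \<Longrightarrow> vscale X (a + b) x = vadd X (vscale X a x) (vscale X b x)"
    and scale_scale: "x \<in> carr X \<Longrightarrow> vscale X a (vscale X b x) = vscale X (a * b) x"
    and scale_one: "x \<in> carr X \<Longrightarrow> vscale X 1 x = x"
    and norm_eq_zero: "x \<in> carr X \<Longrightarrow> vnorm X x = 0 \<longleftrightarrow> x = vzero X"
    and norm_triangle: "\<lbrakk>x \<in> carr X; y \<in> carr X\<rbrakk> \<Longrightarrow> vnorm X (vadd X x y) \<le> vnorm X x + vnorm X y"
    and norm_scale: "x \<in> carr X \<Longrightarrow> vnorm X (vscale X a x) = \<bar>a\<bar> * vnorm X x"

definition space_of :: "'a::real_normed_vector set \<Rightarrow> 'a nspace" where
  "space_of V = \<lparr>carr = V, vadd = (+), vzero = 0, vscale = (*\<^sub>R), vnorm = norm\<rparr>"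

definition type_space :: "'a::real_normed_vector itself \<Rightarrow> 'a nspace" where
  "type_space _ = space_of UNIV"

definition infinite_dimensional :: "'a::real_vector itself \<Rightarrow> bool" where
  "infinite_dimensional _ \<longleftrightarrow> \<not> (\<exists>B::'a set. finite B \<and> span B = UNIV)"

definition linear_map :: "'a nspace \<Rightarrow> 'b nspace \<Rightarrow> ('a \<Rightarrow> 'b) \<Rightarrow> bool" where
  "linear_map X Y T \<longleftrightarrow>
     (\<forall>x\<in>carr X. T x \<in> carr Y) \<and>
     (\<forall>x\<in>carr X. \<forall>y\<in>carr X. T (vadd X x y) = vadd Y (T x) (T y)) \<and>
     (\<forall>a. \<forall>x\<in>carr X. T (vscale X a x) = vscale Y a (T x))"

text \<open>As in the library's locale \<open>bounded_linear\<close>, continuity is expressed as boundedness.\<close>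

definition bounded_linear_map :: "'a nspace \<Rightarrow> 'b nspace \<Rightarrow> ('a \<Rightarrow> 'b) \<Rightarrow> bool" where
  "bounded_linear_map X Y T \<longleftrightarrow>
     linear_map X Y T \<and> (\<exists>C. \<forall>x\<in>carr X. vnorm Y (T x) \<le> C * vnorm X x)"

definition isometrically_isomorphic :: "'a nspace \<Rightarrow> 'b nspace \<Rightarrow> bool" (infix "\<cong>\<^sub>i" 50) where
  "X \<cong>\<^sub>i Y \<longleftrightarrow> (\<exists>T. linear_map X Y T \<and> bij_betw T (carr X) (carr Y) \<and>
                 (\<forall>x\<in>carr X. vnorm Y (T x) = vnorm X x))"

definition contains_copy :: "'a nspace \<Rightarrow> 'b nspace \<Rightarrow> bool" where
  "contains_copy Z X \<longleftrightarrow> (\<exists>T. bounded_linear_map X Z T \<and>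
                            (\<exists>c>0. \<forall>x\<in>carr X. c * vnorm X x \<le> vnorm Z (T x)))"

definition norm_closure :: "'a nspace \<Rightarrow> 'a set \<Rightarrow> 'a set" where
  "norm_closure X A =
     {x \<in> carr X. \<forall>\<epsilon>>0. \<exists>a\<in>A. vnorm X (vadd X x (vscale X (-1) a)) < \<epsilon>}"

section \<open>Duals and iterated duals\<close>

text \<open>Functionals are normalised to be 0 outside the carrier, so that each one is represented once.\<close>

definition dual :: "'a nspace \<Rightarrow> ('a \<Rightarrow> real) nspace" where
  "dual X = \<lparr>carr = {\<phi>. bounded_linear_map X (type_space TYPE(real)) \<phi> \<and> (\<forall>x. x \<notin> carr X \<longrightarrow> \<phi> x = 0)},
             vadd = (\<lambda>\<phi> \<psi> x. \<phi> x + \<psi> x), vzero = (\<lambda>x. 0), vscale = (\<lambda>a \<phi> x. a * \<phi> x),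
             vnorm = (\<lambda>\<phi>. SUP x\<in>{x \<in> carr X. vnorm X x \<le> 1}. \<bar>\<phi> x\<bar>)\<rparr>"

text \<open>
  The type of the literal \<open>n\<close>-fold dual depends on \<open>n\<close>. Therefore \<open>iterated_dual n X D\<close> says that
  \<open>D\<close> is, up to isometric isomorphism, \<open>X\<^bsup>*(n)\<^esup>\<close>, where the successive duals
  are realised as normed spaces on subsets of one type \<open>'u\<close>. A statement about all \<open>E\<close> with
  \<open>is_iterated_dual TYPE('u) n X E\<close> should be polymorphic in \<open>'u\<close>: for each \<open>n\<close> a sufficiently large \<open>'u\<close>
  accommodates \<open>X, X\<^sup>*, \<dots>, X\<^bsup>*(n)\<^esup>\<close>.
\<close>

primrec iterated_dual :: "nat \<Rightarrow> 'x nspace \<Rightarrow> 'u nspace \<Rightarrow> bool" where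
  "iterated_dual 0 X D \<longleftrightarrow> normed_space D \<and> D \<cong>\<^sub>i X"
| "iterated_dual (Suc n) X D \<longleftrightarrow> normed_space D \<and> (\<exists>D'. iterated_dual n X D' \<and> D \<cong>\<^sub>i dual D')"

definition is_iterated_dual :: "'u itself \<Rightarrow> nat \<Rightarrow> 'x nspace \<Rightarrow> 'e nspace \<Rightarrow> bool" where
  "is_iterated_dual _ n X E \<longleftrightarrow> (\<exists>D::'u nspace. iterated_dual n X D \<and> E \<cong>\<^sub>i D)"

definition is_predual :: "'e nspace \<Rightarrow> 'f nspace \<Rightarrow> bool" where
  "is_predual E F \<longleftrightarrow> F \<cong>\<^sub>i dual E"

section \<open>Concrete spaces\<close>

text \<open>Continuous functions vanishing at infinity are bounded, so they form a subspace of \<open>'y \<Rightarrow>\<^sub>C real\<close>,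
  whose norm is the supremum norm.\<close>

definition C0_space :: "'y::topological_space itself \<Rightarrow> ('y \<Rightarrow>\<^sub>C real) nspace" where
  "C0_space _ = space_of {f. \<forall>\<epsilon>>0. \<exists>K. compact K \<and> (\<forall>y. y \<notin> K \<longrightarrow> \<bar>apply_bcontfun f y\<bar> < \<epsilon>)}"

definition c0_space :: "(nat \<Rightarrow>\<^sub>C real) nspace" where
  "c0_space = space_of {a. apply_bcontfun a \<longlonglongrightarrow> 0}"

definition ell1_space :: "(nat \<Rightarrow> real) nspace" where
  "ell1_space = \<lparr>carr = {a. summable (\<lambda>k. \<bar>a k\<bar>)},
                 vadd = (\<lambda>a b k. a k + b k), vzero = (\<lambda>k. 0), vscale = (\<lambda>c a k. c * a k),
                 vnorm = (\<lambda>a. \<Sum>k. \<bar>a k\<bar>)\<rparr>"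

text \<open>Elements of \<open>L\<^sub>1\<close> and \<open>L\<^sub>\<infinity>\<close> are classes of measurable functions modulo equality
  almost everywhere; the operations are computed on representatives.\<close>

definition ae_class :: "'a measure \<Rightarrow> ('a \<Rightarrow> real) \<Rightarrow> ('a \<Rightarrow> real) set" where
  "ae_class M f = {g \<in> borel_measurable M. AE x in M. g x = f x}"

definition repr :: "('a \<Rightarrow> real) set \<Rightarrow> 'a \<Rightarrow> real" where
  "repr A = (SOME f. f \<in> A)"

definition L1_space :: "'a measure \<Rightarrow> ('a \<Rightarrow> real) set nspace" where
  "L1_space M = \<lparr>carr = ae_class M ` {f. integrable M f},
                 vadd = (\<lambda>A B. ae_class M (\<lambda>x. repr A x + repr B x)),
                 vzero = ae_class M (\<lambda>x. 0),
                 vscale = (\<lambda>c A. ae_class M (\<lambda>x. c * repr A x)),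
                 vnorm = (\<lambda>A. \<integral>x. \<bar>repr A x\<bar> \<partial>M)\<rparr>"

text \<open>\<open>real_of_ereal\<close> also sends the essential supremum \<open>-\<infinity>\<close> over a null space to 0.\<close>

definition Linf_space :: "'a measure \<Rightarrow> ('a \<Rightarrow> real) set nspace" where
  "Linf_space M = \<lparr>carr = ae_class M ` {f \<in> borel_measurable M. esssup M (\<lambda>x. ereal \<bar>f x\<bar>) < \<infinity>},
                   vadd = (\<lambda>A B. ae_class M (\<lambda>x. repr A x + repr B x)),
                   vzero = ae_class M (\<lambda>x. 0),
                   vscale = (\<lambda>c A. ae_class M (\<lambda>x. c * repr A x)),
                   vnorm = (\<lambda>A. real_of_ereal (esssup M (\<lambda>x. ereal \<bar>repr A x\<bar>)))\<rparr>"

definition Bil_space ::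
  "'y::real_normed_vector itself \<Rightarrow> 'w::real_normed_vector itself \<Rightarrow> 'z::real_normed_vector itself
     \<Rightarrow> ('y \<Rightarrow> 'w \<Rightarrow> 'z) nspace" where
  "Bil_space _ _ _ = \<lparr>carr = {B. bounded_bilinear B},
     vadd = (\<lambda>B B' y w. B y w + B' y w), vzero = (\<lambda>y w. 0),
     vscale = (\<lambda>c B y w. c *\<^sub>R B y w),
     vnorm = (\<lambda>B. SUP (y, w) \<in> {y. norm y \<le> 1} \<times> {w. norm w \<le> 1}. norm (B y w))\<rparr>"

text \<open>The supremum runs over all pairs; a pair with \<open>x = y\<close> contributes \<open>0 / 0 = 0\<close>, so that the
  norm is also correct on a one-point space.\<close>

definition Lip0_space :: "'m::metric_space \<Rightarrow> ('m \<Rightarrow> real) nspace" where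
  "Lip0_space e = \<lparr>carr = {f. f e = 0 \<and> (\<exists>C. C-lipschitz_on UNIV f)},
                   vadd = (\<lambda>f g x. f x + g x), vzero = (\<lambda>x. 0), vscale = (\<lambda>c f x. c * f x),
                   vnorm = (\<lambda>f. SUP (x, y) \<in> UNIV. \<bar>f x - f y\<bar> / dist x y)\<rparr>"

definition evaluation :: "'m::metric_space \<Rightarrow> 'm \<Rightarrow> ('m \<Rightarrow> real) \<Rightarrow> real" where
  "evaluation e x = (\<lambda>f. if f \<in> carr (Lip0_space e) then f x else 0)"

definition evaluation_span :: "'m::metric_space \<Rightarrow> (('m \<Rightarrow> real) \<Rightarrow> real) set" where
  "evaluation_span e = {(\<lambda>f. \<Sum>x\<in>A. c x * evaluation e x f) | c A. finite A}"

definition free_space :: "'m::metric_space \<Rightarrow> (('m \<Rightarrow> real) \<Rightarrow> real) nspace" where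
  "free_space e = (dual (Lip0_space e))
     \<lparr>carr := norm_closure (dual (Lip0_space e)) (evaluation_span e)\<rparr>"

end

theory Submission
  imports Defs "HOL-Library.Ramsey"
begin

text \<open>
  Two facts combine. If a normed space \<open>E\<close> contains a sequence equivalent to the unit vector basis of
  \<open>\<ell>\<^sub>1\<close> or of \<open>c\<^sub>0\<close>, then \<open>Lip\<^sub>0(E)\<close> maps onto \<open>\<ell>\<^sub>1\<close> (lemma \<open>Lip0_onto_ell1_if_sequence\<close>); and every
  infinite-dimensional space in the list contains such a sequence.

  For the first fact, Lipschitz functions extend from subsets, so it is enough to find a good subset
  of \<open>E\<close>. The subset is a torus: a finitely supported family of unimodular numbers \<open>z\<^sub>i\<close> goes to
  \<open>\<Sum> (Re z\<^sub>i - 1) u\<^sub>2\<^sub>i + Im z\<^sub>i u\<^sub>2\<^sub>i\<^sub>+\<^sub>1\<close>, where \<open>u\<close> is the given sequence. On it live unimodular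
  characters \<open>\<xi>\<^sub>k\<close>, all Lipschitz with one constant. Hence \<open>\<Sum> a\<^sub>k Im \<xi>\<^sub>k\<close> is Lipschitz for every
  \<open>a \<in> \<ell>\<^sub>1\<close>, and the operator that assigns to \<open>f\<close> its sine coefficients, that is, the averages of
  \<open>2 f Im \<xi>\<^sub>k\<close> over a fine grid in a finite-dimensional torus, recovers \<open>a\<close> as the dimension grows. A
  limit along a filter on the naturals then gives the surjection, provided that the coefficients of a
  Lipschitz function are absolutely summable with a bound independent of the grid.

  This bound is the heart of the matter. The characters are arranged so that for every sign pattern
  \<open>\<sigma> \<in> {-1, 1}\<^sup>n\<close> one can move every grid point by \<open>O(h)\<close> in such a way that the angle of \<open>\<xi>\<^sub>k\<close> changes
  by \<open>\<sigma>\<^sub>k h\<close> for all \<open>k < n\<close> simultaneously. Given signs \<open>\<epsilon>\<^sub>k\<close>, weight the differences of \<open>f\<close> along this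
  move by the Riesz product \<open>\<Prod> (1 + \<sigma>\<^sub>k \<epsilon>\<^sub>k Re \<xi>\<^sub>k) \<ge> 0\<close>, whose average over \<open>\<sigma>\<close> is \<open>1\<close>. The result is at
  most \<open>O(h)\<close> times the Lipschitz constant. Shifting the difference to the weight and averaging over
  \<open>\<sigma>\<close> turns the weight into \<open>\<Prod> (1 + \<epsilon>\<^sub>k sin h Im \<xi>\<^sub>k) - 1 = sin h \<Sum> \<epsilon>\<^sub>k Im \<xi>\<^sub>k + O(h\<^sup>2)\<close>
  (lemmas \<open>riesz_identity\<close> and \<open>sum_coef_le\<close>). For \<open>c\<^sub>0\<close> one takes \<open>\<xi>\<^sub>k z = z\<^sub>k\<close>, because the maximum norm
  allows all coordinates to turn at once. For \<open>\<ell>\<^sub>1\<close> only one coordinate may move, so there is one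
  coordinate for every sign pattern, and \<open>\<xi>\<^sub>k\<close> multiplies each coordinate or its conjugate
  according to the \<open>k\<close>-th sign of the pattern.

  The second fact passes through the duals: if \<open>X\<close> has a \<open>c\<^sub>0\<close> or \<open>\<ell>\<^sub>1\<close> sequence, then \<open>X\<^sup>*\<close> has an
  \<open>\<ell>\<^sub>1\<close> sequence, by the Hahn--Banach theorem. The spaces at the bottom of the list are treated by
  hand: disjoint bumps in \<open>C\<^sub>0(Y)\<close>, disjoint sets of positive measure in \<open>L\<^sub>1\<close> and \<open>L\<^sub>\<infinity>\<close>, well separated
  pairs of points in a metric space, rank-one operators and bilinear maps, and almost norming
  vectors for disjoint bumps in the case of a predual of \<open>C(K)\<close>. If the disjoint objects did not
  exist, then the bottom space, all its duals and hence \<open>E\<close> would be finite-dimensional.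
\<close>

section \<open>Limits along a filter and Lipschitz extension\<close>

text \<open>
  A substitute for a nonprincipal ultrafilter. The evaluations \<open>X \<mapsto> X n\<close> are points of a product of
  compact intervals, one for each bounded \<open>X\<close>, so they have a cluster point by Tychonoff's theorem.
  The filter generated by the indices whose evaluation is near the cluster point does the job.
\<close>

lemma exists_limit_filter:
  "\<exists>U::nat filter. U \<noteq> bot \<and> U \<le> sequentially \<and>
     (\<forall>X::nat \<Rightarrow> real. bounded (range X) \<longrightarrow> (\<exists>l. (X \<longlongrightarrow> l) U))"
proof -
  define e :: "nat \<Rightarrow> (nat \<Rightarrow> real) \<Rightarrow> real"
    where "e n = (\<lambda>X. if bounded (range X) then X n else 0)" for n
  define B :: "(nat \<Rightarrow> real) \<Rightarrow> real"
    where "B X = (if bounded (range X) then (SUP n. \<bar>X n\<bar>) else 0)" for X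
  define S where "S = (\<Pi>\<^sub>E X\<in>UNIV. {-B X..B X})"
  have eS: "e n \<in> S" for n
  proof -
    have "\<bar>e n X\<bar> \<le> B X" for X
    proof (cases "bounded (range X)")
      case True
      then obtain K where "\<And>n. \<bar>X n\<bar> \<le> K"
        unfolding bounded_iff by auto
      then have "\<bar>X n\<bar> \<le> (SUP n. \<bar>X n\<bar>)"
        by (intro cSUP_upper bdd_aboveI2) auto
      then show ?thesis using True by (simp add: e_def B_def)
    qed (simp add: e_def B_def)
    then show ?thesis by (auto simp: S_def abs_le_iff minus_le_iff)
  qed
  have "compactin (product_topology (\<lambda>_. euclidean) UNIV) S"
    unfolding S_def by (subst compactin_PiE) auto
  then have "compact S"
    by (simp add: euclidean_product_topology)
  moreover have "filtermap e sequentially \<noteq> bot"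
    by (simp add: filtermap_bot_iff)
  moreover have "eventually (\<lambda>x. x \<in> S) (filtermap e sequentially)"
    using eS by (simp add: eventually_filtermap)
  ultimately obtain x where x: "inf (nhds x) (filtermap e sequentially) \<noteq> bot"
    unfolding compact_filter by blast
  define U where "U = inf sequentially (filtercomap e (nhds x))"
  have "U \<noteq> bot"
  proof
    assume "U = bot"
    then have "eventually (\<lambda>_. False) U" by simp
    then obtain P Q where PQ: "eventually P sequentially" "eventually Q (filtercomap e (nhds x))"
       "\<And>n. P n \<Longrightarrow> Q n \<Longrightarrow> False"
      unfolding U_def eventually_inf by auto
    then obtain R where R: "eventually R (nhds x)" "\<And>n. R (e n) \<Longrightarrow> Q n"
      unfolding eventually_filtercomap by auto
    have "eventually (\<lambda>y. \<not> R y) (filtermap e sequentially)"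
      unfolding eventually_filtermap using PQ(1) by (rule eventually_mono) (use PQ R in blast)
    then have "eventually (\<lambda>_. False) (inf (nhds x) (filtermap e sequentially))"
      unfolding eventually_inf using R(1) by blast
    then show False using x by (simp add: trivial_limit_def)
  qed
  moreover have "U \<le> sequentially" by (simp add: U_def)
  moreover have "\<exists>l. (X \<longlongrightarrow> l) U" if "bounded (range X)" for X :: "nat \<Rightarrow> real"
  proof -
    have "filterlim e (nhds x) U"
      unfolding U_def filterlim_iff_le_filtercomap by simp
    then have "((\<lambda>n. e n X) \<longlongrightarrow> x X) U"
      using continuous_on_tendsto_compose[of UNIV "\<lambda>f. f X" e x U] continuous_on_product_coordinates
      by simp
    then show ?thesis using that by (auto simp: e_def)
  qed
  ultimately show ?thesis by blast
qed

text \<open>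
  The subset is given by a parametrisation \<open>\<tau>\<close>. Where \<open>\<tau>\<close> identifies two parameters, the estimate
  forces equal values of \<open>g\<close>.
\<close>

lemma McShane_extension:
  fixes \<tau> :: "'p \<Rightarrow> 'm::metric_space" and g :: "'p \<Rightarrow> real"
  assumes lip: "\<And>p q. p \<in> P \<Longrightarrow> q \<in> P \<Longrightarrow> \<bar>g p - g q\<bar> \<le> K * dist (\<tau> p) (\<tau> q)" and K: "0 \<le> K"
  obtains f where "K-lipschitz_on UNIV f" "\<And>p. p \<in> P \<Longrightarrow> f (\<tau> p) = g p"
proof (cases "P = {}")
  case True
  have "K-lipschitz_on UNIV (\<lambda>_::'m. 0::real)" using K by (auto intro: lipschitz_onI)
  with True that show ?thesis by blast
next
  case False
  define f where "f y = (INF p\<in>P. g p + K * dist y (\<tau> p))" for y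
  have step: "g p + K * dist z (\<tau> p) \<le> g p + K * dist y (\<tau> p) + K * dist z y" for p z y
    using mult_left_mono[OF dist_triangle[of z "\<tau> p" y] K] by (simp add: algebra_simps)
  obtain p0 where p0: "p0 \<in> P" using False by blast
  have lower: "g p0 - K * dist y (\<tau> p0) \<le> g p + K * dist y (\<tau> p)" if "p \<in> P" for p y
    using lip[OF p0 that] mult_left_mono[OF dist_triangle3[of "\<tau> p0" "\<tau> p" y] K]
    by (simp add: algebra_simps abs_le_iff)
  have bdd: "bdd_below ((\<lambda>p. g p + K * dist y (\<tau> p)) ` P)" for y
    by (rule bdd_belowI2) (rule lower)
  have f_le: "f z \<le> f y + K * dist z y" for y z
  proof -
    have "f z - K * dist z y \<le> f y"
      unfolding f_def[of y]
    proof (rule cINF_greatest[OF False])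
      fix p assume "p \<in> P"
      then have "f z \<le> g p + K * dist z (\<tau> p)"
        unfolding f_def by (intro cINF_lower bdd)
      then show "f z - K * dist z y \<le> g p + K * dist y (\<tau> p)"
        using step[of p z y] by simp
    qed
    then show ?thesis by simp
  qed
  have "K-lipschitz_on UNIV f"
  proof (rule lipschitz_onI)
    show "dist (f x) (f y) \<le> K * dist x y" for x y
      using f_le[of x y] f_le[of y x] by (simp add: dist_real_def abs_le_iff dist_commute)
  qed (rule K)
  moreover have "f (\<tau> p) = g p" if "p \<in> P" for p
  proof (rule antisym)
    show "f (\<tau> p) \<le> g p"
      unfolding f_def using cINF_lower[OF bdd that, of "\<tau> p"] by simp
    show "g p \<le> f (\<tau> p)"
      unfolding f_def
    proof (rule cINF_greatest[OF False])
      fix q assume "q \<in> P"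
      then show "g p \<le> g q + K * dist (\<tau> p) (\<tau> q)" using lip[OF that, of q] by linarith
    qed
  qed
  ultimately show ?thesis using that by blast
qed

lemma Lip0_lipschitz:
  assumes "f \<in> carr (Lip0_space e)"
  shows "(vnorm (Lip0_space e) f)-lipschitz_on UNIV f"
    and "bdd_above ((\<lambda>(x, y). \<bar>f x - f y\<bar> / dist x y) ` UNIV)"
proof -
  obtain C where C: "C-lipschitz_on UNIV f" using assms by (auto simp: Lip0_space_def)
  have C0: "C \<ge> 0" using C by (rule lipschitz_on_nonneg)
  have "\<bar>f x - f y\<bar> / dist x y \<le> C" for x y
    using lipschitz_onD[OF C, of x y] C0 by (auto simp: dist_real_def divide_le_eq)
  then show bdd: "bdd_above ((\<lambda>(x, y). \<bar>f x - f y\<bar> / dist x y) ` UNIV)"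
    by (intro bdd_aboveI2[where M = C]) auto
  have le: "\<bar>f x - f y\<bar> / dist x y \<le> vnorm (Lip0_space e) f" for x y
    using cSUP_upper[OF UNIV_I bdd, of "(x, y)"] by (simp add: Lip0_space_def)
  show "(vnorm (Lip0_space e) f)-lipschitz_on UNIV f"
  proof (rule lipschitz_onI)
    show "dist (f x) (f y) \<le> vnorm (Lip0_space e) f * dist x y" for x y
    proof (cases "x = y")
      case False
      then show ?thesis using le[of x y] by (simp add: dist_real_def divide_le_eq)
    qed simp
    show "0 \<le> vnorm (Lip0_space e) f" using le[of e e] by simp
  qed
qed

lemma Lip0_norm_le:
  assumes "K-lipschitz_on UNIV f"
  shows "vnorm (Lip0_space e) f \<le> K"
proof -
  have "\<bar>f x - f y\<bar> / dist x y \<le> K" for x y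
    using lipschitz_onD[OF assms, of x y] lipschitz_on_nonneg[OF assms]
    by (auto simp: dist_real_def divide_le_eq)
  then show ?thesis by (auto simp: Lip0_space_def intro!: cSUP_least)
qed

section \<open>Torus systems and Riesz products\<close>

lemma sum_Pow_prod_signs:
  fixes a b :: "'i \<Rightarrow> real"
  assumes "finite I"
  shows "(\<Sum>A\<in>Pow I. \<Prod>k\<in>I. if k \<in> A then a k else b k) = (\<Prod>k\<in>I. a k + b k)"
proof -
  have "(\<Prod>k\<in>I. if k \<in> A then a k else b k) = prod a A * prod b (I - A)" if "A \<in> Pow I" for A
    using that assms by (subst prod.If_cases) (auto simp: Int_absorb1 Diff_eq[symmetric] Int_commute intro!: arg_cong2[where f="(*)"] prod.cong)
  then show ?thesis by (simp add: prod_add[OF assms])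
qed

text \<open>
  The constant counts the sets of at least two indices: each of them contributes a product of at
  least two factors \<open>q * b k\<close> to the expansion.
\<close>

lemma prod_one_plus_remainder:
  fixes b :: "nat \<Rightarrow> real"
  assumes b: "\<And>k. k < n \<Longrightarrow> \<bar>b k\<bar> \<le> 1" and q: "0 \<le> q" "q \<le> 1"
  shows "\<bar>(\<Prod>k<n. 1 + q * b k) - 1 - q * (\<Sum>k<n. b k)\<bar> \<le> (2 ^ n - real n - 1) * q\<^sup>2"
  using b
proof (induction n)
  case (Suc n)
  define R where "R = (\<Prod>k<n. 1 + q * b k) - 1 - q * (\<Sum>k<n. b k)"
  have R: "\<bar>R\<bar> \<le> (2 ^ n - real n - 1) * q\<^sup>2"
    unfolding R_def using Suc by simp
  have bn: "\<bar>b n\<bar> \<le> 1" using Suc.prems by simp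
  have "\<bar>\<Sum>k<n. b k\<bar> \<le> real n"
    using order_trans[OF sum_abs[of b "{..<n}"] sum_mono[of "{..<n}" "\<lambda>k. \<bar>b k\<bar>" "\<lambda>_. 1"]] Suc.prems
    by simp
  then have S: "\<bar>q * b n * (q * (\<Sum>k<n. b k))\<bar> \<le> q * 1 * (q * real n)"
    unfolding abs_mult using q bn by (intro mult_mono) auto
  have "\<bar>q * b n\<bar> \<le> 1 * 1" unfolding abs_mult using q bn by (intro mult_mono) auto
  then have "\<bar>1 + q * b n\<bar> \<le> 2" by linarith
  then have "\<bar>R * (1 + q * b n)\<bar> \<le> (2 ^ n - real n - 1) * q\<^sup>2 * 2"
    unfolding abs_mult using R by (intro mult_mono) auto
  moreover have "(\<Prod>k<Suc n. 1 + q * b k) - 1 - q * (\<Sum>k<Suc n. b k)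
      = R * (1 + q * b n) + q * b n * (q * (\<Sum>k<n. b k))"
    by (simp add: R_def algebra_simps)
  ultimately have "\<bar>(\<Prod>k<Suc n. 1 + q * b k) - 1 - q * (\<Sum>k<Suc n. b k)\<bar>
      \<le> (2 ^ n - real n - 1) * q\<^sup>2 * 2 + q * 1 * (q * real n)"
    using S by linarith
  also have "\<dots> = (2 ^ Suc n - real (Suc n) - 1) * q\<^sup>2"
    by (simp add: algebra_simps power2_eq_square)
  finally show ?case .
qed simp

text \<open>
  The grid \<open>P n\<close> parametrises finitely many points of a metric space through \<open>\<tau>\<close>, and \<open>\<xi> k p\<close> is the
  exponential of the \<open>k\<close>-th angle of \<open>p\<close>. The bijection \<open>s n A\<close> changes the first \<open>n\<close> angles by \<open>h n\<close>
  or \<open>- h n\<close> according to the sign pattern \<open>A\<close>, but moves the points only by \<open>C * h n\<close>: this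
  simultaneous change at the cost of a single one is what makes the sine coefficients summable. The
  mesh is so small, relative to the diameter \<open>D n\<close>, that second order terms are harmless.
\<close>

locale torus_system =
  fixes e :: "'m::metric_space" and \<tau> :: "'p \<Rightarrow> 'm" and \<xi> :: "nat \<Rightarrow> 'p \<Rightarrow> complex"
    and P :: "nat \<Rightarrow> 'p set" and s :: "nat \<Rightarrow> nat set \<Rightarrow> 'p \<Rightarrow> 'p"
    and h D :: "nat \<Rightarrow> real" and L C :: real
  assumes finite_P: "finite (P n)" and P_ne: "P n \<noteq> {}"
    and unimodular: "p \<in> P n \<Longrightarrow> norm (\<xi> k p) = 1"
    and L_nonneg: "0 \<le> L" and C_nonneg: "0 \<le> C"
    and \<xi>_lipschitz: "p \<in> P n \<Longrightarrow> q \<in> P m \<Longrightarrow> norm (\<xi> k p - \<xi> k q) \<le> L * dist (\<tau> p) (\<tau> q)"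
    and s_bij: "A \<subseteq> {..<n} \<Longrightarrow> bij_betw (s n A) (P n) (P n)"
    and \<xi>_s: "A \<subseteq> {..<n} \<Longrightarrow> p \<in> P n \<Longrightarrow> k < n \<Longrightarrow>
       \<xi> k (s n A p) = \<xi> k p * cis (if k \<in> A then h n else - h n)"
    and s_move: "A \<subseteq> {..<n} \<Longrightarrow> p \<in> P n \<Longrightarrow> dist (\<tau> (s n A p)) (\<tau> p) \<le> C * h n"
    and diam: "p \<in> P n \<Longrightarrow> dist (\<tau> p) e \<le> D n"
    and h_pos: "0 < h n" and h_le: "h n \<le> 1" and h_small: "2 ^ n * D n * h n \<le> 1"
    and base: "\<exists>p\<in>P n. \<tau> p = e \<and> (\<forall>k. \<xi> k p = 1)"
begin

text \<open>
  The sine coefficients on the \<open>n\<close>-th grid. They are cut off at \<open>n\<close> because \<open>s n A\<close> controls only the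
  first \<open>n\<close> angles.
\<close>

definition coef :: "nat \<Rightarrow> ('m \<Rightarrow> real) \<Rightarrow> nat \<Rightarrow> real" where
  "coef n f k = (if k < n then 2 / card (P n) * (\<Sum>p\<in>P n. f (\<tau> p) * Im (\<xi> k p)) else 0)"

lemma card_P_pos: "real (card (P n)) > 0"
  using finite_P P_ne by (simp add: card_gt_0_iff)

text \<open>
  Summation by parts. The bijection \<open>s n A\<close> carries the weight \<open>G A\<close> to a product whose \<open>k\<close>-th factor
  is \<open>1 \<plusminus> \<epsilon> k * Re (\<xi> k p * cis (\<minusplus> h n))\<close>. In the average over all \<open>A\<close> the two signs of each factor are
  averaged independently; the cosine terms cancel and the sine term survives.
\<close>

lemma riesz_identity:
  fixes F :: "'p \<Rightarrow> real" and \<epsilon> :: "nat \<Rightarrow> real" and n :: nat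
  defines "G \<equiv> \<lambda>A p. \<Prod>k<n. 1 + (if k \<in> A then 1 else -1) * \<epsilon> k * Re (\<xi> k p)"
  shows "(\<Sum>A\<in>Pow {..<n}. \<Sum>p\<in>P n. (F (s n A p) - F p) * G A p)
       = 2 ^ n * (\<Sum>p\<in>P n. F p * ((\<Prod>k<n. 1 + sin (h n) * (\<epsilon> k * Im (\<xi> k p))) - 1))"
    and "(\<Sum>A\<in>Pow {..<n}. G A p) = 2 ^ n"
proof -
  \<comment> \<open>the factors of \<open>G A\<close>, written in terms of the moved point: the angle is turned back\<close>
  define a where "a p k = 1 + \<epsilon> k * Re (\<xi> k p * cis (- h n))" for p k
  define b where "b p k = 1 - \<epsilon> k * Re (\<xi> k p * cis (h n))" for p k
  define H where "H A p = (\<Prod>k<n. if k \<in> A then a p k else b p k)" for A p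
  have G_H: "G A p = H A (s n A p)" if "A \<in> Pow {..<n}" "p \<in> P n" for A p
    unfolding G_def H_def
  proof (rule prod.cong[OF refl])
    fix k assume "k \<in> {..<n}"
    then have "\<xi> k (s n A p) = \<xi> k p * cis (if k \<in> A then h n else - h n)"
      using that by (intro \<xi>_s) auto
    then show "1 + (if k \<in> A then 1 else - 1) * \<epsilon> k * Re (\<xi> k p)
      = (if k \<in> A then a (s n A p) k else b (s n A p) k)"
      by (auto simp: a_def b_def mult.assoc cis_mult)
  qed
  have "a p k + b p k = 2 * (1 + sin (h n) * (\<epsilon> k * Im (\<xi> k p)))" for p k
    by (simp add: a_def b_def algebra_simps)
  then have sum_H: "(\<Sum>A\<in>Pow {..<n}. H A p) = 2 ^ n * (\<Prod>k<n. 1 + sin (h n) * (\<epsilon> k * Im (\<xi> k p)))" for p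
    unfolding H_def by (simp add: sum_Pow_prod_signs prod.distrib del: distrib_left_numeral)
  have "G A p = (\<Prod>k<n. if k \<in> A then 1 + \<epsilon> k * Re (\<xi> k p) else 1 - \<epsilon> k * Re (\<xi> k p))" for A p
    unfolding G_def by (intro prod.cong) auto
  then have sum_G: "(\<Sum>A\<in>Pow {..<n}. G A p) = 2 ^ n" for p
    by (simp add: sum_Pow_prod_signs)
  then show "(\<Sum>A\<in>Pow {..<n}. G A p) = 2 ^ n" .
  have "(\<Sum>A\<in>Pow {..<n}. \<Sum>p\<in>P n. F (s n A p) * G A p)
      = (\<Sum>A\<in>Pow {..<n}. \<Sum>p\<in>P n. F (s n A p) * H A (s n A p))"
    by (intro sum.cong refl) (simp add: G_H)
  also have "\<dots> = (\<Sum>A\<in>Pow {..<n}. \<Sum>p\<in>P n. F p * H A p)"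
    by (intro sum.cong refl sum.reindex_bij_betw s_bij) auto
  also have "\<dots> = (\<Sum>p\<in>P n. F p * (\<Sum>A\<in>Pow {..<n}. H A p))"
    by (subst sum.swap) (simp add: sum_distrib_left)
  finally have 1: "(\<Sum>A\<in>Pow {..<n}. \<Sum>p\<in>P n. F (s n A p) * G A p)
    = (\<Sum>p\<in>P n. F p * (2 ^ n * (\<Prod>k<n. 1 + sin (h n) * (\<epsilon> k * Im (\<xi> k p)))))"
    by (simp add: sum_H)
  have "(\<Sum>A\<in>Pow {..<n}. \<Sum>p\<in>P n. F p * G A p) = (\<Sum>p\<in>P n. F p * 2 ^ n)"
    by (subst sum.swap) (simp add: sum_distrib_left[symmetric] sum_G)
  with 1 show "(\<Sum>A\<in>Pow {..<n}. \<Sum>p\<in>P n. (F (s n A p) - F p) * G A p)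
       = 2 ^ n * (\<Sum>p\<in>P n. F p * ((\<Prod>k<n. 1 + sin (h n) * (\<epsilon> k * Im (\<xi> k p))) - 1))"
    by (simp add: left_diff_distrib right_diff_distrib sum_subtractf sum_distrib_left sum_distrib_right algebra_simps)
qed

lemma abs_Re_Im_\<xi>: "p \<in> P n \<Longrightarrow> \<bar>Re (\<xi> k p)\<bar> \<le> 1 \<and> \<bar>Im (\<xi> k p)\<bar> \<le> 1"
  using abs_Re_le_cmod[of "\<xi> k p"] abs_Im_le_cmod[of "\<xi> k p"] unimodular[of p n k] by simp

text \<open>
  The left side of \<open>riesz_identity\<close> is at most \<open>K * C * h n\<close> times the total weight. On the right side
  the linear part is \<open>sin (h n)\<close> times the sum to be estimated, and the quadratic remainder \<open>R\<close> is
  absorbed by the smallness of \<open>h n\<close>. Division by \<open>sin (h n) \<ge> h n / 2\<close> leaves a bound that depends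
  neither on \<open>n\<close> nor on the grid.
\<close>

lemma sum_coef_le:
  assumes f: "K-lipschitz_on UNIV f" "f e = 0" and \<epsilon>: "\<And>k. \<bar>\<epsilon> k\<bar> \<le> 1"
  shows "(\<Sum>k<n. \<epsilon> k * coef n f k) \<le> (4 * C + 2) * K"
proof -
  define F where "F p = f (\<tau> p)" for p
  define q where "q = sin (h n)"
  define G where "G A p = (\<Prod>k<n. 1 + (if k \<in> A then 1 else -1) * \<epsilon> k * Re (\<xi> k p))" for A p
  define V where "V p = (\<Sum>k<n. \<epsilon> k * Im (\<xi> k p))" for p
  define R where "R p = (\<Prod>k<n. 1 + q * (\<epsilon> k * Im (\<xi> k p))) - 1 - q * V p" for p
  have K: "0 \<le> K" using f by (simp add: lipschitz_on_nonneg)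
  have q: "h n / 2 \<le> q" "q \<le> h n" "q \<le> 1"
  proof -
    \<comment> \<open>as \<open>h n \<le> 1\<close>, the Taylor estimate gives even \<open>5 / 6 * h n \<le> q\<close>\<close>
    have "\<bar>sin (h n) - h n\<bar> \<le> h n ^ 3 / 6"
      using Maclaurin_sin_bound[of "h n" 3] h_pos[of n] by (simp add: sin_coeff_def eval_nat_numeral)
    moreover have "h n ^ 3 \<le> h n" using h_pos[of n] h_le[of n] power_decreasing[of 1 3 "h n"] by simp
    ultimately show "h n / 2 \<le> q" using h_pos[of n] unfolding q_def by linarith
    show "q \<le> h n" unfolding q_def using h_pos[of n] by (intro sin_x_le_x) simp
    show "q \<le> 1" by (simp add: q_def)
  qed
  have q_pos: "0 < q" using q h_pos[of n] by linarith
  have D: "0 \<le> D n" using P_ne[of n] diam[of _ n] zero_le_dist order_trans by blast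
  have b: "\<bar>\<epsilon> k * x\<bar> \<le> 1" if "\<bar>x\<bar> \<le> 1" for k x
    unfolding abs_mult using mult_mono[OF \<epsilon>[of k] that] by simp
  have G_nonneg: "0 \<le> G A p" if "p \<in> P n" for A p
    unfolding G_def
  proof (intro prod_nonneg)
    fix k
    show "0 \<le> 1 + (if k \<in> A then 1 else - 1) * \<epsilon> k * Re (\<xi> k p)"
      using b[of "Re (\<xi> k p)" k] abs_Re_Im_\<xi>[OF that, of k] by auto
  qed
  have R_le: "\<bar>R p\<bar> \<le> 2 ^ n * q\<^sup>2" if "p \<in> P n" for p
  proof -
    have "\<bar>R p\<bar> \<le> (2 ^ n - real n - 1) * q\<^sup>2"
      unfolding R_def V_def using q q_pos b abs_Re_Im_\<xi>[OF that]
      by (intro prod_one_plus_remainder) auto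
    also have "\<dots> \<le> 2 ^ n * q\<^sup>2" by (intro mult_right_mono) auto
    finally show ?thesis .
  qed
  have F_le: "\<bar>F p\<bar> \<le> K * D n" if "p \<in> P n" for p
    using lipschitz_onD[OF f(1), of "\<tau> p" e] mult_left_mono[OF diam[OF that] K] f(2)
    by (simp add: F_def)
  have "2 ^ n * (\<Sum>p\<in>P n. F p * (q * V p + R p))
      = (\<Sum>A\<in>Pow {..<n}. \<Sum>p\<in>P n. (F (s n A p) - F p) * G A p)"
    unfolding G_def riesz_identity(1) by (simp add: R_def q_def)
  also have "\<dots> \<le> (\<Sum>A\<in>Pow {..<n}. \<Sum>p\<in>P n. K * (C * h n) * G A p)"
  proof (intro sum_mono mult_right_mono G_nonneg)
    fix A p assume A: "A \<in> Pow {..<n}" and p: "p \<in> P n"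
    have "F (s n A p) - F p \<le> K * dist (\<tau> (s n A p)) (\<tau> p)"
      using lipschitz_onD[OF f(1), of "\<tau> (s n A p)" "\<tau> p"] by (simp add: F_def dist_real_def)
    also have "\<dots> \<le> K * (C * h n)" using s_move[of A n p] A p K by (intro mult_left_mono) auto
    finally show "F (s n A p) - F p \<le> K * (C * h n)" .
  qed
  also have "\<dots> = 2 ^ n * (card (P n) * (K * (C * h n)))"
    by (subst sum.swap) (simp add: sum_distrib_left[symmetric] G_def riesz_identity(2))
  finally have "(\<Sum>p\<in>P n. F p * (q * V p + R p)) \<le> card (P n) * (K * (C * h n))"
    by simp
  moreover have "(\<Sum>p\<in>P n. - (F p * R p)) \<le> (\<Sum>p\<in>P n. K * D n * (2 ^ n * q\<^sup>2))"
  proof (intro sum_mono)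
    fix p assume "p \<in> P n"
    then have "\<bar>F p * R p\<bar> \<le> K * D n * (2 ^ n * q\<^sup>2)"
      unfolding abs_mult using F_le R_le K D by (intro mult_mono) auto
    then show "- (F p * R p) \<le> K * D n * (2 ^ n * q\<^sup>2)" by linarith
  qed
  ultimately have "q * (\<Sum>p\<in>P n. F p * V p)
     \<le> card (P n) * (K * (C * h n)) + card (P n) * (K * D n * (2 ^ n * q\<^sup>2))"
    by (simp add: distrib_left sum.distrib sum_negf sum_distrib_left mult.left_commute)
  also have "\<dots> \<le> q * (card (P n) * (K * (2 * C + 1)))"
  proof -
    have "C * h n \<le> C * (2 * q)" using q C_nonneg by (intro mult_left_mono) auto
    moreover have "D n * (2 ^ n * q\<^sup>2) \<le> q * 1"
    proof -
      have "2 ^ n * D n * q \<le> 2 ^ n * D n * h n" using q D by (intro mult_left_mono) auto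
      then have "2 ^ n * D n * q \<le> 1" using h_small[of n] by linarith
      then have "q * (2 ^ n * D n * q) \<le> q * 1" using q_pos by (intro mult_left_mono) auto
      then show ?thesis by (simp add: power2_eq_square algebra_simps)
    qed
    ultimately have "C * h n + D n * (2 ^ n * q\<^sup>2) \<le> q * (2 * C + 1)" by (simp add: algebra_simps)
    then have "card (P n) * K * (C * h n + D n * (2 ^ n * q\<^sup>2)) \<le> card (P n) * K * (q * (2 * C + 1))"
      using K by (intro mult_left_mono) auto
    then show ?thesis by (simp add: algebra_simps)
  qed
  finally have "(\<Sum>p\<in>P n. F p * V p) \<le> card (P n) * (K * (2 * C + 1))"
    using q_pos by simp
  then have "2 / card (P n) * (\<Sum>p\<in>P n. F p * V p) \<le> 2 / card (P n) * (card (P n) * (K * (2 * C + 1)))"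
    by (intro mult_left_mono) auto
  also have "\<dots> = (4 * C + 2) * K" using card_P_pos[of n] by (simp add: field_simps)
  also have "2 / card (P n) * (\<Sum>p\<in>P n. F p * V p) = (\<Sum>k<n. \<epsilon> k * coef n f k)"
    by (simp add: V_def F_def coef_def sum_distrib_left sum.swap[of _ "P n"] algebra_simps)
  finally show ?thesis .
qed

lemma sum_abs_coef_le:
  assumes "K-lipschitz_on UNIV f" "f e = 0"
  shows "(\<Sum>k<N. \<bar>coef n f k\<bar>) \<le> (4 * C + 2) * K"
proof -
  have "(\<Sum>k<N. \<bar>coef n f k\<bar>) = (\<Sum>k\<in>{..<N} \<inter> {..<n}. \<bar>coef n f k\<bar>)"
    by (intro sum.mono_neutral_right) (auto simp: coef_def)
  also have "\<dots> \<le> (\<Sum>k<n. \<bar>coef n f k\<bar>)" by (intro sum_mono2) auto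
  also have "\<dots> = (\<Sum>k<n. sgn (coef n f k) * coef n f k)"
    by (simp add: abs_sgn mult.commute)
  also have "\<dots> \<le> (4 * C + 2) * K"
    using assms by (intro sum_coef_le) (auto simp: sgn_if)
  finally show ?thesis .
qed

text \<open>
  Orthogonality follows from invariance: turning all angles by \<open>h n\<close> multiplies the sum of
  \<open>\<xi> j * \<xi> k\<close> by \<open>cis (2 * h n) \<noteq> 1\<close>, and turning only the \<open>j\<close>-th angle forward does the same to the
  sum of \<open>\<xi> j * cnj (\<xi> k)\<close>.
\<close>

lemma sum_Im_Im:
  assumes "j < n" "k < n"
  shows "(\<Sum>p\<in>P n. Im (\<xi> j p) * Im (\<xi> k p)) = (if j = k then card (P n) / 2 else 0)"
proof -
  have "cis (2 * h n) \<noteq> 1"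
  proof
    assume "cis (2 * h n) = 1"
    then have "sin (2 * h n) = 0" by (metis cis.sel(2) one_complex.sel(2))
    moreover have "sin (2 * h n) > 0"
      using h_pos[of n] h_le[of n] pi_gt3 by (intro sin_gt_zero) auto
    ultimately show False by simp
  qed
  have cc: "a * cis (h n) * (b * cis (h n)) = cis (2 * h n) * (a * b)" for a b
  proof -
    have "cis (2 * h n) = cis (h n) * cis (h n)" by (simp add: cis_mult)
    then show ?thesis by (simp add: mult_ac)
  qed
  have "(\<Sum>p\<in>P n. \<xi> j p * \<xi> k p) = (\<Sum>p\<in>P n. \<xi> j (s n {..<n} p) * \<xi> k (s n {..<n} p))"
    by (rule sum.reindex_bij_betw[symmetric, OF s_bij]) simp
  also have "\<dots> = (\<Sum>p\<in>P n. cis (2 * h n) * (\<xi> j p * \<xi> k p))"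
    using assms by (intro sum.cong refl) (simp add: \<xi>_s cc)
  finally have 1: "(\<Sum>p\<in>P n. \<xi> j p * \<xi> k p) = 0"
    using \<open>cis (2 * h n) \<noteq> 1\<close> by (simp flip: sum_distrib_left)
  have 2: "(\<Sum>p\<in>P n. \<xi> j p * cnj (\<xi> k p)) = (if j = k then card (P n) else 0)"
  proof (cases "j = k")
    case True
    then show ?thesis
      using unimodular by (simp add: complex_norm_square[symmetric])
  next
    case False
    have "(\<Sum>p\<in>P n. \<xi> j p * cnj (\<xi> k p)) = (\<Sum>p\<in>P n. \<xi> j (s n {j} p) * cnj (\<xi> k (s n {j} p)))"
      using assms by (intro sum.reindex_bij_betw[symmetric, OF s_bij]) simp
    also have "\<dots> = (\<Sum>p\<in>P n. cis (2 * h n) * (\<xi> j p * cnj (\<xi> k p)))"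
      using assms False by (intro sum.cong refl) (simp add: \<xi>_s cc cis_cnj)
    finally show ?thesis using \<open>cis (2 * h n) \<noteq> 1\<close> False by (simp flip: sum_distrib_left)
  qed
  have "Im a * Im b = (Re (a * cnj b) - Re (a * b)) / 2" for a b by simp
  then have "(\<Sum>p\<in>P n. Im (\<xi> j p) * Im (\<xi> k p))
      = (Re (\<Sum>p\<in>P n. \<xi> j p * cnj (\<xi> k p)) - Re (\<Sum>p\<in>P n. \<xi> j p * \<xi> k p)) / 2"
    by (simp only: Re_sum sum_subtractf[symmetric] sum_divide_distrib)
  then show ?thesis unfolding 1 2 by (cases "j = k") simp_all
qed

text \<open>
  The function is \<open>\<Sum>k. a k * Im (\<xi> k p)\<close> at the point \<open>\<tau> p\<close>, extended to the whole space. It does not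
  depend on \<open>n\<close>; its coefficients on the \<open>n\<close>-th grid differ from \<open>a\<close> only by the tail of the series
  beyond \<open>n\<close>, about which orthogonality says nothing but which is small uniformly.
\<close>

lemma exists_preimage:
  assumes a: "summable (\<lambda>k. \<bar>a k\<bar>)"
  obtains f where "f \<in> carr (Lip0_space e)" "\<And>k. (\<lambda>n. coef n f k) \<longlonglongrightarrow> a k"
proof -
  define U where "U = (\<Union>n. P n)"
  define g where "g p = (\<Sum>k. a k * Im (\<xi> k p))" for p
  have abs_term: "\<bar>a k * Im (\<xi> k p)\<bar> \<le> \<bar>a k\<bar>" if "p \<in> U" for k p
    using that abs_Re_Im_\<xi>[of p _ k] by (auto simp: U_def abs_mult mult_left_le)
  have summ: "summable (\<lambda>k. a k * Im (\<xi> k p))" if "p \<in> U" for p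
    by (rule summable_comparison_test'[OF a]) (use abs_term[OF that] in auto)
  have lip: "\<bar>g p - g q\<bar> \<le> (L * (\<Sum>k. \<bar>a k\<bar>)) * dist (\<tau> p) (\<tau> q)" if "p \<in> U" "q \<in> U" for p q
  proof -
    have le: "\<bar>a k * Im (\<xi> k p) - a k * Im (\<xi> k q)\<bar> \<le> \<bar>a k\<bar> * (L * dist (\<tau> p) (\<tau> q))" for k
    proof -
      have "\<bar>Im (\<xi> k p) - Im (\<xi> k q)\<bar> \<le> L * dist (\<tau> p) (\<tau> q)"
        using that \<xi>_lipschitz[of p _ q _ k] abs_Im_le_cmod[of "\<xi> k p - \<xi> k q"]
        by (force simp: U_def)
      then show ?thesis
        by (simp add: right_diff_distrib[symmetric] abs_mult mult_left_mono)
    qed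
    have "\<bar>g p - g q\<bar> = \<bar>\<Sum>k. a k * Im (\<xi> k p) - a k * Im (\<xi> k q)\<bar>"
      unfolding g_def by (simp add: suminf_diff summ that)
    also have "\<dots> \<le> (\<Sum>k. \<bar>a k\<bar> * (L * dist (\<tau> p) (\<tau> q)))"
      using le norm_suminf_le[of "\<lambda>k. a k * Im (\<xi> k p) - a k * Im (\<xi> k q)"] summable_mult2[OF a]
      by simp
    also have "\<dots> = (\<Sum>k. \<bar>a k\<bar>) * (L * dist (\<tau> p) (\<tau> q))"
      using suminf_mult2[OF a, of "L * dist (\<tau> p) (\<tau> q)"] by simp
    finally show ?thesis by (simp add: algebra_simps)
  qed
  have "0 \<le> L * (\<Sum>k. \<bar>a k\<bar>)" using L_nonneg suminf_nonneg[OF a] by simp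
  then obtain f where f: "(L * (\<Sum>k. \<bar>a k\<bar>))-lipschitz_on UNIV f" "\<And>p. p \<in> U \<Longrightarrow> f (\<tau> p) = g p"
    using McShane_extension[of U g _ \<tau>, OF lip] by blast
  obtain p0 where p0: "p0 \<in> P 0" "\<tau> p0 = e" "\<And>k. \<xi> k p0 = 1" using base[of 0] by blast
  then have "f e = 0" using f(2)[of p0] by (auto simp: U_def g_def)
  then have "f \<in> carr (Lip0_space e)" using f(1) by (auto simp: Lip0_space_def)
  moreover have "(\<lambda>n. coef n f j) \<longlonglongrightarrow> a j" for j
  proof (rule Lim_transform2[where f = "\<lambda>n. a j"])
    show "(\<lambda>n. a j) \<longlonglongrightarrow> a j" by simp
    have tail: "\<bar>a j - coef n f j\<bar> \<le> 2 * (\<Sum>k. \<bar>a (k + n)\<bar>)" if "j < n" for n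
    proof -
      have PU: "p \<in> U" if "p \<in> P n" for p using that by (auto simp: U_def)
      define t where "t p = (\<Sum>k. a (k + n) * Im (\<xi> (k + n) p))" for p
      have t_le: "\<bar>t p\<bar> \<le> (\<Sum>k. \<bar>a (k + n)\<bar>)" if "p \<in> P n" for p
        unfolding t_def using norm_suminf_le[of "\<lambda>k. a (k + n) * Im (\<xi> (k + n) p)" "\<lambda>k. \<bar>a (k + n)\<bar>"]
          abs_term[OF PU[OF that]] a by (simp add: summable_iff_shift[of "\<lambda>k. \<bar>a k\<bar>"])
      have g_eq: "g p = t p + (\<Sum>k<n. a k * Im (\<xi> k p))" if "p \<in> P n" for p
        unfolding g_def t_def by (rule suminf_split_initial_segment[OF summ[OF PU[OF that]]])
      have "(\<Sum>p\<in>P n. (\<Sum>k<n. a k * Im (\<xi> k p)) * Im (\<xi> j p))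
          = (\<Sum>k<n. a k * (\<Sum>p\<in>P n. Im (\<xi> k p) * Im (\<xi> j p)))"
        by (simp add: sum_distrib_left sum_distrib_right sum.swap[of _ "P n"] mult.assoc)
      also have "\<dots> = (\<Sum>k<n. if k = j then a k * (card (P n) / 2) else 0)"
        using that by (intro sum.cong refl) (auto simp: sum_Im_Im)
      also have "\<dots> = a j * (card (P n) / 2)" using that by simp
      finally have main: "(\<Sum>p\<in>P n. (\<Sum>k<n. a k * Im (\<xi> k p)) * Im (\<xi> j p)) = a j * (card (P n) / 2)" .
      have "(\<Sum>p\<in>P n. f (\<tau> p) * Im (\<xi> j p))
          = (\<Sum>p\<in>P n. t p * Im (\<xi> j p) + (\<Sum>k<n. a k * Im (\<xi> k p)) * Im (\<xi> j p))"
        by (intro sum.cong refl) (simp add: f(2) PU g_eq distrib_right)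
      also have "\<dots> = (\<Sum>p\<in>P n. t p * Im (\<xi> j p)) + a j * (card (P n) / 2)"
        by (simp add: sum.distrib main)
      finally have "coef n f j = 2 / card (P n) * (\<Sum>p\<in>P n. t p * Im (\<xi> j p)) + a j"
        using that card_P_pos[of n] by (simp add: coef_def distrib_left)
      then have "\<bar>a j - coef n f j\<bar> = 2 / card (P n) * \<bar>\<Sum>p\<in>P n. t p * Im (\<xi> j p)\<bar>"
        by (simp add: abs_mult)
      also have "\<dots> \<le> 2 / card (P n) * (\<Sum>p\<in>P n. \<Sum>k. \<bar>a (k + n)\<bar>)"
      proof (intro mult_left_mono order_trans[OF sum_abs] sum_mono)
        fix p assume p: "p \<in> P n"
        have "\<bar>t p * Im (\<xi> j p)\<bar> \<le> \<bar>t p\<bar> * 1"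
          unfolding abs_mult using abs_Re_Im_\<xi>[OF p] by (intro mult_left_mono) auto
        then show "\<bar>t p * Im (\<xi> j p)\<bar> \<le> (\<Sum>k. \<bar>a (k + n)\<bar>)" using t_le[OF p] by simp
      qed simp
      finally show ?thesis using card_P_pos[of n] by simp
    qed
    have "(\<lambda>n. 2 * (\<Sum>k. \<bar>a (k + n)\<bar>)) \<longlonglongrightarrow> 0"
      using tendsto_mult_left[OF suminf_exist_split2[OF a], of 2] by simp
    then show "(\<lambda>n. a j - coef n f j) \<longlonglongrightarrow> 0"
      by (rule Lim_null_comparison[rotated])
         (use tail in \<open>auto simp: eventually_sequentially intro!: exI[of _ "Suc j"]\<close>)
  qed
  ultimately show ?thesis using that by blast
qed

text \<open>
  The surjection is the limit of the coefficient maps along a filter for which all bounded sequences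
  converge. The bound for the finite sums survives the limit, and on the functions of
  \<open>exists_preimage\<close> the limit is an ordinary one.
\<close>

theorem Lip0_onto_ell1:
  "\<exists>T. bounded_linear_map (Lip0_space e) ell1_space T \<and> T ` carr (Lip0_space e) = carr ell1_space"
proof -
  obtain U :: "nat filter" where U: "U \<noteq> bot" "U \<le> sequentially"
    and lim: "\<And>X::nat \<Rightarrow> real. bounded (range X) \<Longrightarrow> \<exists>l. (X \<longlongrightarrow> l) U"
    using exists_limit_filter by blast
  define T where "T f k = (SOME l. ((\<lambda>n. coef n f k) \<longlongrightarrow> l) U)" for f k
  let ?X = "Lip0_space e"
  have T_eqI: "T f k = l" if "((\<lambda>n. coef n f k) \<longlongrightarrow> l) U" for f k l
    unfolding T_def using that by (intro some_equality) (auto intro: tendsto_unique[OF U(1)])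
  have coef_abs: "(\<Sum>k<N. \<bar>coef n f k\<bar>) \<le> (4 * C + 2) * vnorm ?X f" if "f \<in> carr ?X" for f n N
    using that by (intro sum_abs_coef_le Lip0_lipschitz) (auto simp: Lip0_space_def)
  have T_lim: "((\<lambda>n. coef n f k) \<longlongrightarrow> T f k) U" if "f \<in> carr ?X" for f k
  proof -
    have "\<bar>coef n f k\<bar> \<le> (4 * C + 2) * vnorm ?X f" for n
      using order_trans[OF member_le_sum coef_abs[OF that, where N = "Suc k"]] by simp
    then have "bounded (range (\<lambda>n. coef n f k))" by (auto simp: bounded_iff)
    then obtain l where "((\<lambda>n. coef n f k) \<longlongrightarrow> l) U" using lim by blast
    then show ?thesis using T_eqI by metis
  qed
  have partial: "(\<Sum>k<N. \<bar>T f k\<bar>) \<le> (4 * C + 2) * vnorm ?X f" if "f \<in> carr ?X" for f N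
    using coef_abs[OF that] by (intro tendsto_upperbound[OF tendsto_sum[OF tendsto_rabs[OF T_lim[OF that]]] _ U(1)]) auto
  have summ: "summable (\<lambda>k. \<bar>T f k\<bar>)" if "f \<in> carr ?X" for f
    by (rule bounded_imp_summable[where B = "(4 * C + 2) * vnorm ?X f"])
      (use partial[OF that] in \<open>simp_all only: lessThan_Suc_atMost[symmetric] abs_ge_zero\<close>)
  have add: "T (vadd ?X f g) = vadd ell1_space (T f) (T g)" if "f \<in> carr ?X" "g \<in> carr ?X" for f g
  proof
    fix k
    have "coef n (\<lambda>x. f x + g x) k = coef n f k + coef n g k" for n
      by (simp add: coef_def distrib_left distrib_right sum.distrib)
    then show "T (vadd ?X f g) k = vadd ell1_space (T f) (T g) k"
      using tendsto_add[OF T_lim[OF that(1), of k] T_lim[OF that(2), of k]]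
      by (simp add: Lip0_space_def ell1_space_def T_eqI)
  qed
  have scale: "T (vscale ?X a f) = vscale ell1_space a (T f)" if "f \<in> carr ?X" for a f
  proof
    fix k
    have "coef n (\<lambda>x. a * f x) k = a * coef n f k" for n
      by (simp add: coef_def sum_distrib_left mult_ac)
    then show "T (vscale ?X a f) k = vscale ell1_space a (T f) k"
      using tendsto_mult_left[OF T_lim[OF that, of k], of a]
      by (simp add: Lip0_space_def ell1_space_def T_eqI)
  qed
  have "vnorm ell1_space (T f) \<le> (4 * C + 2) * vnorm ?X f" if "f \<in> carr ?X" for f
    using suminf_le_const[OF summ[OF that] partial[OF that]] by (simp add: ell1_space_def)
  then have "bounded_linear_map ?X ell1_space T"
    using add scale summ by (auto simp: bounded_linear_map_def linear_map_def ell1_space_def)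
  moreover have "a \<in> T ` carr ?X" if "a \<in> carr ell1_space" for a
  proof -
    have "summable (\<lambda>k. \<bar>a k\<bar>)" using that by (simp add: ell1_space_def)
    then obtain f where f: "f \<in> carr ?X" "\<And>k. (\<lambda>n. coef n f k) \<longlonglongrightarrow> a k"
      using exists_preimage[of a] by blast
    have "T f = a" by (rule ext, rule T_eqI, rule tendsto_mono[OF U(2) f(2)])
    then show ?thesis using f(1) by blast
  qed
  moreover have "T f \<in> carr ell1_space" if "f \<in> carr ?X" for f
    using summ[OF that] by (simp add: ell1_space_def)
  ultimately show ?thesis by blast
qed

end

section \<open>Tori spanned by basic sequences\<close>

text \<open>
  A circle is the set of pairs of its real and imaginary parts, so a torus needs two vectors for each
  of its coordinates: \<open>u (2 * i)\<close> and \<open>u (Suc (2 * i))\<close> for \<open>z i\<close>. The real part is diminished by \<open>1\<close> so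
  that trivial coordinates contribute nothing and the neutral element goes to the origin.
\<close>

definition tcoord :: "(nat \<Rightarrow> complex) \<Rightarrow> nat \<Rightarrow> real" where
  "tcoord z j = (if even j then Re (z (j div 2)) - 1 else Im (z (j div 2)))"

definition torus_map :: "(nat \<Rightarrow> 'e::real_normed_vector) \<Rightarrow> (nat \<Rightarrow> complex) \<Rightarrow> 'e" where
  "torus_map u z = (\<Sum>j | tcoord z j \<noteq> 0. tcoord z j *\<^sub>R u j)"

definition torus_points :: "nat \<Rightarrow> nat \<Rightarrow> (nat \<Rightarrow> complex) set" where
  "torus_points N m = {z. \<forall>i. (i \<in> {..<N} \<longrightarrow> z i \<in> {w. w ^ m = 1}) \<and> (i \<notin> {..<N} \<longrightarrow> z i = 1)}"

lemma finite_torus_points: "m > 0 \<Longrightarrow> finite (torus_points N m)"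
  unfolding torus_points_def by (intro finite_set_of_finite_funs finite_roots_unity) auto

lemma one_in_torus_points: "(\<lambda>_. 1) \<in> torus_points N m"
  by (simp add: torus_points_def)

lemma norm_torus_points: "z \<in> torus_points N m \<Longrightarrow> m > 0 \<Longrightarrow> norm (z i) = 1"
proof (cases "i < N")
  case True
  assume "z \<in> torus_points N m" "m > 0"
  then have "norm (z i) ^ m = 1" using True by (simp add: torus_points_def flip: norm_power)
  then show ?thesis using \<open>m > 0\<close> power_eq_imp_eq_base[of "norm (z i)" m 1] by simp
qed (simp add: torus_points_def)

lemma torus_points_outside: "z \<in> torus_points N m \<Longrightarrow> N \<le> i \<Longrightarrow> z i = 1"
  by (simp add: torus_points_def)

lemma torus_map_eq:
  assumes "\<And>i. N \<le> i \<Longrightarrow> z i = 1"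
  shows "torus_map u z = (\<Sum>j<2 * N. tcoord z j *\<^sub>R u j)"
proof -
  have "tcoord z j = 0" if "j \<ge> 2 * N" for j
    using assms[of "j div 2"] that by (auto simp: tcoord_def)
  then show ?thesis
    unfolding torus_map_def by (intro sum.mono_neutral_left) (auto simp: not_le[symmetric])
qed

lemma torus_map_diff:
  assumes "\<And>i. N \<le> i \<Longrightarrow> z i = 1" "\<And>i. M \<le> i \<Longrightarrow> w i = 1" "N \<le> K" "M \<le> K"
  shows "torus_map u z - torus_map u w = (\<Sum>j<2 * K. (tcoord z j - tcoord w j) *\<^sub>R u j)"
  using torus_map_eq[of K z u] torus_map_eq[of K w u] assms
  by (simp add: scaleR_diff_left sum_subtractf)

lemma abs_tcoord_diff_le: "\<bar>tcoord z j - tcoord w j\<bar> \<le> norm (z (j div 2) - w (j div 2))"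
  using abs_Re_le_cmod[of "z (j div 2) - w (j div 2)"] abs_Im_le_cmod[of "z (j div 2) - w (j div 2)"]
  by (auto simp: tcoord_def)

lemma sum_even_odd: "(\<Sum>j<2 * N. g j) = (\<Sum>i<N. g (2 * i) + g (Suc (2 * i)) :: real)"
  by (induction N) auto

lemma sum_norm_diff_le:
  "(\<Sum>i<N. norm (z i - w i)) \<le> (\<Sum>j<2 * N. \<bar>tcoord z j - tcoord w j\<bar>)"
  unfolding sum_even_odd
  by (intro sum_mono order_trans[OF cmod_le]) (simp add: tcoord_def)

lemma norm_cis_minus_one_le: "norm (cis x - 1) \<le> 2 * \<bar>x\<bar>"
proof -
  have "\<bar>1 - cos x\<bar> = 2 * (\<bar>sin (x / 2)\<bar> * \<bar>sin (x / 2)\<bar>)"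
    using cos_double_sin[of "x / 2"] by (simp add: power2_eq_square abs_mult)
  also have "\<dots> \<le> 2 * (\<bar>x / 2\<bar> * 1)"
    by (intro mult_left_mono mult_mono abs_sin_x_le_abs_x abs_sin_le_one) auto
  finally have "\<bar>Re (cis x - 1)\<bar> \<le> \<bar>x\<bar>" by (simp add: abs_minus_commute)
  moreover have "\<bar>Im (cis x - 1)\<bar> \<le> \<bar>x\<bar>" by (simp add: abs_sin_x_le_abs_x)
  ultimately show ?thesis using cmod_le[of "cis x - 1"] by linarith
qed

text \<open>The grids consist of \<open>m n\<close>-th roots of unity, so \<open>2 * pi / m n\<close> is the angle of a single step.\<close>

lemma exists_mesh:
  fixes B :: "nat \<Rightarrow> real"
  obtains m :: "nat \<Rightarrow> nat" where "\<And>n. m n > 0" "\<And>n. 2 * pi / m n \<le> 1" "\<And>n. B n * (2 * pi / m n) \<le> 1"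
proof -
  have "\<exists>m::nat. (0::nat) < m \<and> 2 * pi / m \<le> 1 \<and> B n * (2 * pi / m) \<le> 1" for n
  proof -
    obtain m :: nat where m: "2 * pi * (1 + \<bar>B n\<bar>) \<le> m" using real_arch_simple by blast
    have pos: "0 < 2 * pi * (1 + \<bar>B n\<bar>)" by (simp add: add_pos_nonneg)
    then have "real m > 0" using m by linarith
    then have "m > 0" by simp
    moreover have "2 * pi \<le> m" using m by (simp add: algebra_simps) (smt (verit) mult_nonneg_nonneg pi_ge_zero abs_ge_zero)
    moreover have "B n * (2 * pi) \<le> m"
    proof -
      have "B n * (2 * pi) \<le> \<bar>B n\<bar> * (2 * pi)" by (intro mult_right_mono) auto
      moreover have "\<bar>B n\<bar> * (2 * pi) \<le> 2 * pi * (1 + \<bar>B n\<bar>)" by (simp add: algebra_simps)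
      ultimately show ?thesis using m by linarith
    qed
    ultimately show ?thesis by (auto simp: divide_le_eq)
  qed
  then show ?thesis using that by metis
qed

lemma mult_cis_root_of_unity:
  assumes "w ^ m = 1" "m > 0"
  shows "(w * cis (2 * pi / m)) ^ m = 1" "(w * cis (- (2 * pi / m))) ^ m = 1"
proof -
  have "cis (2 * pi / m) ^ m = 1" using assms by (simp add: Complex.DeMoivre)
  then show "(w * cis (2 * pi / m)) ^ m = 1" "(w * cis (- (2 * pi / m))) ^ m = 1"
    using assms by (simp_all add: power_mult_distrib power_inverse flip: cis_inverse)
qed

text \<open>
  In the maximum norm it costs no more to turn all coordinates of the torus than to turn one. Hence
  the coordinates themselves serve as characters.
\<close>

lemma Lip0_onto_ell1_if_c0_sequence:
  fixes u :: "nat \<Rightarrow> 'e::real_normed_vector"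
  assumes upper: "\<And>a m b. (\<And>i. i < m \<Longrightarrow> \<bar>a i\<bar> \<le> b) \<Longrightarrow> 0 \<le> b \<Longrightarrow> norm (\<Sum>i<m. a i *\<^sub>R u i) \<le> B * b"
    and lower: "\<And>a m i. i < m \<Longrightarrow> c * \<bar>a i\<bar> \<le> norm (\<Sum>i<m. a i *\<^sub>R u i)" and c: "c > 0"
  shows "\<exists>T. bounded_linear_map (Lip0_space (0::'e)) ell1_space T \<and>
             T ` carr (Lip0_space (0::'e)) = carr ell1_space"
proof -
  have B: "0 \<le> B" using upper[of 0 "\<lambda>_. 0" 1] by simp
  obtain m :: "nat \<Rightarrow> nat" where m: "\<And>n. m n > 0" "\<And>n. 2 * pi / m n \<le> 1"
      "\<And>n. 2 ^ n * (B * 2) * (2 * pi / m n) \<le> 1"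
    using exists_mesh[of "\<lambda>n. 2 ^ n * (B * 2)"] by blast
  define h where "h n = 2 * pi / m n" for n
  define P where "P n = torus_points n (m n)" for n
  define s where "s n A z i = (if i < n then z i * cis (if i \<in> A then h n else - h n) else z i)"
    for n A and z :: "nat \<Rightarrow> complex" and i
  have s_P: "s n A z \<in> P n" if "z \<in> P n" for n A z
    using that m(1)[of n] mult_cis_root_of_unity[of _ "m n"]
    by (auto simp: P_def torus_points_def s_def h_def)
  have unit: "norm (z i) = 1" if "z \<in> P n" for z n i
    using that norm_torus_points[OF _ m(1)] by (simp add: P_def)
  interpret torus_system "0::'e" "torus_map u" "\<lambda>k z. z k" P s h "\<lambda>_. B * 2" "2 / c" "B * 2"
  proof
    show "finite (P n)" for n
      using finite_torus_points[OF m(1)] by (simp add: P_def)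
    show "P n \<noteq> {}" for n
      using one_in_torus_points unfolding P_def by blast
    show "norm (p k) = 1" if "p \<in> P n" for p n k
      using unit that by simp
    show "0 \<le> 2 / c" "0 \<le> B * 2" using c B by auto
    show "0 < h n" "h n \<le> 1" "2 ^ n * (B * 2) * h n \<le> 1" for n
      using m by (auto simp: h_def)
    show "cmod (p k - q k) \<le> 2 / c * dist (torus_map u p) (torus_map u q)"
      if "p \<in> P n" "q \<in> P l" for p n q l k
    proof -
      define K where "K = Suc (max (max n l) k)"
      have "torus_map u p - torus_map u q = (\<Sum>j<2 * K. (tcoord p j - tcoord q j) *\<^sub>R u j)"
        using that torus_points_outside
        by (intro torus_map_diff[of n _ l]) (auto simp: P_def K_def)
      then have "c * \<bar>tcoord p j - tcoord q j\<bar> \<le> dist (torus_map u p) (torus_map u q)" if "j < 2 * K" for j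
        using lower[OF that, of "\<lambda>j. tcoord p j - tcoord q j"] by (simp add: dist_norm)
      moreover have "2 * k < 2 * K" "Suc (2 * k) < 2 * K" by (auto simp: K_def)
      ultimately have "c * \<bar>tcoord p (2 * k) - tcoord q (2 * k)\<bar> \<le> dist (torus_map u p) (torus_map u q)"
        "c * \<bar>tcoord p (Suc (2 * k)) - tcoord q (Suc (2 * k))\<bar> \<le> dist (torus_map u p) (torus_map u q)"
        by blast+
      then have "c * (\<bar>Re (p k - q k)\<bar> + \<bar>Im (p k - q k)\<bar>) \<le> 2 * dist (torus_map u p) (torus_map u q)"
        by (simp add: tcoord_def distrib_left)
      moreover have "c * cmod (p k - q k) \<le> c * (\<bar>Re (p k - q k)\<bar> + \<bar>Im (p k - q k)\<bar>)"
        using c cmod_le[of "p k - q k"] by (intro mult_left_mono) auto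
      ultimately show ?thesis using c by (simp add: field_simps)
    qed
    show "bij_betw (s n A) (P n) (P n)" for n A
    proof (rule bij_betw_byWitness[where f' = "s n (- A)"])
      show "\<forall>a\<in>P n. s n (- A) (s n A a) = a" "\<forall>a\<in>P n. s n A (s n (- A) a) = a"
        by (auto simp: s_def fun_eq_iff mult.assoc cis_mult)
    qed (use s_P in auto)
    show "s n A p k = p k * cis (if k \<in> A then h n else - h n)" if "k < n" for n A p k
      using that by (simp add: s_def)
    have diff: "dist (torus_map u p) (torus_map u q) \<le> B * b"
      if "p \<in> P n" "q \<in> P n" "\<And>i. cmod (p i - q i) \<le> b" "0 \<le> b" for p q n b
    proof -
      have "torus_map u p - torus_map u q = (\<Sum>j<2 * n. (tcoord p j - tcoord q j) *\<^sub>R u j)"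
        using that(1,2) torus_points_outside by (intro torus_map_diff[of n _ n]) (auto simp: P_def)
      moreover have "\<bar>tcoord p j - tcoord q j\<bar> \<le> b" for j
        using abs_tcoord_diff_le[of p j q] that(3)[of "j div 2"] by linarith
      ultimately show ?thesis
        unfolding dist_norm using that(4) by (simp add: upper)
    qed
    have one: "torus_map u (\<lambda>_. 1) = 0" by (simp add: torus_map_def tcoord_def)
    show "dist (torus_map u (s n A p)) (torus_map u p) \<le> B * 2 * h n" if "p \<in> P n" for n A p
    proof -
      have h_pos: "0 < h n" using m(1)[of n] by (simp add: h_def)
      have "cmod (s n A p i - p i) \<le> 2 * h n" for i
      proof -
        have "cmod (s n A p i - p i) = cmod (p i * (cis (if i \<in> A then h n else - h n) - 1))" if "i < n"
          using that by (simp add: s_def algebra_simps)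
        then show ?thesis
          using norm_cis_minus_one_le[of "if i \<in> A then h n else - h n"] unit[OF \<open>p \<in> P n\<close>] h_pos
          by (cases "i < n") (auto simp: norm_mult s_def split: if_splits)
      qed
      then have "dist (torus_map u (s n A p)) (torus_map u p) \<le> B * (2 * h n)"
        using h_pos by (intro diff[OF s_P[OF that] that]) auto
      then show ?thesis by simp
    qed
    show "dist (torus_map u p) 0 \<le> B * 2" if "p \<in> P n" for p n
    proof -
      have "cmod (p i - 1) \<le> 2" for i using norm_triangle_ineq4[of "p i" 1] unit[OF that] by simp
      then have "dist (torus_map u p) (torus_map u (\<lambda>_. 1)) \<le> B * 2"
        using that one_in_torus_points by (intro diff[of _ n]) (auto simp: P_def)
      then show ?thesis by (simp add: one)
    qed
    show "\<exists>p\<in>P n. torus_map u p = 0 \<and> (\<forall>k. p k = 1)" for n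
      using one one_in_torus_points by (intro bexI[of _ "\<lambda>_. 1"]) (auto simp: P_def)
  qed
  show ?thesis by (rule Lip0_onto_ell1)
qed

text \<open>
  For an \<open>\<ell>\<^sub>1\<close> sequence only one coordinate may be turned. The coordinate \<open>set_encode A\<close> is reserved for
  the sign pattern \<open>A\<close>: the \<open>k\<close>-th character contains it as it is if \<open>k \<in> A\<close> and conjugated otherwise,
  so that turning it forward turns the \<open>k\<close>-th character forward or backward as \<open>A\<close> prescribes. The
  characters are Lipschitz because a product of unimodular numbers changes at most by the sum of the
  changes of its factors, which the \<open>\<ell>\<^sub>1\<close> norm dominates.
\<close>

definition twist :: "nat \<Rightarrow> nat \<Rightarrow> complex \<Rightarrow> complex" where
  "twist k i w = (if k \<in> set_decode i then w else cnj w)"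

definition tchar :: "nat \<Rightarrow> (nat \<Rightarrow> complex) \<Rightarrow> complex" where
  "tchar k z = (\<Prod>i | z i \<noteq> 1. twist k i (z i))"

lemma twist_simps:
  "twist k i 1 = 1" "norm (twist k i w) = norm w" "twist k i w - twist k i v = twist k i (w - v)"
  "twist k i (w * v) = twist k i w * twist k i v"
  by (auto simp: twist_def)

lemma tchar_eq:
  assumes "\<And>i. N \<le> i \<Longrightarrow> z i = 1"
  shows "tchar k z = (\<Prod>i<N. twist k i (z i))"
  unfolding tchar_def
  by (intro prod.mono_neutral_left) (use assms in \<open>auto simp: twist_simps not_le[symmetric]\<close>)

lemma set_encode_less: "A \<subseteq> {..<n} \<Longrightarrow> set_encode A < 2 ^ n"
proof -
  assume "A \<subseteq> {..<n}"
  then have "set_encode A \<le> (\<Sum>i<n. 2 ^ i)" unfolding set_encode_def by (intro sum_mono2) auto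
  also have "\<dots> < (2::nat) ^ n" by (induction n) auto
  finally show ?thesis .
qed

lemma Lip0_onto_ell1_if_ell1_sequence:
  fixes u :: "nat \<Rightarrow> 'e::real_normed_vector"
  assumes upper: "\<And>i. norm (u i) \<le> B"
    and lower: "\<And>a m. c * (\<Sum>i<m. \<bar>a i\<bar>) \<le> norm (\<Sum>i<m. a i *\<^sub>R u i)" and c: "c > 0"
  shows "\<exists>T. bounded_linear_map (Lip0_space (0::'e)) ell1_space T \<and>
             T ` carr (Lip0_space (0::'e)) = carr ell1_space"
proof -
  have B: "0 \<le> B" using upper[of 0] norm_ge_zero order_trans by blast
  define D where "D n = B * (2 * (2 * 2 ^ n))" for n :: nat
  obtain m :: "nat \<Rightarrow> nat" where m: "\<And>n. m n > 0" "\<And>n. 2 * pi / m n \<le> 1"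
      "\<And>n. 2 ^ n * D n * (2 * pi / m n) \<le> 1"
    using exists_mesh[of "\<lambda>n. 2 ^ n * D n"] by blast
  define h where "h n = 2 * pi / m n" for n
  have h_pos: "0 < h n" for n using m(1)[of n] by (simp add: h_def)
  define P where "P n = torus_points (2 ^ n) (m n)" for n
  define s where "s n A z = z(set_encode A := z (set_encode A) * cis (h n))"
    for n A and z :: "nat \<Rightarrow> complex"
  define s' where "s' n A z = z(set_encode A := z (set_encode A) * cis (- h n))"
    for n A and z :: "nat \<Rightarrow> complex"
  have s_P: "s n A z \<in> P n" "s' n A z \<in> P n" if "z \<in> P n" "A \<subseteq> {..<n}" for n A z
    using that m(1)[of n] mult_cis_root_of_unity[of _ "m n"] set_encode_less[OF that(2)]
    by (auto simp: P_def torus_points_def s_def s'_def h_def)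
  have unit: "norm (z i) = 1" if "z \<in> P n" for z n i
    using that norm_torus_points[OF _ m(1)] by (simp add: P_def)
  have outside: "z i = 1" if "z \<in> P n" "2 ^ n \<le> i" for z n i
    using that torus_points_outside by (auto simp: P_def)
  interpret torus_system "0::'e" "torus_map u" tchar P s h D "1 / c" "B * 4"
  proof
    show "finite (P n)" for n
      using finite_torus_points[OF m(1)] by (simp add: P_def)
    show "P n \<noteq> {}" for n
      using one_in_torus_points unfolding P_def by blast
    show "norm (tchar k p) = 1" if "p \<in> P n" for p n k
      unfolding tchar_def using unit[OF that] by (simp add: prod_norm[symmetric] twist_simps)
    show "0 \<le> 1 / c" "0 \<le> B * 4" using c B by auto
    show "0 < h n" "h n \<le> 1" "2 ^ n * D n * h n \<le> 1" for n
      using m h_pos by (auto simp: h_def)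
    show "cmod (tchar k p - tchar k q) \<le> 1 / c * dist (torus_map u p) (torus_map u q)"
      if "p \<in> P n" "q \<in> P l" for p n q l k
    proof -
      define K :: nat where "K = max (2 ^ n) (2 ^ l)"
      have "cmod (tchar k p - tchar k q) = cmod ((\<Prod>i<K. twist k i (p i)) - (\<Prod>i<K. twist k i (q i)))"
        using that outside by (subst (1 2) tchar_eq[of K]) (auto simp: K_def)
      also have "\<dots> \<le> (\<Sum>i<K. cmod (twist k i (p i) - twist k i (q i)))"
        using that unit by (intro norm_prod_diff) (auto simp: twist_simps)
      also have "\<dots> = (\<Sum>i<K. cmod (p i - q i))" by (simp add: twist_simps)
      also have "\<dots> \<le> (\<Sum>j<2 * K. \<bar>tcoord p j - tcoord q j\<bar>)" by (rule sum_norm_diff_le)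
      finally have 1: "cmod (tchar k p - tchar k q) \<le> (\<Sum>j<2 * K. \<bar>tcoord p j - tcoord q j\<bar>)" .
      have "torus_map u p - torus_map u q = (\<Sum>j<2 * K. (tcoord p j - tcoord q j) *\<^sub>R u j)"
        using that outside by (intro torus_map_diff[of "2 ^ n" _ "2 ^ l"]) (auto simp: K_def)
      then have "c * (\<Sum>j<2 * K. \<bar>tcoord p j - tcoord q j\<bar>) \<le> dist (torus_map u p) (torus_map u q)"
        using lower[of "\<lambda>j. tcoord p j - tcoord q j" "2 * K"] by (simp add: dist_norm)
      then have "(\<Sum>j<2 * K. \<bar>tcoord p j - tcoord q j\<bar>) \<le> 1 / c * dist (torus_map u p) (torus_map u q)"
        using c by (simp add: field_simps)
      with 1 show ?thesis by linarith
    qed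
    show "bij_betw (s n A) (P n) (P n)" if "A \<subseteq> {..<n}" for n A
    proof (rule bij_betw_byWitness[where f' = "s' n A"])
      show "\<forall>a\<in>P n. s' n A (s n A a) = a" "\<forall>a\<in>P n. s n A (s' n A a) = a"
        by (auto simp: s_def s'_def fun_eq_iff mult.assoc cis_mult)
    qed (use s_P that in auto)
    show "tchar k (s n A p) = tchar k p * cis (if k \<in> A then h n else - h n)"
      if "A \<subseteq> {..<n}" "p \<in> P n" "k < n" for n A p k
    proof -
      define i where "i = set_encode A"
      have i: "i \<in> {..<2 ^ n}" using set_encode_less[OF that(1)] by (simp add: i_def)
      have "set_decode i = A"
        using finite_subset[OF that(1)] by (simp add: i_def)
      then have tw: "twist k i (cis (h n)) = cis (if k \<in> A then h n else - h n)"
        by (simp add: twist_def cis_cnj)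
      have "tchar k (s n A p) = (\<Prod>j<2 ^ n. twist k j (s n A p j))"
        by (intro tchar_eq outside[OF s_P(1)[OF that(2,1)]])
      also have "\<dots> = twist k i (p i * cis (h n)) * (\<Prod>j\<in>{..<2 ^ n} - {i}. twist k j (s n A p j))"
        by (subst prod.remove[OF _ i]) (auto simp: s_def i_def)
      also have "(\<Prod>j\<in>{..<2 ^ n} - {i}. twist k j (s n A p j)) = (\<Prod>j\<in>{..<2 ^ n} - {i}. twist k j (p j))"
        by (intro prod.cong) (auto simp: s_def i_def)
      also have "twist k i (p i * cis (h n)) * (\<Prod>j\<in>{..<2 ^ n} - {i}. twist k j (p j))
          = (\<Prod>j<2 ^ n. twist k j (p j)) * twist k i (cis (h n))"
        by (subst prod.remove[OF _ i, of "\<lambda>j. twist k j (p j)"]) (auto simp: twist_simps)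
      also have "(\<Prod>j<2 ^ n. twist k j (p j)) = tchar k p"
        by (intro tchar_eq[symmetric] outside[OF that(2)])
      finally show ?thesis by (simp add: tw)
    qed
    have diff: "dist (torus_map u p) (torus_map u q) \<le> B * (2 * (\<Sum>i<2 ^ n. cmod (p i - q i)))"
      if "p \<in> P n" "q \<in> P n" for p q n
    proof -
      have "torus_map u p - torus_map u q = (\<Sum>j<2 * 2 ^ n. (tcoord p j - tcoord q j) *\<^sub>R u j)"
        using that outside by (intro torus_map_diff[of "2 ^ n" _ "2 ^ n"]) auto
      also have "norm \<dots> \<le> (\<Sum>j<2 * 2 ^ n. cmod (p (j div 2) - q (j div 2)) * B)"
        by (rule sum_norm_le) (auto intro!: mult_mono abs_tcoord_diff_le upper)
      also have "\<dots> = B * (2 * (\<Sum>i<2 ^ n. cmod (p i - q i)))"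
        by (simp add: sum_even_odd sum_distrib_left algebra_simps)
      finally show ?thesis by (simp add: dist_norm)
    qed
    have one: "torus_map u (\<lambda>_. 1) = 0" by (simp add: torus_map_def tcoord_def)
    show "dist (torus_map u (s n A p)) (torus_map u p) \<le> B * 4 * h n"
      if "A \<subseteq> {..<n}" "p \<in> P n" for n A p
    proof -
      define i where "i = set_encode A"
      have i: "i < 2 ^ n" using set_encode_less[OF that(1)] by (simp add: i_def)
      have "s n A p j - p j = (if j = i then p i * (cis (h n) - 1) else 0)" for j
        by (simp add: s_def i_def algebra_simps)
      then have "cmod (s n A p j - p j) = (if j = i then cmod (cis (h n) - 1) else 0)" for j
        using unit[OF that(2)] by (simp add: norm_mult)
      then have "(\<Sum>j<2 ^ n. cmod (s n A p j - p j)) = cmod (cis (h n) - 1)"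
        using i by simp
      also have "\<dots> \<le> 2 * h n" using norm_cis_minus_one_le[of "h n"] h_pos[of n] by simp
      finally have "B * (2 * (\<Sum>j<2 ^ n. cmod (s n A p j - p j))) \<le> B * (2 * (2 * h n))"
        using B by (intro mult_left_mono) auto
      then show ?thesis using diff[OF s_P(1)[OF that(2,1)] that(2)] by simp
    qed
    show "dist (torus_map u p) 0 \<le> D n" if "p \<in> P n" for p n
    proof -
      have "cmod (p i - 1) \<le> 2" for i using norm_triangle_ineq4[of "p i" 1] unit[OF that] by simp
      then have "(\<Sum>i<2 ^ n. cmod (p i - 1)) \<le> (\<Sum>i<(2::nat) ^ n. 2)" by (intro sum_mono)
      then have "B * (2 * (\<Sum>i<2 ^ n. cmod (p i - 1))) \<le> D n"
        unfolding D_def using B by (intro mult_left_mono) auto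
      then show ?thesis
        using diff[OF that, of "\<lambda>_. 1"] one_in_torus_points by (simp add: one P_def)
    qed
    show "\<exists>p\<in>P n. torus_map u p = 0 \<and> (\<forall>k. tchar k p = 1)" for n
      using one one_in_torus_points by (intro bexI[of _ "\<lambda>_. 1"]) (auto simp: P_def tchar_def)
  qed
  show ?thesis by (rule Lip0_onto_ell1)
qed

section \<open>Basic sequences and linear combinations\<close>

text \<open>Linear combinations with respect to the operations of a record: \<open>lsum X a u m\<close> is
  \<open>\<Sum>i<m. a i * u i\<close>.\<close>

primrec lsum :: "'a nspace \<Rightarrow> (nat \<Rightarrow> real) \<Rightarrow> (nat \<Rightarrow> 'a) \<Rightarrow> nat \<Rightarrow> 'a" where
  "lsum X a u 0 = vzero X"
| "lsum X a u (Suc m) = vadd X (lsum X a u m) (vscale X (a m) (u m))"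

definition has_ell1_sequence :: "'a nspace \<Rightarrow> bool" where
  "has_ell1_sequence X \<longleftrightarrow> (\<exists>u B c. (\<forall>i. u i \<in> carr X \<and> vnorm X (u i) \<le> B) \<and> c > 0 \<and>
     (\<forall>a m. c * (\<Sum>i<m. \<bar>a i\<bar>) \<le> vnorm X (lsum X a u m)))"

definition has_c0_sequence :: "'a nspace \<Rightarrow> bool" where
  "has_c0_sequence X \<longleftrightarrow> (\<exists>u B c. (\<forall>i. u i \<in> carr X) \<and> c > 0 \<and>
     (\<forall>a m b. 0 \<le> b \<longrightarrow> (\<forall>i<m. \<bar>a i\<bar> \<le> b) \<longrightarrow> vnorm X (lsum X a u m) \<le> B * b) \<and>
     (\<forall>a m. \<forall>i<m. c * \<bar>a i\<bar> \<le> vnorm X (lsum X a u m)))"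

text \<open>
  Dimension is bounded through the dependence of \<open>p + 1\<close> vectors, a property that passes along linear
  injections without any choice of bases.
\<close>

definition finite_dimensional :: "'a nspace \<Rightarrow> bool" where
  "finite_dimensional X \<longleftrightarrow> (\<exists>p. \<forall>u. (\<forall>i. u i \<in> carr X) \<longrightarrow>
     (\<exists>a. (\<exists>i<Suc p. a i \<noteq> 0) \<and> lsum X a u (Suc p) = vzero X))"

text \<open>
  The property that makes linear maps into \<open>X\<close> send empty linear combinations to \<open>vzero X\<close>; it is
  immediate for all the concrete spaces.
\<close>

definition zero_scaling :: "'a nspace \<Rightarrow> bool" where
  "zero_scaling X \<longleftrightarrow> (\<forall>x\<in>carr X. vscale X 0 x = vzero X)"

context normed_space
begin

lemma scale_zero: "x \<in> carr X \<Longrightarrow> vscale X 0 x = vzero X"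
  using scale_add_left[of x 1 "-1"] by (simp add: scale_one add_neg)

lemma zero_scaling: "zero_scaling X"
  by (simp add: zero_scaling_def scale_zero)

lemma scale_vzero: "vscale X a (vzero X) = vzero X"
  using scale_scale[OF zero_closed, of a 0] by (simp add: scale_zero zero_closed)

lemma norm_zero: "vnorm X (vzero X) = 0"
  by (simp add: norm_eq_zero zero_closed)

lemma norm_nonneg: "x \<in> carr X \<Longrightarrow> 0 \<le> vnorm X x"
  using norm_triangle[of x "vscale X (-1) x"] by (simp add: add_neg norm_zero scale_closed norm_scale)

lemma zero_add: "x \<in> carr X \<Longrightarrow> vadd X (vzero X) x = x"
  using add_commute[OF zero_closed] add_zero by simp

lemma add_left_commute:
  "x \<in> carr X \<Longrightarrow> y \<in> carr X \<Longrightarrow> z \<in> carr X \<Longrightarrow> vadd X x (vadd X y z) = vadd X y (vadd X x z)"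
  by (metis add_assoc add_commute)

lemmas vs = add_closed zero_closed scale_closed add_zero zero_add add_assoc add_left_commute
  scale_add_right scale_scale scale_one scale_zero scale_vzero

lemma neg_add: "x \<in> carr X \<Longrightarrow> vadd X (vscale X (-1) x) x = vzero X"
  using add_commute[of "vscale X (-1) x" x] by (simp add: vs add_neg)

lemma lsum_closed: "(\<And>i. i < m \<Longrightarrow> u i \<in> carr X) \<Longrightarrow> lsum X a u m \<in> carr X"
  by (induction m) (auto simp: vs)

lemma lsum_add:
  assumes "\<And>i. i < m \<Longrightarrow> u i \<in> carr X"
  shows "lsum X (\<lambda>i. a i + b i) u m = vadd X (lsum X a u m) (lsum X b u m)"
  using assms
proof (induction m)
  case (Suc m)
  then show ?case
    using lsum_closed[of m u a] lsum_closed[of m u b]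
    by (simp add: vs scale_add_left add_commute)
qed (simp add: vs)

lemma lsum_scale:
  assumes "\<And>i. i < m \<Longrightarrow> u i \<in> carr X"
  shows "lsum X (\<lambda>i. r * a i) u m = vscale X r (lsum X a u m)"
  using assms
  by (induction m) (auto simp: vs lsum_closed)

lemma lsum_pad:
  assumes "\<And>i. u i \<in> carr X" "m \<le> m'" "\<And>i. m \<le> i \<Longrightarrow> a i = 0"
  shows "lsum X a u m' = lsum X a u m"
  using assms(2,1,3)
  by (induction m' rule: dec_induct) (auto simp: vs lsum_closed)

lemma lsum_cong: "(\<And>i. i < m \<Longrightarrow> a i = b i) \<Longrightarrow> lsum X a u m = lsum X b u m"
  by (induction m) auto

lemma lsum_single:
  assumes "\<And>i. u i \<in> carr X"
  shows "lsum X (\<lambda>j. if j = i then 1 else 0) u (Suc i) = u i"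
proof -
  have "lsum X (\<lambda>j. if j = i then 1 else 0) u i = lsum X (\<lambda>_. 0 * 1) u i" by (intro lsum_cong) auto
  also have "\<dots> = vzero X" using assms by (subst lsum_scale) (auto simp: scale_zero lsum_closed)
  finally show ?thesis using assms by (simp add: vs)
qed

end

section \<open>Hahn--Banach\<close>

definition sublinear :: "'a nspace \<Rightarrow> ('a \<Rightarrow> real) \<Rightarrow> bool" where
  "sublinear X q \<longleftrightarrow> (\<forall>x\<in>carr X. \<forall>y\<in>carr X. q (vadd X x y) \<le> q x + q y) \<and>
     (\<forall>x\<in>carr X. \<forall>t\<ge>0. q (vscale X t x) \<le> t * q x)"

context normed_space
begin

lemma sublinear_zero: "sublinear X q \<Longrightarrow> q (vzero X) = 0"
proof -
  assume q: "sublinear X q"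
  have "q (vscale X 0 (vzero X)) \<le> 0 * q (vzero X)"
    using q zero_closed unfolding sublinear_def by blast
  moreover have "q (vadd X (vzero X) (vzero X)) \<le> q (vzero X) + q (vzero X)"
    using q zero_closed unfolding sublinear_def by blast
  ultimately show ?thesis by (simp add: vs)
qed

lemma sublinear_scale: "sublinear X q \<Longrightarrow> x \<in> carr X \<Longrightarrow> 0 \<le> t \<Longrightarrow> q (vscale X t x) = t * q x"
proof (cases "t = 0")
  assume *: "sublinear X q" "x \<in> carr X" "0 \<le> t" "t \<noteq> 0"
  then have le: "q (vscale X r y) \<le> r * q y" if "y \<in> carr X" "0 \<le> r" for y r
    using that unfolding sublinear_def by blast
  have "q (vscale X (1 / t) (vscale X t x)) \<le> (1 / t) * q (vscale X t x)"
    using * by (intro le) (auto simp: vs)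
  then have "t * q x \<le> q (vscale X t x)" using * by (simp add: vs field_simps)
  then show ?thesis using le[of x t] * by (simp add: order_antisym)
qed (simp add: vs sublinear_zero)

lemma sublinear_lower:
  assumes q: "sublinear X q" and "x \<in> carr X"
  shows "- q (vscale X (-1) x) \<le> q x"
proof -
  have "q (vadd X x (vscale X (-1) x)) \<le> q x + q (vscale X (-1) x)"
    using assms scale_closed unfolding sublinear_def by blast
  then show ?thesis using assms by (simp add: add_neg sublinear_zero[OF q])
qed

lemma sublinear_INF_chain:
  assumes ne: "C \<noteq> {}" and sub: "\<And>q. q \<in> C \<Longrightarrow> sublinear X q"
    and chain: "\<And>q r. q \<in> C \<Longrightarrow> r \<in> C \<Longrightarrow> (\<forall>x. q x \<le> r x) \<or> (\<forall>x. r x \<le> q x)"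
    and bdd: "\<And>x. x \<in> carr X \<Longrightarrow> bdd_below ((\<lambda>q. q x) ` C)"
  shows "sublinear X (\<lambda>x. INF q\<in>C. q x)"
  unfolding sublinear_def
proof (intro conjI ballI allI impI)
  let ?I = "\<lambda>x. INF q\<in>C. q x"
  fix x assume x: "x \<in> carr X"
  { fix y assume y: "y \<in> carr X"
    have "?I (vadd X x y) - q x \<le> ?I y" if q: "q \<in> C" for q
    proof (rule cINF_greatest[OF ne])
      fix r assume "r \<in> C"
      then obtain p where p: "p \<in> C" "p x \<le> q x" "p y \<le> r y"
        using chain[OF q \<open>r \<in> C\<close>] q by (metis order_refl)
      have "?I (vadd X x y) \<le> p (vadd X x y)" using p(1) bdd x y by (intro cINF_lower) (auto simp: vs)
      also have "\<dots> \<le> p x + p y" using sub[OF p(1)] x y unfolding sublinear_def by blast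
      finally show "?I (vadd X x y) - q x \<le> r y" using p by linarith
    qed
    then have "?I (vadd X x y) - ?I y \<le> q x" if "q \<in> C" for q using that by (simp add: algebra_simps)
    then have "?I (vadd X x y) - ?I y \<le> ?I x" by (rule cINF_greatest[OF ne])
    then show "?I (vadd X x y) \<le> ?I x + ?I y" by simp }
  fix t :: real assume t: "0 \<le> t"
  have le: "?I (vscale X t x) \<le> t * q x" if "q \<in> C" for q
  proof -
    have "?I (vscale X t x) \<le> q (vscale X t x)" using that bdd x by (intro cINF_lower) (auto simp: vs)
    then show ?thesis using sub[OF that] x t by (simp add: sublinear_scale)
  qed
  show "?I (vscale X t x) \<le> t * ?I x"
  proof (cases "t = 0")
    case True
    then show ?thesis using le ne by fastforce
  next
    case False
    then have "?I (vscale X t x) / t \<le> ?I x"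
      using le t by (intro cINF_greatest[OF ne]) (simp add: field_simps)
    then show ?thesis using False t by (simp add: field_simps)
  qed
qed

text \<open>
  For fixed \<open>z\<close>, the functional \<open>r x = (INF t\<in>{0..}. q (x + t * z) - t * q z)\<close> is sublinear and below
  \<open>q\<close>, hence equal to \<open>q\<close>. At \<open>- z\<close> the choice \<open>t = 1\<close> shows \<open>q (- z) \<le> - q z\<close>, so \<open>q\<close> is odd, and an odd
  sublinear functional is linear.
\<close>

lemma sublinear_minimal_is_linear:
  assumes q: "sublinear X q"
    and min: "\<And>r. sublinear X r \<Longrightarrow> (\<And>x. x \<in> carr X \<Longrightarrow> r x \<le> q x) \<Longrightarrow> (\<And>x. x \<in> carr X \<Longrightarrow> r x = q x)"
  shows "linear_map X (type_space TYPE(real)) q"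
proof -
  have add_le: "q (vadd X x y) \<le> q x + q y" if "x \<in> carr X" "y \<in> carr X" for x y
    using q that unfolding sublinear_def by blast
  have neg: "q (vscale X (-1) z) = - q z" if z: "z \<in> carr X" for z
  proof -
    define f where "f x t = q (vadd X x (vscale X t z)) - t * q z" for x t
    define r where "r x = (INF t\<in>{0..}. f x t)" for x
    have lower: "- q (vscale X (-1) x) \<le> f x t" if x: "x \<in> carr X" and t: "0 \<le> t" for x t
    proof -
      have "vadd X (vadd X x (vscale X t z)) (vscale X (-1) x) = vscale X t z"
        using x z by (metis add_assoc add_commute add_neg add_zero scale_closed add_closed)
      then have "q (vscale X t z) \<le> q (vadd X x (vscale X t z)) + q (vscale X (-1) x)"
        using add_le[of "vadd X x (vscale X t z)" "vscale X (-1) x"] x z by (simp add: vs)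
      then show ?thesis using sublinear_scale[OF q z t] by (simp add: f_def)
    qed
    have bdd: "bdd_below (f x ` {0..})" if "x \<in> carr X" for x
      by (rule bdd_belowI2) (use lower that in auto)
    have r_le: "r x \<le> f x t" if "x \<in> carr X" "0 \<le> t" for x t
      unfolding r_def using bdd that by (intro cINF_lower) auto
    have f_add: "f (vadd X x y) (t1 + t2) \<le> f x t1 + f y t2" if "x \<in> carr X" "y \<in> carr X" for x y t1 t2
    proof -
      have "vadd X (vadd X x y) (vscale X (t1 + t2) z)
          = vadd X (vadd X x (vscale X t1 z)) (vadd X y (vscale X t2 z))"
        using that z by (simp add: vs scale_add_left)
      then show ?thesis
        using add_le[of "vadd X x (vscale X t1 z)" "vadd X y (vscale X t2 z)"] that z
        by (simp add: f_def vs algebra_simps)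
    qed
    have "sublinear X r"
      unfolding sublinear_def
    proof (intro conjI ballI allI impI)
      fix x assume x: "x \<in> carr X"
      { fix y assume y: "y \<in> carr X"
        have "r (vadd X x y) - f x t1 \<le> r y" if "t1 \<ge> 0" for t1
          unfolding r_def[of y]
        proof (rule cINF_greatest)
          fix t2 :: real assume "t2 \<in> {0..}"
          then show "r (vadd X x y) - f x t1 \<le> f y t2"
            using r_le[of "vadd X x y" "t1 + t2"] f_add[OF x y, of t1 t2] that x y
            by (simp add: vs)
        qed simp
        then have "r (vadd X x y) - r y \<le> r x"
          unfolding r_def[of x] by (intro cINF_greatest) (auto simp: algebra_simps)
        then show "r (vadd X x y) \<le> r x + r y" by simp }
      fix s :: real assume s: "0 \<le> s"
      show "r (vscale X s x) \<le> s * r x"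
      proof (cases "s = 0")
        case True
        then show ?thesis using r_le[OF zero_closed, of 0] z x by (simp add: f_def vs sublinear_zero[OF q])
      next
        case False
        have "r (vscale X s x) / s \<le> r x"
          unfolding r_def[of x]
        proof (rule cINF_greatest)
          fix t :: real assume t: "t \<in> {0..}"
          have "vadd X (vscale X s x) (vscale X (s * t) z) = vscale X s (vadd X x (vscale X t z))"
            using x z by (simp add: vs)
          then have "f (vscale X s x) (s * t) = s * f x t"
            using sublinear_scale[OF q _ s, of "vadd X x (vscale X t z)"] x z
            by (simp add: f_def vs algebra_simps)
          then show "r (vscale X s x) / s \<le> f x t"
            using r_le[of "vscale X s x" "s * t"] x s t False by (simp add: vs field_simps)
        qed simp
        then show ?thesis using s False by (simp add: field_simps)
      qed
    qed
    moreover have "r x \<le> q x" if "x \<in> carr X" for x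
      using r_le[OF that, of 0] that z by (simp add: f_def vs)
    ultimately have "r (vscale X (-1) z) = q (vscale X (-1) z)"
      using min z by (simp add: vs)
    moreover have "r (vscale X (-1) z) \<le> f (vscale X (-1) z) 1"
      using z by (intro r_le) (auto simp: vs)
    ultimately have "q (vscale X (-1) z) \<le> - q z"
      using z by (simp add: f_def scale_one neg_add sublinear_zero[OF q])
    then show ?thesis using sublinear_lower[OF q z] by linarith
  qed
  have "q (vadd X x y) = q x + q y" if "x \<in> carr X" "y \<in> carr X" for x y
  proof -
    have "vadd X (vadd X x y) (vscale X (-1) y) = x"
      using that by (simp add: vs add_neg)
    then have "q x \<le> q (vadd X x y) + q (vscale X (-1) y)"
      using add_le[of "vadd X x y" "vscale X (-1) y"] that by (simp add: vs)
    then show ?thesis using neg[OF that(2)] add_le[OF that] by simp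
  qed
  moreover have "q (vscale X t x) = t * q x" if "x \<in> carr X" for t x
  proof (cases "0 \<le> t")
    case False
    have "q (vscale X t x) = q (vscale X (-1) (vscale X (- t) x))" using that by (simp add: vs)
    also have "\<dots> = t * q x" using neg[of "vscale X (- t) x"] sublinear_scale[OF q that, of "- t"] that False
      by (simp add: vs)
    finally show ?thesis .
  qed (simp add: sublinear_scale[OF q that])
  ultimately show ?thesis by (simp add: linear_map_def type_space_def space_of_def)
qed

text \<open>
  Zorn's lemma yields a minimal sublinear functional below \<open>p\<close>. All functionals are set to \<open>0\<close> off the
  carrier, so that the pointwise order is antisymmetric.
\<close>

theorem Hahn_Banach_sublinear:
  assumes p: "sublinear X p"
  obtains f where "linear_map X (type_space TYPE(real)) f" "\<And>x. x \<in> carr X \<Longrightarrow> f x \<le> p x"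
    "\<And>x. x \<notin> carr X \<Longrightarrow> f x = 0"
proof -
  define S where "S = {q. sublinear X q \<and> (\<forall>x\<in>carr X. q x \<le> p x) \<and> (\<forall>x. x \<notin> carr X \<longrightarrow> q x = 0)}"
  define P where "P f g \<longleftrightarrow> (\<forall>x. g x \<le> f x)" for f g :: "'a \<Rightarrow> real"
  define p0 where "p0 x = (if x \<in> carr X then p x else 0)" for x
  have p0: "p0 \<in> S" using p by (auto simp: S_def p0_def sublinear_def vs)
  have "\<exists>q\<in>S. \<forall>r\<in>S. P q r \<longrightarrow> r = q"
  proof (rule predicate_Zorn)
    show "partial_order_on S (relation_of P S)"
      by (rule partial_order_on_relation_ofI) (auto simp: P_def fun_eq_iff intro: order_trans order_antisym)
  next
    fix C assume C: "C \<in> Chains (relation_of P S)"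
    then have CS: "q \<in> S" if "q \<in> C" for q
      using that unfolding Chains_def relation_of_def by blast
    show "\<exists>u\<in>S. \<forall>a\<in>C. P a u"
    proof (cases "C = {}")
      case False
      define u where "u x = (INF q\<in>C. q x)" for x
      have bdd: "bdd_below ((\<lambda>q. q x) ` C)" if "x \<in> carr X" for x
      proof (rule bdd_belowI2)
        fix q assume "q \<in> C"
        then show "- p (vscale X (-1) x) \<le> q x"
          using CS[of q] sublinear_lower[of q x] that scale_closed[OF that, of "-1"] unfolding S_def by force
      qed
      have out: "q x = 0" if "x \<notin> carr X" "q \<in> C" for x q using CS that by (auto simp: S_def)
      have chain: "(\<forall>x. q x \<le> r x) \<or> (\<forall>x. r x \<le> q x)" if "q \<in> C" "r \<in> C" for q r
        using C that unfolding Chains_def relation_of_def P_def by blast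
      have "sublinear X u"
        unfolding u_def by (rule sublinear_INF_chain[OF False _ chain bdd]) (use CS in \<open>auto simp: S_def\<close>)
      moreover have u_le: "u x \<le> q x" if q: "q \<in> C" for q x
      proof (cases "x \<in> carr X")
        case True
        then show ?thesis unfolding u_def using bdd q by (intro cINF_lower) auto
      next
        case outside: False
        then have "u x = (INF q\<in>C. 0)" unfolding u_def by (intro INF_cong) (auto simp: out)
        then show ?thesis using out[OF outside q] False by simp
      qed
      moreover obtain q where q: "q \<in> C" using False by blast
      have "u x \<le> p x" if "x \<in> carr X" for x
        using u_le[OF q, of x] CS[OF q] that unfolding S_def by force
      moreover have "u x = 0" if "x \<notin> carr X" for x
      proof -
        have "u x = (INF q\<in>C. 0)" unfolding u_def by (intro INF_cong) (auto simp: out[OF that])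
        then show ?thesis using False by simp
      qed
      ultimately show ?thesis unfolding S_def P_def by blast
    qed (use p0 in blast)
  qed
  then obtain q where q: "q \<in> S" and min: "\<And>r. r \<in> S \<Longrightarrow> P q r \<Longrightarrow> r = q" by blast
  have "linear_map X (type_space TYPE(real)) q"
  proof (rule sublinear_minimal_is_linear)
    show "sublinear X q" using q by (simp add: S_def)
    fix r x assume r: "sublinear X r" "\<And>x. x \<in> carr X \<Longrightarrow> r x \<le> q x" and x: "x \<in> carr X"
    define r0 where "r0 x = (if x \<in> carr X then r x else 0)" for x
    have "sublinear X r0" using r(1) unfolding sublinear_def r0_def by (simp add: vs)
    moreover have "r0 x \<le> p x" if "x \<in> carr X" for x
      using r(2)[OF that] q that by (fastforce simp: S_def r0_def)
    ultimately have "r0 \<in> S" by (simp add: S_def r0_def)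
    moreover have "P q r0" using r q by (auto simp: P_def S_def r0_def)
    ultimately have "r0 = q" by (rule min)
    then have "r0 x = q x" by simp
    then show "r x = q x" using x by (simp add: r0_def)
  qed
  then show ?thesis using that q by (auto simp: S_def)
qed

lemma dual_iff:
  "f \<in> carr (dual X) \<longleftrightarrow> linear_map X (type_space TYPE(real)) f \<and>
     (\<exists>K. \<forall>x\<in>carr X. \<bar>f x\<bar> \<le> K * vnorm X x) \<and> (\<forall>x. x \<notin> carr X \<longrightarrow> f x = 0)"
  by (auto simp: dual_def bounded_linear_map_def type_space_def space_of_def)

text \<open>
  The set \<open>V\<close> is the graph of the prescribed linear functional on the span of \<open>u\<close>. A linear functional
  below \<open>p x = (INF (w, t)\<in>V. K * vnorm X (x - w) + t)\<close> has norm at most \<open>K\<close>, by the choice \<open>w = 0\<close>, and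
  is at most \<open>t\<close> at \<open>w\<close> for all \<open>(w, t) \<in> V\<close>; since \<open>V\<close> is symmetric, equality holds. The hypothesis
  \<open>bound\<close> makes the infimum finite.
\<close>

theorem exists_functional_with_values:
  assumes u: "\<And>i. u i \<in> carr X" and K: "0 \<le> K"
    and bound: "\<And>a m. (\<Sum>i<m. a i * s i) \<le> K * vnorm X (lsum X a u m)"
  obtains f where "f \<in> carr (dual X)" "\<And>i. f (u i) = s i" "\<And>x. x \<in> carr X \<Longrightarrow> \<bar>f x\<bar> \<le> K * vnorm X x"
proof -
  define V where "V = {(lsum X a u m, \<Sum>i<m. a i * s i) | a m. True}"
  have V_I: "(lsum X a u m, \<Sum>i<m. a i * s i) \<in> V" for a m by (auto simp: V_def)
  have V_bound: "t \<le> K * vnorm X w" "w \<in> carr X" if "(w, t) \<in> V" for w t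
    using that bound lsum_closed u by (auto simp: V_def)
  have V_ne: "V \<noteq> {}" using V_I by blast
  have V_scale: "(vscale X r w, r * t) \<in> V" if wt: "(w, t) \<in> V" for w t r
  proof -
    obtain a m where "w = lsum X a u m" "t = (\<Sum>i<m. a i * s i)" using wt by (auto simp: V_def)
    then have "vscale X r w = lsum X (\<lambda>i. r * a i) u m" "r * t = (\<Sum>i<m. (r * a i) * s i)"
      using u by (auto simp: lsum_scale sum_distrib_left mult.assoc)
    then show ?thesis using V_I by metis
  qed
  have V_add: "(vadd X w w', t + t') \<in> V" if wt: "(w, t) \<in> V" "(w', t') \<in> V" for w t w' t'
  proof -
    have pad: "\<exists>a. w = lsum X a u M \<and> t = (\<Sum>i<M. a i * s i)"
      if wt: "w = lsum X b u m" "t = (\<Sum>i<m. b i * s i)" and M: "m \<le> M" for w t b m M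
    proof (intro exI conjI)
      define a where "a i = (if i < m then b i else 0)" for i
      have "lsum X a u M = lsum X a u m" using M u by (intro lsum_pad) (auto simp: a_def)
      also have "\<dots> = lsum X b u m" by (intro lsum_cong) (auto simp: a_def)
      finally show "w = lsum X a u M" using wt by simp
      have "(\<Sum>i<M. a i * s i) = (\<Sum>i<m. a i * s i)"
        using M by (intro sum.mono_neutral_right) (auto simp: a_def)
      then show "t = (\<Sum>i<M. a i * s i)" using wt by (simp add: a_def)
    qed
    obtain b m b' m' where "w = lsum X b u m" "t = (\<Sum>i<m. b i * s i)"
        "w' = lsum X b' u m'" "t' = (\<Sum>i<m'. b' i * s i)" using wt by (auto simp: V_def)
    then obtain a a' where "w = lsum X a u (max m m')" "t = (\<Sum>i<max m m'. a i * s i)"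
        "w' = lsum X a' u (max m m')" "t' = (\<Sum>i<max m m'. a' i * s i)"
      using pad[of w b m t "max m m'"] pad[of w' b' m' t' "max m m'"] by auto
    then have "vadd X w w' = lsum X (\<lambda>i. a i + a' i) u (max m m')"
      "t + t' = (\<Sum>i<max m m'. (a i + a' i) * s i)"
      using u by (auto simp: lsum_add sum.distrib distrib_right)
    then show ?thesis using V_I by metis
  qed
  define g where "g x = (\<lambda>(w, t). K * vnorm X (vadd X x (vscale X (-1) w)) + t)" for x
  define p where "p x = (INF v\<in>V. g x v)" for x
  have norm_diff: "vnorm X w \<le> vnorm X (vadd X x (vscale X (-1) w)) + vnorm X x"
    if "x \<in> carr X" "w \<in> carr X" for x w
  proof -
    have "vadd X x (vscale X (-1) (vadd X x (vscale X (-1) w))) = w"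
      using that add_neg[of x] zero_add[of w] add_assoc[of x "vscale X (-1) x" w] by (simp add: vs)
    then have "vnorm X w \<le> vnorm X x + vnorm X (vscale X (-1) (vadd X x (vscale X (-1) w)))"
      using norm_triangle[of x "vscale X (-1) (vadd X x (vscale X (-1) w))"] that by (simp add: vs)
    then show ?thesis using norm_scale[of "vadd X x (vscale X (-1) w)" "-1"] that
      by (simp add: add_closed scale_closed)
  qed
  have lower: "- K * vnorm X x \<le> g x v" if "x \<in> carr X" "v \<in> V" for x v
  proof -
    obtain w t where v: "v = (w, t)" by (cases v)
    have w: "w \<in> carr X" using V_bound that v by blast
    have "(vscale X (-1) w, (-1) * t) \<in> V" using V_scale that v by blast
    then have "- t \<le> K * vnorm X w" using V_bound(1)[of "vscale X (-1) w" "- t"] w by (simp add: norm_scale)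
    moreover have "K * vnorm X w \<le> K * (vnorm X (vadd X x (vscale X (-1) w)) + vnorm X x)"
      using norm_diff[OF that(1) w] K by (intro mult_left_mono) auto
    ultimately show ?thesis by (simp add: g_def v algebra_simps)
  qed
  have bdd: "bdd_below (g x ` V)" if "x \<in> carr X" for x
    by (rule bdd_belowI2) (use lower that in auto)
  have p_le: "p x \<le> g x v" if "x \<in> carr X" "v \<in> V" for x v
    unfolding p_def using bdd that by (intro cINF_lower) auto
  have "sublinear X p"
    unfolding sublinear_def
  proof (intro conjI ballI allI impI)
    fix x assume x: "x \<in> carr X"
    { fix y assume y: "y \<in> carr X"
      have le: "p (vadd X x y) \<le> g x v + g y v'" if v: "v \<in> V" and v': "v' \<in> V" for v v'
      proof -
        obtain w t w' t' where vw: "v = (w, t)" "v' = (w', t')" by (cases v; cases v')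
        have w: "w \<in> carr X" "w' \<in> carr X" using V_bound v v' vw by blast+
        have "vadd X (vadd X x y) (vscale X (-1) (vadd X w w'))
            = vadd X (vadd X x (vscale X (-1) w)) (vadd X y (vscale X (-1) w'))"
          using x y w by (simp add: vs)
        then have "vnorm X (vadd X (vadd X x y) (vscale X (-1) (vadd X w w')))
           \<le> vnorm X (vadd X x (vscale X (-1) w)) + vnorm X (vadd X y (vscale X (-1) w'))"
          using norm_triangle x y w by (simp add: add_closed scale_closed)
        from mult_left_mono[OF this K]
        have "g (vadd X x y) (vadd X w w', t + t') \<le> g x v + g y v'"
          by (simp add: g_def vw algebra_simps)
        moreover have "p (vadd X x y) \<le> g (vadd X x y) (vadd X w w', t + t')"
          using V_add v v' vw x y by (intro p_le) (auto simp: add_closed)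
        ultimately show ?thesis by linarith
      qed
      have "p (vadd X x y) - g x v \<le> p y" if "v \<in> V" for v
        unfolding p_def[of y] using le[OF that] by (intro cINF_greatest[OF V_ne]) (simp add: algebra_simps)
      then have "p (vadd X x y) - p y \<le> p x"
        unfolding p_def[of x] by (intro cINF_greatest[OF V_ne]) (simp add: algebra_simps)
      then show "p (vadd X x y) \<le> p x + p y" by simp }
    fix r :: real assume r: "0 \<le> r"
    have le: "p (vscale X r x) \<le> r * g x v" if v: "v \<in> V" for v
    proof -
      obtain w t where vw: "v = (w, t)" by (cases v)
      have w: "w \<in> carr X" using V_bound v vw by blast
      have "vadd X (vscale X r x) (vscale X (-1) (vscale X r w)) = vscale X r (vadd X x (vscale X (-1) w))"
        using x w by (simp add: vs)
      then have "vnorm X (vadd X (vscale X r x) (vscale X (-1) (vscale X r w)))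
          = r * vnorm X (vadd X x (vscale X (-1) w))"
        using x w r norm_scale[of "vadd X x (vscale X (-1) w)" r] by (simp add: add_closed scale_closed)
      then have "g (vscale X r x) (vscale X r w, r * t) = r * g x v"
        by (simp add: g_def vw algebra_simps)
      then show ?thesis
        using p_le[of "vscale X r x" "(vscale X r w, r * t)"] V_scale[of w t r] x v vw by (simp add: vs)
    qed
    show "p (vscale X r x) \<le> r * p x"
    proof (cases "r = 0")
      case True
      then show ?thesis using le V_ne by fastforce
    next
      case False
      then have "p (vscale X r x) / r \<le> p x"
        unfolding p_def[of x] using le r by (intro cINF_greatest[OF V_ne]) (simp add: field_simps)
      then show ?thesis using False r by (simp add: field_simps)
    qed
  qed
  then obtain f where f: "linear_map X (type_space TYPE(real)) f" "\<And>x. x \<in> carr X \<Longrightarrow> f x \<le> p x"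
     "\<And>x. x \<notin> carr X \<Longrightarrow> f x = 0" using Hahn_Banach_sublinear by blast
  have f_scale: "f (vscale X r x) = r * f x" if "x \<in> carr X" for r x
    using f(1) that by (simp add: linear_map_def type_space_def space_of_def)
  have f_V: "f w \<le> t" if "(w, t) \<in> V" for w t
    using f(2)[of w] p_le[OF V_bound(2)[OF that] that] V_bound(2)[OF that]
    by (simp add: g_def add_neg norm_zero)
  have f_K: "f x \<le> K * vnorm X x" if "x \<in> carr X" for x
    using f(2)[OF that] p_le[OF that V_I[of _ 0]] that by (simp add: g_def vs)
  have "(u i, s i) \<in> V" for i
  proof -
    define a where "a j = (if j = i then 1 else 0 :: real)" for j
    have "lsum X a u (Suc i) = u i" unfolding a_def by (rule lsum_single[OF u])
    moreover have "(\<Sum>j<Suc i. a j * s j) = s i" by (simp add: a_def)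
    ultimately show ?thesis using V_I[of a "Suc i"] by simp
  qed
  then have f_le: "f (u i) \<le> s i" "f (vscale X (-1) (u i)) \<le> (-1) * s i" for i
    using f_V V_scale by blast+
  have f_u: "f (u i) = s i" for i
    using f_le[of i] f_scale[OF u[of i], where r = "-1"] by linarith
  have f_abs: "\<bar>f x\<bar> \<le> K * vnorm X x" if "x \<in> carr X" for x
    using f_K[OF that] f_K[of "vscale X (-1) x"] f_scale[OF that, of "-1"] that
    by (simp add: vs norm_scale)
  then have "f \<in> carr (dual X)" using f by (auto simp: dual_iff)
  then show ?thesis using that f_u f_abs by blast
qed

end

section \<open>Basic sequences in the dual\<close>

lemma dual_simps [simp]:
  "vadd (dual X) f g = (\<lambda>x. f x + g x)" "vzero (dual X) = (\<lambda>x. 0)" "vscale (dual X) a f = (\<lambda>x. a * f x)"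
  by (simp_all add: dual_def)

lemma lsum_dual: "lsum (dual X) a f m = (\<lambda>x. \<Sum>i<m. a i * f i x)"
  by (induction m) auto

lemma zero_scaling_dual: "zero_scaling (dual X)"
  by (simp add: zero_scaling_def)

context normed_space
begin

lemma dual_linear:
  assumes "f \<in> carr (dual X)"
  shows "x \<in> carr X \<Longrightarrow> y \<in> carr X \<Longrightarrow> f (vadd X x y) = f x + f y"
    and "x \<in> carr X \<Longrightarrow> f (vscale X r x) = r * f x"
    and "x \<notin> carr X \<Longrightarrow> f x = 0"
  using assms by (auto simp: dual_iff linear_map_def type_space_def space_of_def)

lemma dual_lsum:
  assumes f: "f \<in> carr (dual X)" and u: "\<And>i. i < m \<Longrightarrow> u i \<in> carr X"
  shows "f (lsum X a u m) = (\<Sum>i<m. a i * f (u i))"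
  using u
proof (induction m)
  case 0
  show ?case using dual_linear(2)[OF f zero_closed, of 0] by (simp add: vs)
next
  case (Suc m)
  then show ?case using dual_linear[OF f] lsum_closed[of m u a] by (simp add: vs)
qed

lemma lsum_in_dual:
  assumes "\<And>i. i < m \<Longrightarrow> f i \<in> carr (dual X)"
  shows "lsum (dual X) a f m \<in> carr (dual X)"
proof -
  obtain K where K: "\<And>i x. i < m \<Longrightarrow> x \<in> carr X \<Longrightarrow> \<bar>f i x\<bar> \<le> K i * vnorm X x"
    using assms unfolding dual_iff by metis
  have "\<bar>\<Sum>i<m. a i * f i x\<bar> \<le> (\<Sum>i<m. \<bar>a i\<bar> * K i) * vnorm X x" if "x \<in> carr X" for x
    unfolding sum_distrib_right
    by (intro order_trans[OF sum_abs] sum_mono) (use K that in \<open>auto simp: abs_mult mult.assoc intro!: mult_left_mono\<close>)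
  moreover have "linear_map X (type_space TYPE(real)) (\<lambda>x. \<Sum>i<m. a i * f i x)"
    using dual_linear[OF assms]
    by (simp add: linear_map_def type_space_def space_of_def distrib_left sum.distrib sum_distrib_left mult_ac)
  ultimately show ?thesis
    using dual_linear(3)[OF assms] unfolding lsum_dual dual_iff by auto
qed

lemma dual_norm_bdd:
  assumes "f \<in> carr (dual X)"
  shows "bdd_above ((\<lambda>x. \<bar>f x\<bar>) ` {x \<in> carr X. vnorm X x \<le> 1})"
proof -
  obtain K where K: "\<And>x. x \<in> carr X \<Longrightarrow> \<bar>f x\<bar> \<le> K * vnorm X x"
    using assms by (auto simp: dual_iff)
  have "K * vnorm X x \<le> \<bar>K\<bar>" if "x \<in> carr X" "vnorm X x \<le> 1" for x
    using mult_mono[of K "\<bar>K\<bar>" "vnorm X x" 1] that norm_nonneg by simp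
  then show ?thesis using K by (intro bdd_aboveI2[where M = "\<bar>K\<bar>"]) (auto intro: order_trans)
qed

lemma dual_norm_ge:
  assumes f: "f \<in> carr (dual X)" and x: "x \<in> carr X" "vnorm X x \<le> M" and M: "M > 0"
  shows "\<bar>f x\<bar> \<le> M * vnorm (dual X) f"
proof -
  have "\<bar>f (vscale X (1 / M) x)\<bar> \<le> (SUP x\<in>{x \<in> carr X. vnorm X x \<le> 1}. \<bar>f x\<bar>)"
    by (intro cSUP_upper dual_norm_bdd[OF f]) (use x M in \<open>auto simp: vs norm_scale\<close>)
  then show ?thesis
    using x M dual_linear(2)[OF f x(1)] by (simp add: dual_def abs_mult field_simps)
qed

lemma dual_norm_le:
  assumes "0 \<le> K" "\<And>x. x \<in> carr X \<Longrightarrow> \<bar>f x\<bar> \<le> K * vnorm X x"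
  shows "vnorm (dual X) f \<le> K"
  unfolding dual_def
proof (simp, rule cSUP_least)
  show "{x \<in> carr X. vnorm X x \<le> 1} \<noteq> {}" using zero_closed norm_zero by fastforce
  fix x assume "x \<in> {x \<in> carr X. vnorm X x \<le> 1}"
  then show "\<bar>f x\<bar> \<le> K" using assms mult_left_mono[of "vnorm X x" 1 K] by force
qed

text \<open>
  The bound is the criterion for a functional with the values \<open>s k i\<close> at \<open>u i\<close> to exist. If these
  functionals realise every finite sign pattern on vectors of norm at most \<open>M\<close>, they form an \<open>\<ell>\<^sub>1\<close>
  sequence: evaluate a linear combination at the vector with the signs of its coefficients.
\<close>

lemma dual_has_ell1_sequence:
  fixes s :: "nat \<Rightarrow> nat \<Rightarrow> real"
  assumes u: "\<And>i. u i \<in> carr X" and K: "0 \<le> K" and M: "M > 0"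
    and bound: "\<And>k a m. (\<Sum>i<m. a i * s k i) \<le> K * vnorm X (lsum X a u m)"
    and signs: "\<And>A n. \<exists>a m. vnorm X (lsum X a u m) \<le> M \<and>
      (\<forall>k<n. (\<Sum>i<m. a i * s k i) = (if k \<in> A then 1 else -1))"
  shows "has_ell1_sequence (dual X)"
proof -
  have "\<exists>f. f \<in> carr (dual X) \<and> (\<forall>i. f (u i) = s k i) \<and> (\<forall>x\<in>carr X. \<bar>f x\<bar> \<le> K * vnorm X x)" for k :: nat
    using exists_functional_with_values[OF u K bound[of _ k]] by metis
  then obtain f where f: "\<And>k. f k \<in> carr (dual X)" "\<And>k i. f k (u i) = s k i"
    "\<And>k x. x \<in> carr X \<Longrightarrow> \<bar>f k x\<bar> \<le> K * vnorm X x"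
    by metis
  show ?thesis
    unfolding has_ell1_sequence_def
  proof (rule exI[of _ f], rule exI[of _ K], rule exI[of _ "1 / M"], intro conjI allI)
    show "f i \<in> carr (dual X)" for i by (rule f)
    show "vnorm (dual X) (f i) \<le> K" for i using K f(3) by (rule dual_norm_le)
    show "1 / M > 0" using M by simp
    fix a :: "nat \<Rightarrow> real" and m
    obtain b l where x: "vnorm X (lsum X b u l) \<le> M"
      "\<And>k. k < m \<Longrightarrow> (\<Sum>i<l. b i * s k i) = (if k \<in> {k. 0 \<le> a k} then 1 else -1)"
      using signs[of m "{k. 0 \<le> a k}"] by blast
    have "(\<Sum>k<m. \<bar>a k\<bar>) = lsum (dual X) a f m (lsum X b u l)"
      unfolding lsum_dual using x(2) by (intro sum.cong) (simp_all add: dual_lsum[OF f(1) u] f(2))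
    also have "\<dots> \<le> M * vnorm (dual X) (lsum (dual X) a f m)"
      using dual_norm_ge[OF lsum_in_dual lsum_closed x(1) M] f(1) u by (meson abs_le_D1)
    finally show "1 / M * (\<Sum>i<m. \<bar>a i\<bar>) \<le> vnorm (dual X) (lsum (dual X) a f m)"
      using M by (simp add: field_simps)
  qed
qed

text \<open>
  Every bounded sequence of values on an \<open>\<ell>\<^sub>1\<close> sequence is attained by a functional. The \<open>k\<close>-th one is
  to take the value given by the \<open>k\<close>-th binary digit of \<open>i\<close> at \<open>u i\<close>; then every finite sign pattern
  occurs at one of the \<open>u i\<close>.
\<close>

theorem dual_has_ell1_if_ell1:
  assumes "has_ell1_sequence X"
  shows "has_ell1_sequence (dual X)"
proof -
  obtain u B c where u: "\<And>i. u i \<in> carr X" and B: "\<And>i. vnorm X (u i) \<le> B" and c: "c > 0"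
    and lower: "\<And>a m. c * (\<Sum>i<m. \<bar>a i\<bar>) \<le> vnorm X (lsum X a u m)"
    using assms by (auto simp: has_ell1_sequence_def)
  define s where "s k i = (if k \<in> set_decode i then 1 else -1 :: real)" for k i
  show ?thesis
  proof (rule dual_has_ell1_sequence[OF u, of "1 / c" "max B 1" s])
    show "0 \<le> 1 / c" "max B 1 > 0" using c by auto
    show "(\<Sum>i<m. a i * s k i) \<le> 1 / c * vnorm X (lsum X a u m)" for k a m
    proof -
      have "c * (\<Sum>i<m. a i * s k i) \<le> c * (\<Sum>i<m. \<bar>a i\<bar>)"
        using c by (intro mult_left_mono sum_mono) (auto simp: s_def)
      then have "c * (\<Sum>i<m. a i * s k i) \<le> vnorm X (lsum X a u m)"
        using lower[where a = a and m = m] by linarith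
      then show ?thesis using c by (simp add: field_simps)
    qed
    fix A :: "nat set" and n :: nat
    \<comment> \<open>the index whose binary digits below \<open>n\<close> form the pattern \<open>A\<close>\<close>
    define i where "i = set_encode (A \<inter> {..<n})"
    define a where "a j = (if j = i then 1 else 0 :: real)" for j
    have "set_decode i = A \<inter> {..<n}" by (simp add: i_def)
    then have "(\<Sum>j<Suc i. a j * s k j) = (if k \<in> A then 1 else -1)" if "k < n" for k
      using that by (simp add: a_def s_def)
    moreover have "lsum X a u (Suc i) = u i" unfolding a_def by (rule lsum_single[OF u])
    ultimately show "\<exists>a m. vnorm X (lsum X a u m) \<le> max B 1 \<and>
        (\<forall>k<n. (\<Sum>i<m. a i * s k i) = (if k \<in> A then 1 else -1))"
      using B[of i] by (intro exI[of _ a] exI[of _ "Suc i"]) simp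
  qed
qed

text \<open>The biorthogonal functionals; the sign patterns are realised by the bounded combinations
  \<open>\<Sum>i<n. \<plusminus> u i\<close>.\<close>

theorem dual_has_ell1_if_c0:
  assumes "has_c0_sequence X"
  shows "has_ell1_sequence (dual X)"
proof -
  obtain u B c where u: "\<And>i. u i \<in> carr X" and c: "c > 0"
    and upper: "\<And>a m b. 0 \<le> b \<Longrightarrow> (\<And>i. i < m \<Longrightarrow> \<bar>a i\<bar> \<le> b) \<Longrightarrow> vnorm X (lsum X a u m) \<le> B * b"
    and lower: "\<And>a m i. i < m \<Longrightarrow> c * \<bar>a i\<bar> \<le> vnorm X (lsum X a u m)"
    using assms unfolding has_c0_sequence_def by metis
  define s where "s k i = (if i = k then 1 else 0 :: real)" for k i :: nat
  have sum_s: "(\<Sum>i<m. a i * s k i) = (if k < m then a k else 0)" for a k m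
    by (simp add: s_def if_distrib[of "(*) _"] cong: if_cong)
  show ?thesis
  proof (rule dual_has_ell1_sequence[OF u, of "1 / c" "max B 1" s])
    show "0 \<le> 1 / c" "max B 1 > 0" using c by auto
    show "(\<Sum>i<m. a i * s k i) \<le> 1 / c * vnorm X (lsum X a u m)" for k a m
    proof (cases "k < m")
      case True
      have "c * a k \<le> c * \<bar>a k\<bar>" using c by (intro mult_left_mono) auto
      then have "c * a k \<le> vnorm X (lsum X a u m)" using lower[OF True, where a = a] by linarith
      then show ?thesis using c True by (simp add: sum_s field_simps)
    qed (use c norm_nonneg lsum_closed u in \<open>simp add: sum_s\<close>)
    fix A :: "nat set" and n :: nat
    define a where "a i = (if i \<in> A then 1 else -1 :: real)" for i
    have "vnorm X (lsum X a u n) \<le> B * 1" by (rule upper) (auto simp: a_def)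
    then show "\<exists>a m. vnorm X (lsum X a u m) \<le> max B 1 \<and>
        (\<forall>k<n. (\<Sum>i<m. a i * s k i) = (if k \<in> A then 1 else -1))"
      unfolding sum_s by (intro exI[of _ a] exI[of _ n]) (simp add: a_def)
  qed
qed

text \<open>
  Choose \<open>u i\<close> in the unit ball with \<open>f i (u i) > 3 / 4\<close>. As \<open>\<Sum>j. \<bar>f j (u i)\<bar> \<le> 1\<close>, the other
  functionals together have at most \<open>1 / 4\<close> at \<open>u i\<close>, and testing a combination of the \<open>u i\<close> against
  \<open>\<Sum>j. \<plusminus> f j\<close> loses at most half of the sum of the absolute values of its coefficients.
\<close>

theorem has_ell1_if_dual_isometric_c0:
  assumes f: "\<And>i. f i \<in> carr (dual X)" and f1: "\<And>i. vnorm (dual X) (f i) = 1"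
    and upper: "\<And>a m. (\<And>i. i < m \<Longrightarrow> \<bar>a i\<bar> \<le> 1) \<Longrightarrow> vnorm (dual X) (lsum (dual X) a f m) \<le> 1"
  shows "has_ell1_sequence X"
proof -
  have "\<exists>x\<in>carr X. vnorm X x \<le> 1 \<and> 3 / 4 < f i x" for i
  proof -
    have "3 / 4 < (SUP x\<in>{x \<in> carr X. vnorm X x \<le> 1}. \<bar>f i x\<bar>)"
      using f1[of i] by (simp add: dual_def)
    then obtain x where x: "x \<in> carr X" "vnorm X x \<le> 1" "3 / 4 < \<bar>f i x\<bar>"
      using less_cSUP_iff[OF _ dual_norm_bdd[OF f]] zero_closed norm_zero
      by (metis (no_types, lifting) empty_iff mem_Collect_eq zero_le_one)
    define y where "y = vscale X (sgn (f i x)) x"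
    have "f i y = \<bar>f i x\<bar>" using dual_linear(2)[OF f x(1)] by (simp add: y_def abs_sgn mult.commute)
    moreover have "y \<in> carr X" "vnorm X y \<le> 1"
      using x by (auto simp: y_def vs norm_scale abs_mult sgn_if)
    ultimately show ?thesis using x by (intro bexI[of _ y]) auto
  qed
  then obtain u where u: "\<And>i. u i \<in> carr X" "\<And>i. vnorm X (u i) \<le> 1" "\<And>i. 3 / 4 < f i (u i)" by metis
  have upper': "\<bar>\<Sum>j<m. b j * f j x\<bar> \<le> vnorm X x" if "\<And>j. j < m \<Longrightarrow> \<bar>b j\<bar> \<le> 1" "x \<in> carr X" for b m x
  proof (cases "vnorm X x = 0")
    case True
    then have "x = vscale X 0 x" using that(2) norm_eq_zero by (simp add: vs)
    then have "f j x = 0" for j using dual_linear(2)[OF f that(2), of j 0] by simp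
    then show ?thesis using True by simp
  next
    case False
    then have pos: "vnorm X x > 0" using norm_nonneg[OF that(2)] by simp
    have "\<bar>lsum (dual X) b f m x\<bar> \<le> vnorm X x * vnorm (dual X) (lsum (dual X) b f m)"
      using f that pos by (intro dual_norm_ge lsum_in_dual) auto
    also have "\<dots> \<le> vnorm X x * 1" using upper[OF that(1)] pos by (intro mult_left_mono) auto
    finally show ?thesis by (simp add: lsum_dual)
  qed
  have off: "(\<Sum>j\<in>{..<m} - {i}. \<bar>f j (u i)\<bar>) \<le> 1 / 4" if i: "i < m" for i m
  proof -
    have "\<bar>\<Sum>j<m. sgn (f j (u i)) * f j (u i)\<bar> \<le> vnorm X (u i)"
      using u by (intro upper') (auto simp: sgn_if)
    moreover have "sgn r * r = \<bar>r\<bar>" for r :: real by (simp add: sgn_if)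
    ultimately have "(\<Sum>j<m. \<bar>f j (u i)\<bar>) \<le> 1"
      using u(2)[of i] by simp
    moreover have "(\<Sum>j<m. \<bar>f j (u i)\<bar>) = \<bar>f i (u i)\<bar> + (\<Sum>j\<in>{..<m} - {i}. \<bar>f j (u i)\<bar>)"
      using i by (intro sum.remove) auto
    ultimately show ?thesis using u(3)[of i] by linarith
  qed
  show ?thesis
    unfolding has_ell1_sequence_def
  proof (intro exI conjI allI)
    show "u i \<in> carr X" "vnorm X (u i) \<le> 1" for i using u by auto
    show "(1 / 2 :: real) > 0" by simp
    fix a :: "nat \<Rightarrow> real" and m
    define b where "b j = sgn (a j)" for j
    define x where "x = lsum X a u m"
    have "\<bar>a i\<bar> * (1 / 2) \<le> a i * (\<Sum>j<m. b j * f j (u i))" if i: "i < m" for i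
    proof -
      have "(\<Sum>j<m. b j * f j (u i)) = b i * f i (u i) + (\<Sum>j\<in>{..<m} - {i}. b j * f j (u i))"
        using i by (intro sum.remove) auto
      then have "a i * (\<Sum>j<m. b j * f j (u i)) = \<bar>a i\<bar> * f i (u i) + a i * (\<Sum>j\<in>{..<m} - {i}. b j * f j (u i))"
        by (simp add: b_def distrib_left abs_sgn)
      moreover have "\<bar>a i * (\<Sum>j\<in>{..<m} - {i}. b j * f j (u i))\<bar> \<le> \<bar>a i\<bar> * (1 / 4)"
      proof -
        have "\<bar>\<Sum>j\<in>{..<m} - {i}. b j * f j (u i)\<bar> \<le> (\<Sum>j\<in>{..<m} - {i}. \<bar>f j (u i)\<bar>)"
          by (intro order_trans[OF sum_abs] sum_mono) (auto simp: b_def abs_mult sgn_if)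
        then have "\<bar>\<Sum>j\<in>{..<m} - {i}. b j * f j (u i)\<bar> \<le> 1 / 4" using off[OF i] by linarith
        then show ?thesis unfolding abs_mult by (intro mult_left_mono) auto
      qed
      moreover have "\<bar>a i\<bar> * (3 / 4) \<le> \<bar>a i\<bar> * f i (u i)" using u(3)[of i] by (intro mult_left_mono) auto
      ultimately show ?thesis by linarith
    qed
    then have "(\<Sum>i<m. \<bar>a i\<bar> * (1 / 2)) \<le> (\<Sum>i<m. a i * (\<Sum>j<m. b j * f j (u i)))"
      by (intro sum_mono) auto
    also have "\<dots> = (\<Sum>j<m. b j * (\<Sum>i<m. a i * f j (u i)))"
      by (simp add: sum_distrib_left mult.left_commute) (rule sum.swap)
    also have "\<dots> = (\<Sum>j<m. b j * f j x)"
      unfolding x_def using u f by (intro sum.cong refl) (simp add: dual_lsum)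
    also have "\<dots> \<le> vnorm X x"
      by (rule order_trans[OF abs_ge_self upper']) (auto simp: b_def sgn_if x_def u lsum_closed)
    finally show "1 / 2 * (\<Sum>i<m. \<bar>a i\<bar>) \<le> vnorm X (lsum X a u m)"
      by (simp add: x_def sum_divide_distrib[symmetric])
  qed
qed

end

section \<open>Dimension\<close>

text \<open>Gaussian elimination of one equation together with one unknown.\<close>

lemma homogeneous_system:
  fixes v :: "'i \<Rightarrow> 'j \<Rightarrow> real"
  assumes "finite J" "finite I" "card J < card I"
  shows "\<exists>a. (\<exists>i\<in>I. a i \<noteq> 0) \<and> (\<forall>j\<in>J. (\<Sum>i\<in>I. a i * v i j) = 0)"
  using assms
proof (induction J arbitrary: I v rule: finite_induct)
  case empty
  then have "I \<noteq> {}" by auto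
  then show ?case by (intro exI[of _ "\<lambda>_. 1"]) auto
next
  case (insert j0 J)
  show ?case
  proof (cases "\<forall>i\<in>I. v i j0 = 0")
    case True
    have "\<exists>a. (\<exists>i\<in>I. a i \<noteq> 0) \<and> (\<forall>j\<in>J. (\<Sum>i\<in>I. a i * v i j) = 0)"
      using insert by (intro insert.IH) auto
    then obtain a where "\<exists>i\<in>I. a i \<noteq> 0" "\<forall>j\<in>J. (\<Sum>i\<in>I. a i * v i j) = 0"
      by blast
    then show ?thesis using True by (intro exI[of _ a]) auto
  next
    case False
    then obtain i0 where i0: "i0 \<in> I" "v i0 j0 \<noteq> 0" by blast
    define w where "w i j = v i j - v i j0 / v i0 j0 * v i0 j" for i j
    have "\<exists>b. (\<exists>i\<in>I - {i0}. b i \<noteq> 0) \<and> (\<forall>j\<in>J. (\<Sum>i\<in>I - {i0}. b i * w i j) = 0)"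
      using insert i0 by (intro insert.IH) (auto simp: card_Diff_singleton)
    then obtain b where b: "\<exists>i\<in>I - {i0}. b i \<noteq> 0" "\<And>j. j \<in> J \<Longrightarrow> (\<Sum>i\<in>I - {i0}. b i * w i j) = 0"
      by blast
    define t where "t = - (\<Sum>i\<in>I - {i0}. b i * v i j0) / v i0 j0"
    define a where "a = b(i0 := t)"
    have split: "(\<Sum>i\<in>I. a i * v i j) = t * v i0 j + (\<Sum>i\<in>I - {i0}. b i * v i j)" for j
      using i0 insert.prems(1) by (subst sum.remove[OF _ i0(1)]) (auto simp: a_def intro!: sum.cong)
    have "(\<Sum>i\<in>I. a i * v i j) = (\<Sum>i\<in>I - {i0}. b i * w i j)" for j
      unfolding split w_def t_def
      by (simp add: right_diff_distrib sum_subtractf sum_distrib_right sum_divide_distrib mult.assoc)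
    moreover have "(\<Sum>i\<in>I. a i * v i j0) = 0" unfolding split t_def using i0 by simp
    moreover have "\<exists>i\<in>I. a i \<noteq> 0" using b(1) by (auto simp: a_def)
    ultimately show ?thesis using b(2) by (intro exI[of _ a]) auto
  qed
qed

text \<open>Finitely many linear coordinates \<open>v x j\<close> that separate points bound the dimension.\<close>

lemma finite_dimensionalI:
  fixes v :: "'a \<Rightarrow> 'j \<Rightarrow> real"
  assumes "finite J"
    and vanish: "\<And>u a m. (\<And>i. u i \<in> carr X) \<Longrightarrow> (\<And>j. j \<in> J \<Longrightarrow> (\<Sum>i<m. a i * v (u i) j) = 0) \<Longrightarrow>
       lsum X a u m = vzero X"
  shows "finite_dimensional X"
  unfolding finite_dimensional_def
proof (intro exI[of _ "card J"] allI impI)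
  fix u :: "nat \<Rightarrow> 'a" assume u: "\<forall>i. u i \<in> carr X"
  obtain a where "\<exists>i\<in>{..<Suc (card J)}. a i \<noteq> 0" "\<forall>j\<in>J. (\<Sum>i<Suc (card J). a i * v (u i) j) = 0"
    using homogeneous_system[OF assms(1), of "{..<Suc (card J)}" "\<lambda>i. v (u i)"] by auto
  then show "\<exists>a. (\<exists>i<Suc (card J). a i \<noteq> 0) \<and> lsum X a u (Suc (card J)) = vzero X"
    using vanish[where u = u and m = "Suc (card J)" and a = a] u by blast
qed

context normed_space
begin

text \<open>With \<open>q\<close> the greatest length of an independent family, one more vector \<open>x\<close> produces a relation
  in which \<open>x\<close> has a nonzero coefficient.\<close>

lemma finite_dimensional_spanning:
  assumes "finite_dimensional X"
  obtains u q where "\<And>i. u i \<in> carr X" "\<And>x. x \<in> carr X \<Longrightarrow> \<exists>a. x = lsum X a u q"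
proof -
  define Q where "Q p \<longleftrightarrow> (\<forall>u. (\<forall>i. u i \<in> carr X) \<longrightarrow> (\<exists>a. (\<exists>i<p. a i \<noteq> 0) \<and> lsum X a u p = vzero X))" for p
  obtain p where "Q (Suc p)" using assms unfolding finite_dimensional_def Q_def by blast
  then obtain q where q: "Q (Suc q)" "\<not> Q q"
  proof -
    have "\<not> Q 0" using zero_closed by (auto simp: Q_def)
    with \<open>Q (Suc p)\<close> show ?thesis using that by (induction p) auto
  qed
  then obtain u where u: "\<And>i. u i \<in> carr X"
    and indep: "\<And>a. lsum X a u q = vzero X \<Longrightarrow> (\<forall>i<q. a i = 0)"
    unfolding Q_def by blast
  have "\<exists>a. x = lsum X a u q" if x: "x \<in> carr X" for x
  proof -
    define w where "w = u(q := x)"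
    have w: "\<forall>i. w i \<in> carr X" using u x by (simp add: w_def)
    obtain a where a: "\<exists>i<Suc q. a i \<noteq> 0" "lsum X a w (Suc q) = vzero X" using q(1) w unfolding Q_def by blast
    have cong: "lsum X b w m = lsum X b u m" if "m \<le> q" for b m
      using that by (induction m) (auto simp: w_def)
    define y where "y = lsum X a u q"
    have y: "y \<in> carr X" using u by (simp add: y_def lsum_closed)
    have eq: "vadd X y (vscale X (a q) x) = vzero X"
      using a(2) cong[of q a] by (simp add: w_def y_def)
    have aq: "a q \<noteq> 0"
    proof
      assume "a q = 0"
      then have "y = vzero X" using eq x y by (simp add: vs)
      then show False using indep[of a] a(1) \<open>a q = 0\<close> by (auto simp: y_def less_Suc_eq)
    qed
    have "vadd X (vscale X (-1) y) (vadd X y (vscale X (a q) x)) = vscale X (a q) x"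
      using x y add_assoc[of "vscale X (-1) y" y "vscale X (a q) x"] by (simp add: neg_add zero_add scale_closed)
    then have "vscale X (a q) x = vscale X (-1) y" using eq y by (simp add: vs)
    then have "vscale X (1 / a q) (vscale X (a q) x) = vscale X (1 / a q) (vscale X (-1) y)" by simp
    then have "x = vscale X (- (1 / a q)) y" using x y aq by (simp add: vs)
    then have "x = lsum X (\<lambda>i. - (1 / a q) * a i) u q"
      using lsum_scale[of q u "- (1 / a q)" a] u by (simp add: y_def)
    then show ?thesis by blast
  qed
  then show ?thesis using that u by blast
qed

theorem finite_dimensional_dual:
  assumes "finite_dimensional X"
  shows "finite_dimensional (dual X)"
proof -
  obtain u q where u: "\<And>i. u i \<in> carr X" and span: "\<And>x. x \<in> carr X \<Longrightarrow> \<exists>a. x = lsum X a u q"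
    using finite_dimensional_spanning[OF assms] by blast
  show ?thesis
  proof (rule finite_dimensionalI[of "{..<q}" _ "\<lambda>f j. f (u j)"])
    fix f :: "nat \<Rightarrow> 'a \<Rightarrow> real" and a :: "nat \<Rightarrow> real" and m
    assume f: "\<And>i. f i \<in> carr (dual X)" and 0: "\<And>j. j \<in> {..<q} \<Longrightarrow> (\<Sum>i<m. a i * f i (u j)) = 0"
    define g where "g = lsum (dual X) a f m"
    have g: "g \<in> carr (dual X)" using f by (simp add: g_def lsum_in_dual)
    have "g x = 0" if x: "x \<in> carr X" for x
    proof -
      obtain b where "x = lsum X b u q" using span[OF x] by blast
      then have "g x = (\<Sum>j<q. b j * g (u j))" using u by (simp add: dual_lsum[OF g])
      also have "\<dots> = 0" using 0 by (intro sum.neutral) (auto simp: g_def lsum_dual)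
      finally show ?thesis .
    qed
    then show "lsum (dual X) a f m = vzero (dual X)"
      using dual_linear(3)[OF g] by (fastforce simp: g_def[symmetric])
  qed simp
qed

end

section \<open>Isometries and iterated duals\<close>

lemma lsum_linear_map:
  assumes "normed_space X" "zero_scaling Y" and T: "linear_map X Y T" and u: "\<And>i. u i \<in> carr X"
  shows "T (lsum X a u m) = lsum Y a (\<lambda>i. T (u i)) m"
proof -
  interpret normed_space X by fact
  have "T (vzero X) = T (vscale X 0 (vzero X))" by (simp add: vs)
  also have "\<dots> = vzero Y"
    using T zero_closed assms(2) unfolding linear_map_def zero_scaling_def by metis
  finally show ?thesis
    using T u lsum_closed by (induction m) (auto simp: linear_map_def vs)
qed

lemma isometric_transfer:
  fixes X :: "'a nspace"
  assumes X: "normed_space X" and Y: "zero_scaling Y" and iso: "X \<cong>\<^sub>i Y"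
  shows "has_ell1_sequence Y \<Longrightarrow> has_ell1_sequence X"
    and "has_c0_sequence Y \<Longrightarrow> has_c0_sequence X"
    and "finite_dimensional Y \<Longrightarrow> finite_dimensional X"
proof -
  interpret normed_space X by fact
  obtain T where T: "linear_map X Y T" "bij_betw T (carr X) (carr Y)" "\<And>x. x \<in> carr X \<Longrightarrow> vnorm Y (T x) = vnorm X x"
    using iso unfolding isometrically_isomorphic_def by blast
  have lift: "\<exists>u. (\<forall>i. u i \<in> carr X \<and> T (u i) = v i) \<and> (\<forall>a m. vnorm X (lsum X a u m) = vnorm Y (lsum Y a v m))"
    if v: "\<forall>i. v i \<in> carr Y" for v
  proof -
    obtain u where u: "\<And>i. u i \<in> carr X" "\<And>i. T (u i) = v i"
    proof
      show "inv_into (carr X) T (v i) \<in> carr X" "T (inv_into (carr X) T (v i)) = v i" for i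
        using v T(2) by (auto simp: bij_betw_def inv_into_into f_inv_into_f)
    qed
    have "vnorm X (lsum X a u m) = vnorm Y (lsum Y a v m)" for a m
      using T(3)[OF lsum_closed[of m u a, OF u(1)]] lsum_linear_map[OF X Y T(1), of u a m] u by simp
    then show ?thesis using u by blast
  qed
  show "has_ell1_sequence X" if "has_ell1_sequence Y"
  proof -
    obtain v B c where v: "\<forall>i. v i \<in> carr Y \<and> vnorm Y (v i) \<le> B" "c > 0"
       "\<forall>a m. c * (\<Sum>i<m. \<bar>a i\<bar>) \<le> vnorm Y (lsum Y a v m)"
      using \<open>has_ell1_sequence Y\<close> unfolding has_ell1_sequence_def by blast
    obtain u where u: "\<forall>i. u i \<in> carr X \<and> T (u i) = v i"
       "\<forall>a m. vnorm X (lsum X a u m) = vnorm Y (lsum Y a v m)" using lift v by blast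
    then have "vnorm X (u i) \<le> B" for i using T(3)[of "u i"] v(1)[THEN spec, of i] u(1) by simp
    then show ?thesis
      unfolding has_ell1_sequence_def using u v(2,3) by (intro exI[of _ u] exI[of _ B] exI[of _ c]) simp
  qed
  show "has_c0_sequence X" if "has_c0_sequence Y"
  proof -
    obtain v B c where v: "\<forall>i. v i \<in> carr Y" and bounds: "c > 0"
       "\<forall>a m b. 0 \<le> b \<longrightarrow> (\<forall>i<m. \<bar>a i\<bar> \<le> b) \<longrightarrow> vnorm Y (lsum Y a v m) \<le> B * b"
       "\<forall>a m. \<forall>i<m. c * \<bar>a i\<bar> \<le> vnorm Y (lsum Y a v m)"
      using \<open>has_c0_sequence Y\<close> unfolding has_c0_sequence_def by blast
    obtain u where u: "\<forall>i. u i \<in> carr X \<and> T (u i) = v i"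
       "\<forall>a m. vnorm X (lsum X a u m) = vnorm Y (lsum Y a v m)" using lift v by blast
    show ?thesis
      unfolding has_c0_sequence_def using u bounds by (intro exI[of _ u] exI[of _ B] exI[of _ c]) simp
  qed
  show "finite_dimensional X" if "finite_dimensional Y"
  proof -
    obtain p where p: "\<And>v. \<forall>i. v i \<in> carr Y \<Longrightarrow> \<exists>a. (\<exists>i<Suc p. a i \<noteq> 0) \<and> lsum Y a v (Suc p) = vzero Y"
      using \<open>finite_dimensional Y\<close> unfolding finite_dimensional_def by blast
    have Tz: "T (vzero X) = vzero Y" using lsum_linear_map[OF X Y T(1), of "\<lambda>_. vzero X" _ 0] zero_closed by simp
    show ?thesis
      unfolding finite_dimensional_def
    proof (intro exI[of _ p] allI impI)
      fix u :: "nat \<Rightarrow> 'a" assume u: "\<forall>i. u i \<in> carr X"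
      then have "\<forall>i. T (u i) \<in> carr Y" using T(1) by (simp add: linear_map_def)
      then obtain a where a: "\<exists>i<Suc p. a i \<noteq> 0" "lsum Y a (\<lambda>i. T (u i)) (Suc p) = vzero Y" using p[of "\<lambda>i. T (u i)"] by blast
      then have "T (lsum X a u (Suc p)) = T (vzero X)" using lsum_linear_map[OF X Y T(1), of u a "Suc p"] u Tz by simp
      then have "lsum X a u (Suc p) = vzero X"
        using T(2) u lsum_closed[of "Suc p" u a] zero_closed unfolding bij_betw_def inj_on_def by blast
      then show "\<exists>a. (\<exists>i<Suc p. a i \<noteq> 0) \<and> lsum X a u (Suc p) = vzero X" using a by blast
    qed
  qed
qed

text \<open>Every passage to a dual produces an \<open>\<ell>\<^sub>1\<close> sequence; the alternative \<open>c\<^sub>0\<close> is there for \<open>n = 0\<close>.\<close>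

theorem iterated_dual_transfer:
  fixes D :: "'u nspace"
  assumes "iterated_dual n X D" "zero_scaling X"
  shows "normed_space D" and "finite_dimensional X \<Longrightarrow> finite_dimensional D"
    and "has_ell1_sequence X \<or> has_c0_sequence X \<Longrightarrow> has_ell1_sequence D \<or> has_c0_sequence D"
  using assms
proof (induction n arbitrary: D)
  case 0
  { case 1 then show ?case by simp }
  { case 2 then show ?case using isometric_transfer(3) by auto }
  { case 3 then show ?case using isometric_transfer(1,2) by fastforce }
next
  case (Suc n)
  { case 1 then show ?case by simp }
  { case 2
    then obtain D' :: "'u nspace" where D': "normed_space D" "iterated_dual n X D'" "D \<cong>\<^sub>i dual D'" by auto
    then have "normed_space D'" "finite_dimensional D'" using Suc.IH 2 by auto
    then show ?case using D' isometric_transfer(3) normed_space.finite_dimensional_dual zero_scaling_dual by blast }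
  { case 3
    then obtain D' :: "'u nspace" where D': "normed_space D" "iterated_dual n X D'" "D \<cong>\<^sub>i dual D'" by auto
    then have "normed_space D'" "has_ell1_sequence D' \<or> has_c0_sequence D'" using Suc.IH 3 by auto
    then have "has_ell1_sequence (dual D')"
      using normed_space.dual_has_ell1_if_ell1 normed_space.dual_has_ell1_if_c0 by blast
    then show ?case using D' isometric_transfer(1) zero_scaling_dual by blast }
qed

section \<open>Normed spaces that are types\<close>

lemma normed_space_space_of:
  assumes "subspace V"
  shows "normed_space (space_of V)"
  using assms
  by unfold_locales (auto simp: space_of_def subspace_add subspace_0 subspace_scale algebra_simps
      scaleR_add_left intro: norm_triangle_ineq)

lemma normed_space_type_space: "normed_space (type_space TYPE('e::real_normed_vector))"
  unfolding type_space_def by (intro normed_space_space_of subspace_UNIV)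

lemma carr_type_space [simp]: "carr (type_space TYPE('e::real_normed_vector)) = UNIV"
  and vnorm_type_space [simp]: "vnorm (type_space TYPE('e::real_normed_vector)) = norm"
  by (simp_all add: type_space_def space_of_def)

lemma space_of_simps [simp]:
  "carr (space_of V) = V" "vadd (space_of V) = (+)" "vzero (space_of V) = 0"
  "vscale (space_of V) = (*\<^sub>R)" "vnorm (space_of V) = norm"
  by (simp_all add: space_of_def)

lemma lsum_space_of: "lsum (space_of V) a u m = (\<Sum>i<m. a i *\<^sub>R u i)"
  by (induction m) auto

lemma lsum_type_space: "lsum (type_space TYPE('e::real_normed_vector)) a u m = (\<Sum>i<m. a i *\<^sub>R u i)"
  by (simp add: type_space_def lsum_space_of)

lemma Lip0_onto_ell1_if_sequence:
  assumes "has_ell1_sequence (type_space TYPE('e::real_normed_vector)) \<or> has_c0_sequence (type_space TYPE('e))"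
  shows "\<exists>T. bounded_linear_map (Lip0_space (0::'e)) ell1_space T \<and>
             T ` carr (Lip0_space (0::'e)) = carr ell1_space"
  using assms
proof
  assume "has_ell1_sequence (type_space TYPE('e))"
  then obtain u :: "nat \<Rightarrow> 'e" and B c where "c > 0" "\<And>i. norm (u i) \<le> B"
     "\<And>a m. c * (\<Sum>i<m. \<bar>a i\<bar>) \<le> norm (\<Sum>i<m. a i *\<^sub>R u i)"
    unfolding has_ell1_sequence_def lsum_type_space vnorm_type_space by blast
  then show ?thesis by (intro Lip0_onto_ell1_if_ell1_sequence[of u B c]) auto
next
  assume "has_c0_sequence (type_space TYPE('e))"
  then obtain u :: "nat \<Rightarrow> 'e" and B c where "c > 0"
     "\<And>a m b. 0 \<le> b \<Longrightarrow> \<forall>i<m. \<bar>a i\<bar> \<le> b \<Longrightarrow> norm (\<Sum>i<m. a i *\<^sub>R u i) \<le> B * b"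
     "\<And>a m i. i < m \<Longrightarrow> c * \<bar>a i\<bar> \<le> norm (\<Sum>i<m. a i *\<^sub>R u i)"
    unfolding has_c0_sequence_def lsum_type_space vnorm_type_space by blast
  then show ?thesis by (intro Lip0_onto_ell1_if_c0_sequence[of u B c]) auto
qed

lemma infinite_dimensional_type_space:
  assumes "infinite_dimensional TYPE('e::real_normed_vector)"
  shows "\<not> finite_dimensional (type_space TYPE('e))"
proof
  assume "finite_dimensional (type_space TYPE('e))"
  then obtain u :: "nat \<Rightarrow> 'e" and q where "\<And>x. \<exists>a. x = (\<Sum>i<q. a i *\<^sub>R u i)"
    using normed_space.finite_dimensional_spanning[OF normed_space_type_space]
    unfolding lsum_type_space carr_type_space by (metis UNIV_I)
  then have "x \<in> span (u ` {..<q})" for x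
    by (metis (no_types, lifting) image_eqI span_base span_scale span_sum)
  then show False using assms unfolding infinite_dimensional_def by (metis UNIV_eq_I finite_imageI finite_lessThan)
qed

lemma infinite_dimensional_nonzero:
  assumes "infinite_dimensional TYPE('e::real_vector)"
  obtains x :: "'e::real_vector" where "x \<noteq> 0"
proof -
  have "\<exists>x::'e. x \<noteq> 0"
  proof (rule ccontr)
    assume "\<nexists>x::'e. x \<noteq> 0"
    then have "span {} = (UNIV :: 'e set)" by auto
    then show False using assms unfolding infinite_dimensional_def by blast
  qed
  then show ?thesis using that by blast
qed

text \<open>Finite dimension passes to duals, so the space at the bottom of an infinite-dimensional iterated
  dual cannot be finite-dimensional.\<close>

lemma iterated_dual_has_sequence:
  assumes "infinite_dimensional TYPE('e::real_normed_vector)"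
    and iter: "is_iterated_dual TYPE('u) n X (type_space TYPE('e::real_normed_vector))"
    and X: "zero_scaling X" "\<not> finite_dimensional X \<Longrightarrow> has_ell1_sequence X \<or> has_c0_sequence X"
  shows "has_ell1_sequence (type_space TYPE('e::real_normed_vector)) \<or> has_c0_sequence (type_space TYPE('e))"
proof -
  obtain D :: "'u nspace" where D: "iterated_dual n X D" "type_space TYPE('e) \<cong>\<^sub>i D"
    using iter by (auto simp: is_iterated_dual_def)
  have zD: "zero_scaling D" using iterated_dual_transfer(1)[OF D(1) X(1)] by (rule normed_space.zero_scaling)
  have "\<not> finite_dimensional D"
    using isometric_transfer(3)[OF normed_space_type_space zD D(2)] infinite_dimensional_type_space[OF assms(1)] by blast
  then have "has_ell1_sequence D \<or> has_c0_sequence D"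
    using iterated_dual_transfer(2,3)[OF D(1) X(1)] X(2) by blast
  then show ?thesis using isometric_transfer(1,2)[OF normed_space_type_space zD D(2)] by blast
qed

section \<open>Continuous functions\<close>

text \<open>
  If all points are isolated, singletons will do. Otherwise separate points, one after the other, from
  a fixed point \<open>y\<close> that is not isolated, inside smaller and smaller neighbourhoods \<open>W n\<close> of \<open>y\<close>.
\<close>

lemma infinite_t2_disjoint_opens:
  assumes "infinite (UNIV :: 'y::t2_space set)"
  obtains x :: "nat \<Rightarrow> 'y::t2_space" and U where "\<And>i. open (U i)" "\<And>i. x i \<in> U i" "\<And>i j. i \<noteq> j \<Longrightarrow> U i \<inter> U j = {}"
proof (cases "\<forall>y::'y. open {y}")
  case True
  obtain x :: "nat \<Rightarrow> 'y" where "inj x" using assms infinite_countable_subset by blast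
  then show ?thesis using True by (intro that[of "\<lambda>i. {x i}" x]) (auto simp: inj_eq)
next
  case False
  then obtain y :: 'y where y: "\<not> open {y}" by blast
  define Q where "Q W W' \<longleftrightarrow> W' \<subseteq> W \<and> (\<exists>U x. open U \<and> x \<in> U \<and> U \<subseteq> W \<and> U \<inter> W' = {})" for W W' :: "'y set"
  have "\<exists>W. \<forall>n. (open (W n) \<and> y \<in> W n) \<and> Q (W n) (W (Suc n))"
  proof (rule dependent_nat_choice)
    show "\<exists>x::'y set. open x \<and> y \<in> x" using open_UNIV by blast
    fix W :: "'y set" assume W: "open W \<and> y \<in> W"
    then have "W \<noteq> {y}" using y by auto
    then obtain x where x: "x \<in> W" "x \<noteq> y" using W by blast
    then obtain A B where "open A" "open B" "x \<in> A" "y \<in> B" "A \<inter> B = {}"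
      using hausdorff[OF x(2)] by blast
    then show "\<exists>W'. (open W' \<and> y \<in> W') \<and> Q W W'"
      unfolding Q_def using W x
      by (intro exI[of _ "B \<inter> W"] conjI exI[of _ "A \<inter> W"] exI[of _ x]) (auto intro: open_Int)
  qed
  then obtain W where "\<And>n. Q (W n) (W (Suc n))" by blast
  then obtain U x where W: "\<And>n. W (Suc n) \<subseteq> W n" and U: "\<And>n. open (U n)" "\<And>n. x n \<in> U n"
    "\<And>n. U n \<subseteq> W n" "\<And>n. U n \<inter> W (Suc n) = {}"
    unfolding Q_def by metis
  have "U i \<inter> U j = {}" if "i < j" for i j
    using lift_Suc_antimono_le[of W "Suc i" j] W U(3,4) that by (meson Suc_leI disjoint_iff subsetD)
  then have "U i \<inter> U j = {}" if "i \<noteq> j" for i j using that by (metis Int_commute nat_neq_iff)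
  then show ?thesis using that U by blast
qed

lemma locally_compact_bump:
  assumes lc: "locally_compact_space (euclidean :: 'y::t2_space topology)" and U: "open U" "x \<in> (U::'y::t2_space set)"
  obtains f :: "'y::t2_space \<Rightarrow>\<^sub>C real" and K where "apply_bcontfun f x = 1" "\<And>y. \<bar>apply_bcontfun f y\<bar> \<le> 1"
    "\<And>y. y \<notin> U \<Longrightarrow> apply_bcontfun f y = 0" "compact K" "\<And>y. y \<notin> K \<Longrightarrow> apply_bcontfun f y = 0"
proof -
  have "\<forall>x::'y. \<exists>V K. open V \<and> compact K \<and> x \<in> V \<and> V \<subseteq> K"
    using lc unfolding locally_compact_space_def by simp
  then obtain V K where VK: "open V" "compact K" "x \<in> V" "V \<subseteq> K"
    by blast
  have "Hausdorff_space (euclidean :: 'y topology)"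
    unfolding Hausdorff_space_def disjnt_def using hausdorff by auto
  then have "completely_regular_space (euclidean :: 'y topology)"
    using lc locally_compact_regular_imp_completely_regular_space by blast
  moreover have "closedin euclidean (- (U \<inter> V))" using U VK by (auto intro: open_Int)
  moreover have "x \<in> topspace euclidean - (- (U \<inter> V))" using U VK by auto
  ultimately obtain g where g: "continuous_map euclidean (top_of_set {0..1::real}) g" "g x = 0" "g ` (- (U \<inter> V)) \<subseteq> {1}"
    unfolding completely_regular_space_def by meson
  then have g01: "0 \<le> g y" "g y \<le> 1" and cont: "continuous_on UNIV g" for y
    by (auto simp: continuous_map_in_subtopology)
  define f where "f = Bcontfun (\<lambda>y. 1 - g y)"
  have "(\<lambda>y. 1 - g y) \<in> bcontfun"
    by (rule bcontfun_normI[where b = 1]) (use g01 cont in \<open>auto intro: continuous_intros\<close>)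
  then have f: "apply_bcontfun f y = 1 - g y" for y by (simp add: f_def Bcontfun_inverse)
  have "g y = 1" if "y \<notin> U \<or> y \<notin> K" for y using g(3) VK(4) that by blast
  then show ?thesis
    by (intro that[of f K]) (use f g(2) g01 VK in auto)
qed

lemma apply_bcontfun_sum_scaleR:
  "apply_bcontfun (\<Sum>i<(m::nat). a i *\<^sub>R u i) y = (\<Sum>i<m. a i * apply_bcontfun (u i) y)"
  by (induction m) (auto simp: plus_bcontfun.rep_eq scaleR_bcontfun.rep_eq)

lemma disjoint_bumps_norm:
  fixes f :: "nat \<Rightarrow> 'y::topological_space \<Rightarrow>\<^sub>C real"
  assumes x: "\<And>i. apply_bcontfun (f i) (x i) = 1" and f1: "\<And>i y. \<bar>apply_bcontfun (f i) y\<bar> \<le> 1"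
    and disj: "\<And>i j y. i \<noteq> j \<Longrightarrow> apply_bcontfun (f i) y = 0 \<or> apply_bcontfun (f j) y = 0"
  shows "0 \<le> b \<Longrightarrow> (\<And>i. i < m \<Longrightarrow> \<bar>a i\<bar> \<le> b) \<Longrightarrow> norm (\<Sum>i<m. a i *\<^sub>R f i) \<le> b"
    and "i < m \<Longrightarrow> \<bar>a i\<bar> \<le> norm (\<Sum>i<m. a i *\<^sub>R f i)"
proof -
  have single: "(\<Sum>j<m. a j * apply_bcontfun (f j) y) = a i * apply_bcontfun (f i) y"
    if "i < m" "apply_bcontfun (f i) y \<noteq> 0" for i y
  proof -
    have "apply_bcontfun (f j) y = 0" if "j \<noteq> i" for j
      using disj[OF that, of y] \<open>apply_bcontfun (f i) y \<noteq> 0\<close> by simp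
    then show ?thesis using that(1) by (subst sum.remove[of _ i]) auto
  qed
  { assume b: "0 \<le> b" "\<And>i. i < m \<Longrightarrow> \<bar>a i\<bar> \<le> b"
    show "norm (\<Sum>i<m. a i *\<^sub>R f i) \<le> b"
    proof (rule norm_bound)
      fix y
      show "norm (apply_bcontfun (\<Sum>i<m. a i *\<^sub>R f i) y) \<le> b"
      proof (cases "\<exists>i<m. apply_bcontfun (f i) y \<noteq> 0")
        case True
        then obtain i where i: "i < m" "apply_bcontfun (f i) y \<noteq> 0" by blast
        have "\<bar>a i\<bar> * \<bar>apply_bcontfun (f i) y\<bar> \<le> b * 1" using b i f1 by (intro mult_mono) auto
        then show ?thesis by (simp add: apply_bcontfun_sum_scaleR single[OF i] abs_mult)
      qed (use b in \<open>auto simp: apply_bcontfun_sum_scaleR\<close>)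
    qed }
  { assume i: "i < m"
    have "norm (apply_bcontfun (\<Sum>i<m. a i *\<^sub>R f i) (x i)) \<le> norm (\<Sum>i<m. a i *\<^sub>R f i)"
      by (rule norm_bounded)
    then show "\<bar>a i\<bar> \<le> norm (\<Sum>i<m. a i *\<^sub>R f i)"
      using single[OF i, of "x i"] x by (simp add: apply_bcontfun_sum_scaleR) }
qed

text \<open>The constants are both \<open>1\<close>: for a predual of \<open>C(K)\<close> it matters that the sequence is isometric to
  the unit vector basis.\<close>

lemma exists_disjoint_bumps:
  assumes lc: "locally_compact_space (euclidean :: 'y::t2_space topology)" and inf: "infinite (UNIV :: 'y::t2_space set)"
  obtains f :: "nat \<Rightarrow> 'y::t2_space \<Rightarrow>\<^sub>C real" where "\<And>i. f i \<in> carr (C0_space TYPE('y))"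
    "\<And>b a m. 0 \<le> b \<Longrightarrow> (\<And>i. i < m \<Longrightarrow> \<bar>a i\<bar> \<le> b) \<Longrightarrow> norm (\<Sum>i<m. a i *\<^sub>R f i) \<le> b"
    "\<And>i a m. i < m \<Longrightarrow> \<bar>a i\<bar> \<le> norm (\<Sum>i<m. a i *\<^sub>R f i)"
proof -
  obtain x :: "nat \<Rightarrow> 'y" and U where U: "\<And>i. open (U i)" "\<And>i. x i \<in> U i" "\<And>i j. i \<noteq> j \<Longrightarrow> U i \<inter> U j = {}"
    using infinite_t2_disjoint_opens[OF inf] by metis
  have "\<exists>f K. apply_bcontfun f (x i) = 1 \<and> (\<forall>y. \<bar>apply_bcontfun f y\<bar> \<le> (1::real)) \<and>
    (\<forall>y. y \<notin> U i \<longrightarrow> apply_bcontfun f y = 0) \<and> compact K \<and> (\<forall>y. y \<notin> K \<longrightarrow> apply_bcontfun f y = 0)" for i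
    using locally_compact_bump[OF lc U(1)[of i] U(2)[of i]] by metis
  then obtain f :: "nat \<Rightarrow> 'y \<Rightarrow>\<^sub>C real" and K where f: "\<And>i. apply_bcontfun (f i) (x i) = 1"
    "\<And>i y. \<bar>apply_bcontfun (f i) y\<bar> \<le> 1" "\<And>i y. y \<notin> U i \<Longrightarrow> apply_bcontfun (f i) y = 0"
    "\<And>i. compact (K i)" "\<And>i y. y \<notin> K i \<Longrightarrow> apply_bcontfun (f i) y = 0"
    by metis
  have disj: "apply_bcontfun (f i) y = 0 \<or> apply_bcontfun (f j) y = 0" if "i \<noteq> j" for i j y
    using f(3) U(3)[OF that] by blast
  show ?thesis
  proof (rule that[of f])
    show "f i \<in> carr (C0_space TYPE('y))" for i
      using f(4,5) unfolding C0_space_def by (auto intro!: exI[of _ "K i"])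
  qed (use disjoint_bumps_norm[of f x, OF f(1,2) disj] in blast)+
qed

lemma C0_space_has_c0:
  assumes "locally_compact_space (euclidean :: 'y::t2_space topology)" "infinite (UNIV :: 'y::t2_space set)"
  shows "has_c0_sequence (C0_space TYPE('y::t2_space))"
proof -
  obtain f :: "nat \<Rightarrow> 'y \<Rightarrow>\<^sub>C real" where f: "\<And>i. f i \<in> carr (C0_space TYPE('y))"
    "\<And>b a m. 0 \<le> b \<Longrightarrow> (\<And>i. i < m \<Longrightarrow> \<bar>a i\<bar> \<le> b) \<Longrightarrow> norm (\<Sum>i<m. a i *\<^sub>R f i) \<le> b"
    "\<And>i a m. i < m \<Longrightarrow> \<bar>a i\<bar> \<le> norm (\<Sum>i<m. a i *\<^sub>R f i)"
    by (rule exists_disjoint_bumps[OF assms]) blast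
  show ?thesis
    unfolding has_c0_sequence_def
    by (intro exI[of _ f] exI[of _ 1])
       (use f in \<open>simp_all add: C0_space_def lsum_space_of\<close>)
qed

lemma finite_dimensional_bcontfun:
  assumes "finite (UNIV :: 'y::topological_space set)"
  shows "finite_dimensional (space_of (V :: ('y::topological_space \<Rightarrow>\<^sub>C real) set))"
proof (rule finite_dimensionalI[of UNIV _ "apply_bcontfun"])
  fix u :: "nat \<Rightarrow> 'y \<Rightarrow>\<^sub>C real" and a :: "nat \<Rightarrow> real" and m
  assume "\<And>j. j \<in> UNIV \<Longrightarrow> (\<Sum>i<m. a i * apply_bcontfun (u i) j) = 0"
  then show "lsum (space_of V) a u m = vzero (space_of V)"
    by (auto intro: bcontfun_eqI simp: lsum_space_of apply_bcontfun_sum_scaleR zero_bcontfun.rep_eq)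
qed (rule assms)

lemma C0_space_finite:
  "finite (UNIV :: 'y::topological_space set) \<Longrightarrow> finite_dimensional (C0_space TYPE('y))"
  unfolding C0_space_def by (rule finite_dimensional_bcontfun)

lemma zero_scaling_C0: "zero_scaling (C0_space TYPE('y::topological_space))"
  by (simp add: zero_scaling_def C0_space_def)

lemma (in normed_space) exists_norming_functional:
  assumes x: "x \<in> carr X" "x \<noteq> vzero X"
  obtains f where "f \<in> carr (dual X)" "f x = 1"
proof -
  define u where "u i = (if i = 0 then x else vzero X)" for i :: nat
  define s where "s i = (if i = 0 then 1 else 0 :: real)" for i :: nat
  have nx: "vnorm X x > 0" using x norm_nonneg norm_eq_zero by (simp add: order_less_le)
  have u: "u i \<in> carr X" for i using x by (simp add: u_def vs)
  have eq: "lsum X a u (Suc m) = vscale X (a 0) x \<and> (\<Sum>i<Suc m. a i * s i) = a 0" for a m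
    by (induction m) (use x in \<open>auto simp: u_def s_def vs\<close>)
  have "(\<Sum>i<m. a i * s i) \<le> 1 / vnorm X x * vnorm X (lsum X a u m)" for a m
  proof (cases m)
    case (Suc k)
    then show ?thesis using eq[of a k] nx x by (simp add: norm_scale)
  qed (simp add: norm_zero)
  from exists_functional_with_values[OF u _ this] nx obtain f where "f \<in> carr (dual X)" "\<And>i. f (u i) = s i"
    by (metis divide_nonneg_pos zero_le_one)
  then show ?thesis using that[of f] by (metis u_def s_def)
qed

text \<open>
  The isometry \<open>S\<close> carries disjoint bumps to functionals on \<open>E\<close>, to which
  \<open>has_ell1_if_dual_isometric_c0\<close> applies. The compact space must be infinite: otherwise finitely many
  functionals would span the dual of \<open>E\<close>, and they would separate the points of \<open>E\<close>.
\<close>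

lemma predual_C_has_ell1:
  assumes inf: "infinite_dimensional TYPE('e::real_normed_vector)" and K: "compact (UNIV :: 'k::t2_space set)"
    and pre: "is_predual (type_space TYPE('e::real_normed_vector)) (type_space TYPE('k::t2_space \<Rightarrow>\<^sub>C real))"
  shows "has_ell1_sequence (type_space TYPE('e::real_normed_vector))"
proof -
  let ?E = "type_space TYPE('e)" and ?C = "type_space TYPE('k \<Rightarrow>\<^sub>C real)"
  interpret E: normed_space ?E by (rule normed_space_type_space)
  interpret C: normed_space ?C by (rule normed_space_type_space)
  obtain S where S: "linear_map ?C (dual ?E) S" "bij_betw S UNIV (carr (dual ?E))"
    "\<And>g. vnorm (dual ?E) (S g) = norm g"
    using pre unfolding is_predual_def isometrically_isomorphic_def by auto
  have S_dual: "S g \<in> carr (dual ?E)" for g using S(1) by (simp add: linear_map_def)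
  have S_lsum: "lsum (dual ?E) a (\<lambda>i. S (g i)) m = S (\<Sum>i<m. a i *\<^sub>R g i)" for a g m
    using lsum_linear_map[OF normed_space_type_space zero_scaling_dual S(1), of g a m] by (simp add: lsum_type_space)
  have inf_K: "infinite (UNIV :: 'k set)"
  proof
    assume fin: "finite (UNIV :: 'k set)"
    then have "finite_dimensional ?C"
      unfolding type_space_def by (rule finite_dimensional_bcontfun)
    then obtain g :: "nat \<Rightarrow> 'k \<Rightarrow>\<^sub>C real" and q where span: "\<And>f. \<exists>a. f = lsum ?C a g q"
      using C.finite_dimensional_spanning by auto
    have "finite_dimensional ?E"
    proof (rule finite_dimensionalI[of "{..<q}" _ "\<lambda>x j. S (g j) x"])
      fix u :: "nat \<Rightarrow> 'e" and a :: "nat \<Rightarrow> real" and m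
      assume 0: "\<And>j. j \<in> {..<q} \<Longrightarrow> (\<Sum>i<m. a i * S (g j) (u i)) = 0"
      show "lsum ?E a u m = vzero ?E"
      proof (rule ccontr)
        assume "lsum ?E a u m \<noteq> vzero ?E"
        then obtain f where f: "f \<in> carr (dual ?E)" "f (lsum ?E a u m) = 1"
          using E.exists_norming_functional[of "lsum ?E a u m"] by auto
        obtain h where h: "f = S h" using f(1) S(2) unfolding bij_betw_def by blast
        obtain b where "h = lsum ?C b g q" using span by blast
        then have "f = lsum (dual ?E) b (\<lambda>j. S (g j)) q" by (simp add: h S_lsum lsum_type_space)
        then have "f (lsum ?E a u m) = (\<Sum>j<q. b j * S (g j) (lsum ?E a u m))" by (simp add: lsum_dual)
        also have "\<dots> = 0"
          using 0 by (intro sum.neutral) (simp add: E.dual_lsum[OF S_dual])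
        finally show False using f(2) by simp
      qed
    qed simp
    then show False using infinite_dimensional_type_space[OF inf] by blast
  qed
  have lc: "locally_compact_space (euclidean :: 'k topology)"
    using K by (intro compact_imp_locally_compact_space) (simp add: compact_space_def)
  obtain f :: "nat \<Rightarrow> 'k \<Rightarrow>\<^sub>C real" where f:
    "\<And>b a m. 0 \<le> b \<Longrightarrow> (\<And>i. i < m \<Longrightarrow> \<bar>a i\<bar> \<le> b) \<Longrightarrow> norm (\<Sum>i<m. a i *\<^sub>R f i) \<le> b"
    "\<And>i a m. i < m \<Longrightarrow> \<bar>a i\<bar> \<le> norm (\<Sum>i<m. a i *\<^sub>R f i)"
    by (rule exists_disjoint_bumps[OF lc inf_K]) blast
  show ?thesis
  proof (rule E.has_ell1_if_dual_isometric_c0[of "\<lambda>i. S (f i)"])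
    show "S (f i) \<in> carr (dual ?E)" for i by (rule S_dual)
    show "vnorm (dual ?E) (S (f i)) = 1" for i
    proof -
      define a where "a j = (if j = i then 1 else 0 :: real)" for j
      have "(\<Sum>j<Suc i. a j *\<^sub>R f j) = f i" by (simp add: a_def)
      moreover have "norm (\<Sum>j<Suc i. a j *\<^sub>R f j) \<le> 1" by (rule f(1)) (auto simp: a_def)
      moreover have "\<bar>a i\<bar> \<le> norm (\<Sum>j<Suc i. a j *\<^sub>R f j)" by (rule f(2)) simp
      ultimately show ?thesis by (simp add: S(3) a_def)
    qed
    show "vnorm (dual ?E) (lsum (dual ?E) a (\<lambda>i. S (f i)) m) \<le> 1" if "\<And>i. i < m \<Longrightarrow> \<bar>a i\<bar> \<le> 1" for a m
      using f(1)[of 1 m a] that by (simp add: S_lsum S(3))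
  qed
qed

section \<open>Operators and bilinear maps\<close>

lemma has_c0_sequence_embedding:
  assumes X: "normed_space X" "has_c0_sequence X" and Y: "zero_scaling Y" and T: "linear_map X Y T"
    and k: "k1 > 0" "\<And>x. x \<in> carr X \<Longrightarrow> k1 * vnorm X x \<le> vnorm Y (T x)"
      "\<And>x. x \<in> carr X \<Longrightarrow> vnorm Y (T x) \<le> k2 * vnorm X x"
  shows "has_c0_sequence Y"
proof -
  interpret normed_space X by fact
  obtain u B c where u: "\<And>i. u i \<in> carr X" and c: "c > 0"
    and upper: "\<And>a m b. 0 \<le> b \<Longrightarrow> \<forall>i<m. \<bar>a i\<bar> \<le> b \<Longrightarrow> vnorm X (lsum X a u m) \<le> B * b"
    and lower: "\<And>a m i. i < m \<Longrightarrow> c * \<bar>a i\<bar> \<le> vnorm X (lsum X a u m)"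
    using X(2) unfolding has_c0_sequence_def by metis
  have Tu: "lsum Y a (\<lambda>i. T (u i)) m = T (lsum X a u m)" for a m
    using lsum_linear_map[OF X(1) Y T u] by simp
  have x: "lsum X a u m \<in> carr X" for a m using u lsum_closed by blast
  show ?thesis
    unfolding has_c0_sequence_def Tu
  proof (rule exI[of _ "\<lambda>i. T (u i)"], rule exI[of _ "\<bar>k2\<bar> * B"], rule exI[of _ "k1 * c"],
      unfold Tu, intro conjI allI impI)
    show "k1 * c > 0" using k(1) c by simp
    show "T (u i) \<in> carr Y" for i using T u by (simp add: linear_map_def)
    show "vnorm Y (T (lsum X a u m)) \<le> \<bar>k2\<bar> * B * b" if "0 \<le> b" "\<forall>i<m. \<bar>a i\<bar> \<le> b" for a m b
    proof -
      have "k2 * vnorm X (lsum X a u m) \<le> \<bar>k2\<bar> * vnorm X (lsum X a u m)"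
        using norm_nonneg[OF x] by (intro mult_right_mono) auto
      then show ?thesis
        using k(3)[OF x, of a m] mult_left_mono[OF upper[OF that], of "\<bar>k2\<bar>"] by (simp add: mult.assoc)
    qed
    show "k1 * c * \<bar>a i\<bar> \<le> vnorm Y (T (lsum X a u m))" if "i < m" for a m i
      using order_trans[OF mult_left_mono[OF lower[OF that, where a = a], of k1] k(2)[OF x]] k(1)
      by (simp add: mult.assoc)
  qed
qed

lemma c0_space_has_c0: "has_c0_sequence c0_space"
proof -
  define f :: "nat \<Rightarrow> nat \<Rightarrow>\<^sub>C real" where "f i = Bcontfun (\<lambda>n. if n = i then 1 else 0)" for i
  have "(\<lambda>n. if n = i then 1 else 0 :: real) \<in> bcontfun" for i :: nat
    by (rule bcontfun_normI[where b = 1]) auto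
  then have f: "apply_bcontfun (f i) n = (if n = i then 1 else 0)" for i n
    by (simp add: f_def Bcontfun_inverse)
  have bumps: "0 \<le> b \<Longrightarrow> (\<And>i. i < m \<Longrightarrow> \<bar>a i\<bar> \<le> b) \<Longrightarrow> norm (\<Sum>i<m. a i *\<^sub>R f i) \<le> b"
    "i < m \<Longrightarrow> \<bar>a i\<bar> \<le> norm (\<Sum>i<m. a i *\<^sub>R f i)" for a b i m
    using disjoint_bumps_norm[of f id] by (simp_all add: f)
  have "(\<lambda>n. apply_bcontfun (f i) n) \<longlonglongrightarrow> 0" for i
    by (rule tendsto_eventually) (auto simp: f eventually_sequentially intro!: exI[of _ "Suc i"])
  then show ?thesis
    unfolding has_c0_sequence_def
    by (intro exI[of _ f] exI[of _ 1]) (use bumps in \<open>simp_all add: c0_space_def lsum_space_of\<close>)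
qed

lemma contains_copy_has_c0:
  assumes "contains_copy (type_space TYPE('z::real_normed_vector)) c0_space"
  shows "has_c0_sequence (type_space TYPE('z::real_normed_vector))"
proof -
  let ?Z = "type_space TYPE('z)"
  have sub: "subspace {a :: nat \<Rightarrow>\<^sub>C real. apply_bcontfun a \<longlonglongrightarrow> 0}"
    unfolding subspace_def
    by (auto simp: zero_bcontfun.rep_eq plus_bcontfun.rep_eq scaleR_bcontfun.rep_eq
        intro: tendsto_add_zero tendsto_mult_right_zero)
  then have c0: "normed_space c0_space" unfolding c0_space_def by (rule normed_space_space_of)
  obtain T C c where T: "linear_map c0_space ?Z T" and C: "\<And>x. x \<in> carr c0_space \<Longrightarrow> vnorm ?Z (T x) \<le> C * vnorm c0_space x"
    and c: "c > 0" "\<And>x. x \<in> carr c0_space \<Longrightarrow> c * vnorm c0_space x \<le> vnorm ?Z (T x)"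
    using assms unfolding contains_copy_def bounded_linear_map_def by blast
  show ?thesis
    by (rule has_c0_sequence_embedding[OF c0 c0_space_has_c0
          normed_space.zero_scaling[OF normed_space_type_space] T c C])
qed

lemma exists_bounded_functional:
  fixes y :: "'y::real_normed_vector"
  assumes "y \<noteq> 0"
  obtains f :: "'y::real_normed_vector \<Rightarrow> real" where "bounded_linear f" "f y = 1"
proof -
  interpret normed_space "type_space TYPE('y)" by (rule normed_space_type_space)
  have "y \<noteq> vzero (type_space TYPE('y))" using assms by (simp add: type_space_def)
  then obtain f where f: "f \<in> carr (dual (type_space TYPE('y)))" "f y = 1"
    using exists_norming_functional[of y] by auto
  obtain K where "\<And>x. \<bar>f x\<bar> \<le> K * norm x" using f(1) by (auto simp: dual_iff)
  then have "bounded_linear f"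
    using dual_linear(1,2)[OF f(1)]
    by (intro bounded_linear_intro[where K = K]) (auto simp: type_space_def mult.commute)
  then show ?thesis using that f(2) by blast
qed

text \<open>With a functional \<open>f\<close> that is \<open>1\<close> at \<open>y\<close>, the rank-one operators \<open>x \<mapsto> f x * z\<close> embed \<open>Z\<close>.\<close>

lemma operators_have_c0:
  assumes "infinite_dimensional TYPE('y::real_normed_vector)" and Z: "has_c0_sequence (type_space TYPE('z::real_normed_vector))"
  shows "has_c0_sequence (type_space TYPE('y::real_normed_vector \<Rightarrow>\<^sub>L 'z::real_normed_vector))"
proof -
  obtain y :: 'y where y: "y \<noteq> 0" using infinite_dimensional_nonzero[OF assms(1)] by blast
  obtain f :: "'y \<Rightarrow> real" where f: "bounded_linear f" "f y = 1" using exists_bounded_functional[OF y] by blast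
  obtain K where K: "0 \<le> K" "\<And>x. \<bar>f x\<bar> \<le> norm x * K" using bounded_linear.nonneg_bounded[OF f(1)] by auto
  define T where "T z = Blinfun (\<lambda>x. f x *\<^sub>R z)" for z :: 'z
  have "bounded_linear (\<lambda>x. f x *\<^sub>R z)" for z :: 'z
    by (rule bounded_linear_compose[OF bounded_linear_scaleR_left f(1)])
  then have T: "blinfun_apply (T z) x = f x *\<^sub>R z" for z x
    by (simp add: T_def bounded_linear_Blinfun_apply)
  show ?thesis
  proof (rule has_c0_sequence_embedding[OF normed_space_type_space Z normed_space.zero_scaling[OF normed_space_type_space]])
    show "linear_map (type_space TYPE('z)) (type_space TYPE('y \<Rightarrow>\<^sub>L 'z)) T"
      unfolding linear_map_def type_space_def
      by (auto intro!: blinfun_eqI simp: T blinfun.add_left blinfun.scaleR_left scaleR_add_right)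
    show "1 / norm y > 0" using y by simp
    show "1 / norm y * vnorm (type_space TYPE('z)) z \<le> vnorm (type_space TYPE('y \<Rightarrow>\<^sub>L 'z)) (T z)" for z
      using norm_blinfun[of "T z" y] y f(2) by (simp add: T field_simps)
    show "vnorm (type_space TYPE('y \<Rightarrow>\<^sub>L 'z)) (T z) \<le> K * vnorm (type_space TYPE('z)) z" for z
      unfolding vnorm_type_space
    proof (rule norm_blinfun_bound)
      show "norm (blinfun_apply (T z) x) \<le> K * norm z * norm x" for x
        using mult_right_mono[OF K(2)[of x] norm_ge_zero[of z]] by (simp add: T mult_ac)
    qed (use K in simp)
  qed
qed

lemma zero_scaling_Bil:
  "zero_scaling (Bil_space TYPE('y::real_normed_vector) TYPE('w::real_normed_vector) TYPE('z::real_normed_vector))"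
  by (simp add: zero_scaling_def Bil_space_def)

lemma bilinear_maps_have_c0:
  assumes "infinite_dimensional TYPE('y::real_normed_vector)" "infinite_dimensional TYPE('w::real_normed_vector)"
    and Z: "has_c0_sequence (type_space TYPE('z::real_normed_vector))"
  shows "has_c0_sequence (Bil_space TYPE('y::real_normed_vector) TYPE('w::real_normed_vector) TYPE('z::real_normed_vector))"
proof -
  let ?B = "Bil_space TYPE('y) TYPE('w) TYPE('z)"
  obtain y :: 'y where y: "y \<noteq> 0" using infinite_dimensional_nonzero[OF assms(1)] by blast
  obtain f :: "'y \<Rightarrow> real" where f: "bounded_linear f" "f y = 1" using exists_bounded_functional[OF y] by blast
  obtain K where K: "0 \<le> K" "\<And>x. \<bar>f x\<bar> \<le> norm x * K" using bounded_linear.nonneg_bounded[OF f(1)] by auto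
  obtain w :: 'w where w: "w \<noteq> 0" using infinite_dimensional_nonzero[OF assms(2)] by blast
  obtain g :: "'w \<Rightarrow> real" where g: "bounded_linear g" "g w = 1" using exists_bounded_functional[OF w] by blast
  obtain L where L: "0 \<le> L" "\<And>x. \<bar>g x\<bar> \<le> norm x * L" using bounded_linear.nonneg_bounded[OF g(1)] by auto
  define T where "T z = (\<lambda>s t. (f s * g t) *\<^sub>R z)" for z :: 'z
  have T_carr: "T z \<in> carr ?B" for z
  proof -
    have "bounded_bilinear (\<lambda>s t. f s *\<^sub>R (g t *\<^sub>R z))"
      by (rule bounded_bilinear.comp[OF bounded_bilinear_scaleR f(1)
            bounded_linear_compose[OF bounded_linear_scaleR_left g(1)]])
    then show ?thesis by (simp add: Bil_space_def T_def)
  qed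
  have le: "norm (T z s t) \<le> K * L * norm z" if "norm s \<le> 1" "norm t \<le> 1" for s t z
  proof -
    have "\<bar>f s\<bar> \<le> K" "\<bar>g t\<bar> \<le> L"
      using K(2)[of s] L(2)[of t] mult_right_mono[OF that(1) K(1)] mult_right_mono[OF that(2) L(1)] by auto
    then have "\<bar>f s * g t\<bar> \<le> K * L" unfolding abs_mult using K(1) by (intro mult_mono) auto
    then show ?thesis by (simp add: T_def mult_right_mono)
  qed
  have norm_T: "vnorm ?B (T z) = (SUP (s, t) \<in> {s. norm s \<le> 1} \<times> {t. norm t \<le> 1}. norm (T z s t))" for z
    by (simp add: Bil_space_def)
  show ?thesis
  proof (rule has_c0_sequence_embedding[OF normed_space_type_space Z zero_scaling_Bil])
    show "linear_map (type_space TYPE('z)) ?B T"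
      using T_carr unfolding linear_map_def type_space_def
      by (auto simp: Bil_space_def T_def fun_eq_iff scaleR_add_right)
    show "1 / (norm y * norm w) > 0" using y w by simp
    show "vnorm ?B (T z) \<le> K * L * vnorm (type_space TYPE('z)) z" for z
      unfolding norm_T vnorm_type_space by (rule cSUP_least) (use le in \<open>auto intro!: exI[of _ 0]\<close>)
    show "1 / (norm y * norm w) * vnorm (type_space TYPE('z)) z \<le> vnorm ?B (T z)" for z
    proof -
      have "norm (T z (y /\<^sub>R norm y) (w /\<^sub>R norm w)) \<le> vnorm ?B (T z)"
        unfolding norm_T
        by (rule cSUP_upper2[where x = "(y /\<^sub>R norm y, w /\<^sub>R norm w)"])
           (use le y w in \<open>auto intro!: bdd_aboveI2[where M = "K * L * norm z"]\<close>)
      then show ?thesis using f g by (simp add: T_def linear_simps field_simps)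
    qed
  qed
qed

section \<open>Infinite metric spaces\<close>

text \<open>
  Join \<open>x\<close> and \<open>p x\<close> by an edge and apply Ramsey's theorem. An infinite complete set is impossible: all
  but one of its points other than \<open>x\<close> would be sent to \<open>x\<close>, hence could not be joined to each other.
\<close>

lemma sequence_avoiding_values:
  fixes p :: "'a \<Rightarrow> 'a"
  assumes I: "infinite I" and p: "\<And>x. x \<in> I \<Longrightarrow> p x \<noteq> x"
  obtains J where "J \<subseteq> I" "infinite J" "\<And>x y. x \<in> J \<Longrightarrow> y \<in> J \<Longrightarrow> p x \<noteq> y"
proof -
  define col where "col e = (if \<exists>x y. e = {x, y} \<and> p x = y then 1 else 0 :: nat)" for e
  have "\<forall>x\<in>I. \<forall>y\<in>I. x \<noteq> y \<longrightarrow> col {x, y} < 2" by (simp add: col_def)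
  from Ramsey2[OF I this] obtain J t where J: "J \<subseteq> I" "infinite J"
    and col: "\<forall>x\<in>J. \<forall>y\<in>J. x \<noteq> y \<longrightarrow> col {x, y} = t" by (elim exE conjE)
  have col_1: "col {x, y} = 1 \<longleftrightarrow> p x = y \<or> p y = x" for x y
    by (auto simp: col_def doubleton_eq_iff)
  have fresh: "\<exists>y\<in>J. y \<notin> F" if "finite F" for F
    using Diff_infinite_finite[OF that J(2)] by (metis Diff_iff ex_in_conv finite.emptyI)
  have "t \<noteq> 1"
  proof
    assume "t = 1"
    then have adj: "p x = y \<or> p y = x" if "x \<in> J" "y \<in> J" "x \<noteq> y" for x y
      using col col_1[of x y] that by simp
    obtain x where x: "x \<in> J" using fresh[of "{}"] by blast
    obtain y where y: "y \<in> J" "y \<notin> {x, p x}" using fresh[of "{x, p x}"] by blast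
    obtain z where z: "z \<in> J" "z \<notin> {x, p x, y}" using fresh[of "{x, p x, y}"] by blast
    have "p y = x" "p z = x" using adj[OF x y(1)] adj[OF x z(1)] y z by auto
    then show False using adj[OF y(1) z(1)] y z by auto
  qed
  have "p x \<noteq> y" if xy: "x \<in> J" "y \<in> J" for x y
  proof
    assume "p x = y"
    then have "x \<noteq> y" "col {x, y} = 1" using p[of x] J(1) xy col_1 by auto
    then show False using col xy \<open>t \<noteq> 1\<close> by simp
  qed
  then show ?thesis using that[OF J] by blast
qed

text \<open>
  The open balls of radius \<open>r i\<close> around \<open>x i\<close> are far enough from each other that cones over them can
  be added with arbitrary signs without increasing the Lipschitz constant; the points \<open>y i\<close> lie
  outside of all balls, but at a distance from \<open>x i\<close> comparable to \<open>r i\<close>. Thus the slopes between \<open>x i\<close>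
  and \<open>y i\<close> can be prescribed independently of each other.
\<close>

definition bump_sequence :: "(nat \<Rightarrow> 'm::metric_space) \<Rightarrow> (nat \<Rightarrow> 'm) \<Rightarrow> (nat \<Rightarrow> real) \<Rightarrow> real \<Rightarrow> bool" where
  "bump_sequence x y r K \<longleftrightarrow> (\<forall>i. 0 < r i \<and> dist (x i) (y i) \<le> K * r i) \<and>
     (\<forall>i j. i \<noteq> j \<longrightarrow> r i + r j \<le> dist (x i) (x j)) \<and> (\<forall>i j. r j \<le> dist (y i) (x j))"

text \<open>Points whose distances to \<open>y\<close> decrease geometrically, with radii half of these distances.\<close>

lemma exists_bump_sequence_converging:
  fixes y :: "'m::metric_space"
  assumes "y islimpt UNIV"
  obtains x r where "bump_sequence x (\<lambda>_. y) r 2"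
proof -
  have ex: "\<exists>x. x \<noteq> y \<and> dist x y < e" if "e > 0" for e
    using assms that by (auto simp: islimpt_approachable)
  have "\<exists>x. \<forall>n. x n \<noteq> y \<and> dist (x (Suc n)) y < dist (x n) y / 4"
  proof (rule dependent_nat_choice)
    show "\<exists>x. x \<noteq> y" using ex[of 1] by auto
    show "\<exists>x'. x' \<noteq> y \<and> dist x' y < dist x y / 4" if "x \<noteq> y" for x
      using ex[of "dist x y / 4"] that by simp
  qed
  then obtain x where x: "\<And>n. x n \<noteq> y" "\<And>n. dist (x (Suc n)) y < dist (x n) y / 4" by blast
  have dec: "dist (x j) y \<le> dist (x i) y / 4" if "i < j" for i j
  proof -
    have "dist (x (Suc n)) y \<le> dist (x n) y" for n using x(2)[of n] zero_le_dist[of "x n" y] by linarith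
    then have "dist (x j) y \<le> dist (x (Suc i)) y"
      using lift_Suc_antimono_le[of "\<lambda>n. dist (x n) y" "Suc i" j] that by simp
    then show ?thesis using x(2)[of i] by linarith
  qed
  have sep: "dist (x i) y / 2 + dist (x j) y / 2 \<le> dist (x i) (x j)" if "i < j" for i j
    using dec[OF that] dist_triangle[of "x i" y "x j"] zero_le_dist[of "x i" y] by linarith
  have "bump_sequence x (\<lambda>_. y) (\<lambda>i. dist (x i) y / 2) 2"
    unfolding bump_sequence_def
  proof (intro conjI allI impI)
    show "dist (x i) y / 2 + dist (x j) y / 2 \<le> dist (x i) (x j)" if "i \<noteq> j" for i j
      using sep[of i j] sep[of j i] that by (auto simp: dist_commute nat_neq_iff)
    show "dist (x j) y / 2 \<le> dist y (x j)" for j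
      using zero_le_dist[of y "x j"] by (simp only: dist_commute[of "x j" y])
  qed (use x(1) in auto)
  then show ?thesis using that by blast
qed

text \<open>
  For isolated points the radius is half of the distance \<open>d x\<close> to the rest of the space, and \<open>p x\<close> is a
  point that almost attains this distance. The set \<open>J\<close> ensures that \<open>p x\<close> is not itself a centre.
\<close>

lemma exists_bump_sequence_isolated:
  assumes inf: "infinite {x::'m::metric_space. \<not> x islimpt UNIV}"
  obtains x y :: "nat \<Rightarrow> 'm::metric_space" and r where "bump_sequence x y r 4"
proof -
  let ?I = "{x::'m. \<not> x islimpt UNIV}"
  define d where "d x = infdist x (- {x})" for x :: 'm
  have ne: "- {x} \<noteq> {}" for x :: 'm
    using inf by (metis Compl_empty_eq double_complement finite.emptyI finite_insert finite_subset top_greatest)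
  have d_le: "d x \<le> dist x z" if "z \<noteq> x" for x z
    unfolding d_def using that by (intro infdist_le) auto
  have d_pos: "d x > 0" if x: "x \<in> ?I" for x
  proof -
    obtain e where e: "e > 0" "\<And>z. z \<noteq> x \<Longrightarrow> e \<le> dist x z"
      using x by (auto simp: islimpt_approachable dist_commute not_less)
    then have "e \<le> d x" unfolding d_def infdist_def using ne[of x] by (auto intro!: cINF_greatest)
    then show ?thesis using e(1) by linarith
  qed
  have "\<exists>z. z \<noteq> x \<and> dist x z \<le> 2 * d x" if "x \<in> ?I" for x
  proof -
    have "infdist x (- {x}) < 2 * d x" using d_pos[OF that] by (simp add: d_def)
    then obtain z where "z \<in> - {x}" "dist x z < 2 * d x"
      unfolding infdist_def using ne[of x] by (auto simp: cINF_less_iff)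
    then show ?thesis by (auto intro: less_imp_le)
  qed
  then obtain p where p: "\<And>x. x \<in> ?I \<Longrightarrow> p x \<noteq> x" "\<And>x. x \<in> ?I \<Longrightarrow> dist x (p x) \<le> 2 * d x" by metis
  obtain J where J: "J \<subseteq> ?I" "infinite J" "\<And>x z. x \<in> J \<Longrightarrow> z \<in> J \<Longrightarrow> p x \<noteq> z"
    using sequence_avoiding_values[OF inf p(1)] by metis
  obtain x :: "nat \<Rightarrow> 'm" where x: "inj x" "range x \<subseteq> J" using infinite_countable_subset[OF J(2)] by blast
  have xJ: "x i \<in> J" "x i \<in> ?I" for i using x J(1) by auto
  have "bump_sequence x (\<lambda>i. p (x i)) (\<lambda>i. d (x i) / 2) 4"
    unfolding bump_sequence_def
  proof (intro conjI allI impI)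
    show "0 < d (x i) / 2" for i using d_pos[OF xJ(2)[of i]] by simp
    show "dist (x i) (p (x i)) \<le> 4 * (d (x i) / 2)" for i using p(2)[OF xJ(2)[of i]] by simp
    show "d (x i) / 2 + d (x j) / 2 \<le> dist (x i) (x j)" if "i \<noteq> j" for i j
    proof -
      have "x i \<noteq> x j" using x(1) that by (simp add: inj_eq)
      then show ?thesis using d_le[of "x j" "x i"] d_le[of "x i" "x j"] by (simp add: dist_commute)
    qed
    show "d (x j) / 2 \<le> dist (p (x i)) (x j)" for i j
      using d_le[of "p (x i)" "x j"] J(3)[OF xJ(1)[of i] xJ(1)[of j]] d_pos[OF xJ(2)[of j]]
      by (simp add: dist_commute)
  qed
  then show ?thesis using that by blast
qed

lemma exists_bump_sequence:
  assumes "infinite (UNIV :: 'm::metric_space set)"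
  obtains x y :: "nat \<Rightarrow> 'm::metric_space" and r K where "bump_sequence x y r K"
proof (cases "\<exists>y::'m. y islimpt UNIV")
  case True
  then show ?thesis using exists_bump_sequence_converging that by metis
next
  case False
  then have "infinite {x::'m. \<not> x islimpt UNIV}" using assms by simp
  then show ?thesis using exists_bump_sequence_isolated that by metis
qed

text \<open>By Lipschitz extension the values need to be checked on the points \<open>x i\<close> and \<open>y i\<close> only.\<close>

lemma bump_function:
  assumes b: "bump_sequence x y r K" and s: "\<And>i. \<bar>s i\<bar> \<le> 1"
  obtains g where "g \<in> carr (Lip0_space e)" "vnorm (Lip0_space e) g \<le> 1" "\<And>i. g (x i) - g (y i) = s i * r i"
proof -
  have r: "0 < r i" "r j \<le> dist (y i) (x j)" and sep: "i \<noteq> j \<Longrightarrow> r i + r j \<le> dist (x i) (x j)" for i j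
    using b by (auto simp: bump_sequence_def)
  define t where "t = case_sum x y"
  define h where "h = case_sum (\<lambda>i. s i * r i) (\<lambda>_::nat. 0)"
  have sr: "\<bar>s i * r i\<bar> \<le> r i" for i
    using mult_right_mono[OF s[of i], of "r i"] r(1)[of i] by (simp add: abs_mult)
  have "\<bar>h p - h q\<bar> \<le> 1 * dist (t p) (t q)" for p q
  proof (cases p; cases q)
    fix i j assume pq: "p = Inl i" "q = Inl j"
    show ?thesis
    proof (cases "i = j")
      case False
      have "\<bar>s i * r i - s j * r j\<bar> \<le> r i + r j" using sr[of i] sr[of j] by linarith
      then show ?thesis using sep[OF False] by (simp add: pq h_def t_def)
    qed (simp add: pq)
  next
    fix i j assume "p = Inl i" "q = Inr j"
    then show ?thesis using sr[of i] r(2)[of i j] by (simp add: h_def t_def dist_commute)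
  next
    fix i j assume "p = Inr i" "q = Inl j"
    then show ?thesis using sr[of j] r(2)[of j i] by (simp add: h_def t_def)
  qed (simp add: h_def)
  then obtain f where f: "1-lipschitz_on UNIV f" "\<And>p. f (t p) = h p"
    using McShane_extension[of UNIV h 1 t] by auto
  define g where "g z = f z - f e" for z
  have g: "1-lipschitz_on UNIV g"
    using f(1) unfolding lipschitz_on_def g_def by (simp add: dist_real_def)
  show ?thesis
  proof (rule that[of g])
    show "g \<in> carr (Lip0_space e)" using g by (auto simp: Lip0_space_def g_def)
    show "vnorm (Lip0_space e) g \<le> 1" by (rule Lip0_norm_le[OF g])
    show "g (x i) - g (y i) = s i * r i" for i
      using f(2)[of "Inl i"] f(2)[of "Inr i"] by (simp add: g_def t_def h_def)
  qed
qed

section \<open>Lipschitz functions\<close>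

lemma Lip0_simps [simp]:
  "vadd (Lip0_space e) f g = (\<lambda>x. f x + g x)" "vzero (Lip0_space e) = (\<lambda>x. 0)"
  "vscale (Lip0_space e) a f = (\<lambda>x. a * f x)"
  by (simp_all add: Lip0_space_def)

lemma Lip0_carrI: "f e = 0 \<Longrightarrow> C-lipschitz_on UNIV f \<Longrightarrow> f \<in> carr (Lip0_space e)"
  by (auto simp: Lip0_space_def)

lemma Lip0_at_base: "f \<in> carr (Lip0_space e) \<Longrightarrow> f e = 0"
  by (simp add: Lip0_space_def)

lemma Lip0_dist: "f \<in> carr (Lip0_space e) \<Longrightarrow> \<bar>f x - f y\<bar> \<le> vnorm (Lip0_space e) f * dist x y"
  using lipschitz_onD[OF Lip0_lipschitz(1), of f e x y] by (simp add: dist_real_def)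

lemma lipschitz_on_mult_left: "C-lipschitz_on UNIV f \<Longrightarrow> (\<bar>a\<bar> * C)-lipschitz_on UNIV (\<lambda>x. a * f x :: real)"
  using lipschitz_on_cmult_real_nonneg by (metis lipschitz_on_cmult_real)

lemma normed_space_Lip0: "normed_space (Lip0_space (e::'m::metric_space))"
proof -
  let ?X = "Lip0_space e"
  have add: "(\<lambda>x. f x + g x) \<in> carr ?X \<and> vnorm ?X (\<lambda>x. f x + g x) \<le> vnorm ?X f + vnorm ?X g"
    if "f \<in> carr ?X" "g \<in> carr ?X" for f g
  proof -
    have "(vnorm ?X f + vnorm ?X g)-lipschitz_on UNIV (\<lambda>x. f x + g x)"
      by (intro lipschitz_on_add Lip0_lipschitz that)
    then show ?thesis using that Lip0_carrI[of "\<lambda>x. f x + g x" e] by (simp add: Lip0_norm_le Lip0_at_base)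
  qed
  have scale: "(\<lambda>x. a * f x) \<in> carr ?X \<and> vnorm ?X (\<lambda>x. a * f x) \<le> \<bar>a\<bar> * vnorm ?X f" if "f \<in> carr ?X" for a f
  proof -
    have "(\<bar>a\<bar> * vnorm ?X f)-lipschitz_on UNIV (\<lambda>x. a * f x)"
      by (intro lipschitz_on_mult_left Lip0_lipschitz that)
    then show ?thesis using that Lip0_carrI[of "\<lambda>x. a * f x" e] by (simp add: Lip0_norm_le Lip0_at_base)
  qed
  have zero: "(\<lambda>x. 0) \<in> carr ?X" by (rule Lip0_carrI[where C = 0]) (auto intro: lipschitz_onI)
  have nonneg: "0 \<le> vnorm ?X f" if "f \<in> carr ?X" for f
    using lipschitz_on_nonneg[OF Lip0_lipschitz(1)[OF that]] .
  have norm_zero: "vnorm ?X (\<lambda>x. 0) = 0"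
    using Lip0_norm_le[of 0 "\<lambda>x. 0" e] nonneg[OF zero] by (simp add: lipschitz_onI order_antisym)
  show ?thesis
  proof
    fix f a assume f: "f \<in> carr ?X"
    show "(vnorm ?X f = 0) = (f = vzero ?X)"
    proof
      assume "vnorm ?X f = 0"
      then have "f x = 0" for x using Lip0_dist[OF f, of x e] Lip0_at_base[OF f] by simp
      then show "f = vzero ?X" by auto
    qed (simp add: norm_zero)
    show "vnorm ?X (vscale ?X a f) = \<bar>a\<bar> * vnorm ?X f"
    proof (cases "a = 0")
      case False
      have "vnorm ?X f \<le> \<bar>1 / a\<bar> * vnorm ?X (\<lambda>x. a * f x)"
        using scale[of "\<lambda>x. a * f x" "1 / a"] scale[OF f, of a] False by simp
      then show ?thesis using scale[OF f, of a] False by (simp add: field_simps order_antisym)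
    qed (simp add: norm_zero)
  qed (use add scale zero in \<open>auto simp: algebra_simps\<close>)
qed

lemma lsum_Lip0: "lsum (Lip0_space e) a u m = (\<lambda>x. \<Sum>i<m. a i * u i x)"
  by (induction m) auto

lemma Lip0_finite:
  assumes "finite (UNIV :: 'm::metric_space set)"
  shows "finite_dimensional (Lip0_space (e :: 'm::metric_space))"
  by (rule finite_dimensionalI[of UNIV _ "\<lambda>f. f"]) (use assms in \<open>auto simp: lsum_Lip0\<close>)

text \<open>The \<open>k\<close>-th function has the slope between \<open>x i\<close> and \<open>y i\<close> whose sign is the \<open>k\<close>-th binary digit
  of \<open>i\<close>, so that every finite sign pattern is seen by one of the pairs.\<close>

lemma Lip0_has_ell1:
  assumes "infinite (UNIV :: 'm::metric_space set)"
  shows "has_ell1_sequence (Lip0_space (e :: 'm::metric_space))"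
proof -
  let ?X = "Lip0_space e"
  interpret normed_space ?X by (rule normed_space_Lip0)
  obtain x y :: "nat \<Rightarrow> 'm" and r K where b: "bump_sequence x y r K"
    using exists_bump_sequence[OF assms] by metis
  have r: "0 < r i" "dist (x i) (y i) \<le> K * r i" "r i \<le> dist (x i) (y i)" for i
    using b by (auto simp: bump_sequence_def dist_commute)
  have K: "K > 0"
  proof -
    have "0 < K * r 0" using r[of 0] by linarith
    then show ?thesis using r(1)[of 0] by (simp add: zero_less_mult_iff)
  qed
  define s where "s k i = (if k \<in> set_decode i then 1 else -1 :: real)" for k i
  have "\<exists>g. g \<in> carr ?X \<and> vnorm ?X g \<le> 1 \<and> (\<forall>i. g (x i) - g (y i) = s k i * r i)" for k
  proof -
    have "\<bar>s k i\<bar> \<le> 1" for i by (simp add: s_def)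
    from bump_function[where s = "s k", OF b this, where e = e] show ?thesis by blast
  qed
  then obtain g where g: "\<And>k. g k \<in> carr ?X" "\<And>k. vnorm ?X (g k) \<le> 1"
     "\<And>k i. g k (x i) - g k (y i) = s k i * r i" by metis
  show ?thesis
    unfolding has_ell1_sequence_def
  proof (rule exI[of _ g], rule exI[of _ 1], rule exI[of _ "1 / K"], intro conjI allI)
    show "g i \<in> carr ?X" "vnorm ?X (g i) \<le> 1" for i by (rule g)+
    show "1 / K > 0" using K by simp
    fix a :: "nat \<Rightarrow> real" and m
    define f where "f = lsum ?X a g m"
    have f: "f \<in> carr ?X" using g lsum_closed by (simp add: f_def)
    define i where "i = set_encode {k. k < m \<and> 0 \<le> a k}"
    have i: "set_decode i = {k. k < m \<and> 0 \<le> a k}" by (simp add: i_def)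
    have "f (x i) - f (y i) = (\<Sum>k<m. a k * (g k (x i) - g k (y i)))"
      by (simp add: f_def lsum_Lip0 right_diff_distrib sum_subtractf)
    also have "\<dots> = (\<Sum>k<m. \<bar>a k\<bar> * r i)"
      by (intro sum.cong refl) (auto simp: g(3) s_def i)
    finally have "(\<Sum>k<m. \<bar>a k\<bar>) * r i \<le> vnorm ?X f * dist (x i) (y i)"
      using Lip0_dist[OF f, of "x i" "y i"] by (simp add: sum_distrib_right)
    also have "\<dots> \<le> vnorm ?X f * (K * r i)" using r(2) norm_nonneg[OF f] by (intro mult_left_mono)
    finally have "(\<Sum>k<m. \<bar>a k\<bar>) \<le> vnorm ?X f * K" using r(1)[of i] by simp
    then show "1 / K * (\<Sum>k<m. \<bar>a k\<bar>) \<le> vnorm ?X f" using K by (simp add: field_simps)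
  qed
qed

section \<open>Lipschitz-free spaces\<close>

lemma free_space_simps [simp]:
  "vadd (free_space e) = vadd (dual (Lip0_space e))" "vzero (free_space e) = vzero (dual (Lip0_space e))"
  "vscale (free_space e) = vscale (dual (Lip0_space e))" "vnorm (free_space e) = vnorm (dual (Lip0_space e))"
  "carr (free_space e) = norm_closure (dual (Lip0_space e)) (evaluation_span e)"
  by (simp_all add: free_space_def)

lemma lsum_free: "lsum (free_space e) a u m = lsum (dual (Lip0_space e)) a u m"
  by (induction m) auto

lemma zero_scaling_free: "zero_scaling (free_space e)"
  by (simp add: zero_scaling_def)

lemma free_space_finite:
  assumes "finite (UNIV :: 'm::metric_space set)"
  shows "finite_dimensional (free_space (e :: 'm::metric_space))"
proof -
  have "finite_dimensional (dual (Lip0_space e))"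
    by (rule normed_space.finite_dimensional_dual[OF normed_space_Lip0 Lip0_finite[OF assms]])
  moreover have "carr (free_space e) \<subseteq> carr (dual (Lip0_space e))" by (auto simp: norm_closure_def)
  ultimately show ?thesis unfolding finite_dimensional_def lsum_free by (metis free_space_simps(2) subsetD)
qed

text \<open>The sequence consists of the molecules \<open>(\<delta> (x i) - \<delta> (y i)) / r i\<close>, tested against the functions of
  \<open>bump_function\<close>.\<close>

lemma free_space_has_ell1:
  assumes "infinite (UNIV :: 'm::metric_space set)"
  shows "has_ell1_sequence (free_space (e :: 'm::metric_space))"
proof -
  let ?X = "Lip0_space e"
  interpret normed_space ?X by (rule normed_space_Lip0)
  obtain x y :: "nat \<Rightarrow> 'm" and r K where b: "bump_sequence x y r K"
    using exists_bump_sequence[OF assms] by metis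
  have r: "0 < r i" "dist (x i) (y i) \<le> K * r i" "r i \<le> dist (x i) (y i)" for i
    using b by (auto simp: bump_sequence_def dist_commute)
  have K: "0 \<le> K"
  proof -
    have "0 < K * r 0" using r[of 0] by linarith
    then show ?thesis using r(1)[of 0] by (simp add: zero_less_mult_iff)
  qed
  define M where "M i f = (if f \<in> carr ?X then (f (x i) - f (y i)) / r i else 0)" for i f
  have M_le: "\<bar>M i f\<bar> \<le> K * vnorm ?X f" if "f \<in> carr ?X" for i f
  proof -
    have "\<bar>f (x i) - f (y i)\<bar> \<le> vnorm ?X f * (K * r i)"
      using Lip0_dist[OF that, of "x i" "y i"] mult_left_mono[OF r(2)[of i] norm_nonneg[OF that]] by linarith
    then show ?thesis using r(1)[of i] that by (simp add: M_def field_simps)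
  qed
  have M_dual: "M i \<in> carr (dual ?X)" for i
  proof -
    have "linear_map ?X (type_space TYPE(real)) (M i)"
      using add_closed scale_closed
      by (auto simp: linear_map_def type_space_def space_of_def M_def add_divide_distrib diff_divide_distrib algebra_simps)
    then show ?thesis using M_le by (auto simp: dual_iff M_def)
  qed
  have M_span: "M i \<in> evaluation_span e" for i
  proof -
    have "x i \<noteq> y i" using r[of i] by auto
    define c where "c z = (if z = x i then 1 else -1) / r i" for z
    have "M i = (\<lambda>f. \<Sum>z\<in>{x i, y i}. c z * evaluation e z f)"
      using \<open>x i \<noteq> y i\<close> by (auto simp: M_def evaluation_def c_def fun_eq_iff diff_divide_distrib)
    then show ?thesis unfolding evaluation_span_def by blast
  qed
  have "vnorm (dual ?X) (\<lambda>x. 0) \<le> 0" by (rule dual_norm_le) auto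
  then have M_carr: "M i \<in> carr (free_space e)" for i
    using M_dual M_span by (auto simp: norm_closure_def intro!: bexI[of _ "M i"])
  show ?thesis
    unfolding has_ell1_sequence_def
  proof (rule exI[of _ M], rule exI[of _ K], rule exI[of _ 1], intro conjI allI)
    show "M i \<in> carr (free_space e)" for i by (rule M_carr)
    show "vnorm (free_space e) (M i) \<le> K" for i
      using dual_norm_le[OF K M_le] by simp
    fix a :: "nat \<Rightarrow> real" and m
    have "\<bar>sgn (a i)\<bar> \<le> 1" for i by (simp add: sgn_if)
    from bump_function[where s = "\<lambda>i. sgn (a i)", OF b this, where e = e]
    obtain g where g: "g \<in> carr ?X" "vnorm ?X g \<le> 1" "\<And>i. g (x i) - g (y i) = sgn (a i) * r i"
      by blast
    \<comment> \<open>the pair \<open>x i\<close>, \<open>y i\<close> sees only the value of \<open>g\<close> at \<open>x i\<close>\<close>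
    have "(\<Sum>i<m. \<bar>a i\<bar>) = lsum (dual ?X) a M m g"
      unfolding lsum_dual using r(1) by (intro sum.cong refl) (simp add: M_def g abs_sgn less_imp_neq[symmetric])
    also have "\<dots> \<le> 1 * vnorm (dual ?X) (lsum (dual ?X) a M m)"
      by (rule order_trans[OF abs_ge_self dual_norm_ge[OF lsum_in_dual g(1,2)]]) (auto simp: M_dual)
    finally show "1 * (\<Sum>i<m. \<bar>a i\<bar>) \<le> vnorm (free_space e) (lsum (free_space e) a M m)"
      by (simp add: lsum_free)
  qed simp
qed

section \<open>Disjoint sets of positive measure\<close>

definition atom_of :: "'a measure \<Rightarrow> 'a set \<Rightarrow> bool" where
  "atom_of M A \<longleftrightarrow> A \<in> sets M \<and> A \<notin> null_sets M \<and>
     (\<forall>B\<in>sets M. B \<subseteq> A \<longrightarrow> B \<in> null_sets M \<or> A - B \<in> null_sets M)"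

text \<open>
  Call a set small if finitely many atoms cover it up to a null set. A set that is not small is
  neither null nor an atom, hence splits into two parts of positive measure, of which at least one is
  again not small. Repeat with that part; the parts left behind are disjoint.
\<close>

lemma atoms_or_disjoint_sequence:
  obtains (atoms) F where "finite F" "\<And>A. A \<in> F \<Longrightarrow> atom_of M A" "space M - \<Union>F \<in> null_sets M"
    | (disjoint) A :: "nat \<Rightarrow> 'a set" where "\<And>i. A i \<in> sets M" "\<And>i. A i \<notin> null_sets M" "\<And>i j. i \<noteq> j \<Longrightarrow> A i \<inter> A j = {}"
proof -
  define small where "small B \<longleftrightarrow> (\<exists>F. finite F \<and> (\<forall>A\<in>F. atom_of M A) \<and> B - \<Union>F \<in> null_sets M)" for B
  show thesis
  proof (cases "small (space M)")
    case True
    then show ?thesis using atoms unfolding small_def by blast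
  next
    case False
    have small_Un: "small (B \<union> C)" if BC: "small B" "small C" for B C
    proof -
      obtain F G where FG: "finite F" "\<forall>A\<in>F. atom_of M A" "B - \<Union>F \<in> null_sets M"
        "finite G" "\<forall>A\<in>G. atom_of M A" "C - \<Union>G \<in> null_sets M"
        using BC unfolding small_def by blast
      have F_sets: "\<Union>F \<in> sets M" "\<Union>G \<in> sets M" using FG by (auto simp: atom_of_def intro!: sets.finite_Union)
      have "(B \<union> C) - \<Union>(F \<union> G) = (B - \<Union>F - \<Union>G) \<union> (C - \<Union>G - \<Union>F)" by auto
      moreover have "\<dots> \<in> null_sets M"
        by (intro null_sets.Un null_set_Diff[OF FG(3) F_sets(2)] null_set_Diff[OF FG(6) F_sets(1)])
      ultimately show ?thesis using FG unfolding small_def by (intro exI[of _ "F \<union> G"]) auto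
    qed
    have "\<exists>W. \<forall>n. (W n \<in> sets M \<and> \<not> small (W n)) \<and> (W (Suc n) \<subseteq> W n \<and> W n - W (Suc n) \<notin> null_sets M)"
    proof (rule dependent_nat_choice)
      show "\<exists>W. W \<in> sets M \<and> \<not> small W" using False by blast
      fix W assume W: "W \<in> sets M \<and> \<not> small W"
      have "W \<notin> null_sets M"
      proof
        assume "W \<in> null_sets M"
        then have "small W" unfolding small_def by (intro exI[of _ "{}"]) auto
        then show False using W by blast
      qed
      moreover have "\<not> atom_of M W"
      proof
        assume "atom_of M W"
        then have "small W" unfolding small_def by (intro exI[of _ "{W}"]) auto
        then show False using W by blast
      qed
      ultimately obtain B where B: "B \<in> sets M" "B \<subseteq> W" "B \<notin> null_sets M" "W - B \<notin> null_sets M"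
        using W unfolding atom_of_def by blast
      have "B \<union> (W - B) = W" using B by auto
      then have "\<not> small B \<or> \<not> small (W - B)" using small_Un[of B "W - B"] W by auto
      moreover have "W - (W - B) = B" using B by auto
      ultimately show "\<exists>W'. (W' \<in> sets M \<and> \<not> small W') \<and> (W' \<subseteq> W \<and> W - W' \<notin> null_sets M)"
        using B W by (metis Diff_subset sets.Diff)
    qed
    then obtain W where W: "\<And>n. W n \<in> sets M" "\<And>n. W (Suc n) \<subseteq> W n" "\<And>n. W n - W (Suc n) \<notin> null_sets M"
      by blast
    define A where "A n = W n - W (Suc n)" for n
    have "A i \<inter> A j = {}" if "i < j" for i j
      using lift_Suc_antimono_le[of W "Suc i" j] W(2) that by (auto simp: A_def)
    then have "A i \<inter> A j = {}" if "i \<noteq> j" for i j using that by (metis Int_commute nat_neq_iff)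
    then show ?thesis using disjoint[of A] W by (auto simp: A_def)
  qed
qed

text \<open>
  If the essential infimum of \<open>f\<close> on the atom, written as the negative of an essential supremum, were
  less than the essential supremum, a number \<open>t\<close> between them would split the atom into the two parts
  on which \<open>f \<le> t\<close> and \<open>f > t\<close>. The value \<open>- \<infinity>\<close> off the atom does not affect the suprema.
\<close>

lemma atom_AE_const:
  fixes f :: "'a \<Rightarrow> real"
  assumes A: "atom_of M A" and f[measurable]: "f \<in> borel_measurable M"
  shows "\<exists>c. AE x in M. x \<in> A \<longrightarrow> f x = c"
proof -
  have A_sets[measurable]: "A \<in> sets M" and A_pos: "A \<notin> null_sets M"
    and dich: "\<And>B. B \<in> sets M \<Longrightarrow> B \<subseteq> A \<Longrightarrow> B \<in> null_sets M \<or> A - B \<in> null_sets M"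
    using A by (auto simp: atom_of_def)
  define g where "g x = (if x \<in> A then ereal (f x) else - \<infinity>)" for x
  define g' where "g' x = (if x \<in> A then - ereal (f x) else - \<infinity>)" for x
  have meas: "g \<in> borel_measurable M" "g' \<in> borel_measurable M"
    unfolding g_def g'_def by measurable
  have alt: "(AE x in M. x \<in> A \<longrightarrow> f x \<le> t) \<or> (AE x in M. x \<in> A \<longrightarrow> t < f x)" for t
  proof -
    have B: "A \<inter> {x \<in> space M. t < f x} \<in> sets M" by measurable
    show ?thesis
      using dich[OF B Int_lower1]
    proof
      assume "A \<inter> {x \<in> space M. t < f x} \<in> null_sets M"
      then have "AE x in M. x \<in> A \<longrightarrow> f x \<le> t" by (rule AE_I') auto
      then show ?thesis ..
    next
      assume "A - A \<inter> {x \<in> space M. t < f x} \<in> null_sets M"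
      then have "AE x in M. x \<in> A \<longrightarrow> t < f x" by (rule AE_I') auto
      then show ?thesis ..
    qed
  qed
  have le: "esssup M g \<le> - esssup M g'"
  proof (rule ccontr)
    assume "\<not> ?thesis"
    then obtain t where t: "- esssup M g' < ereal t" "ereal t < esssup M g"
      using ereal_dense2 by (metis not_le)
    show False
      using alt[of t]
    proof
      assume "AE x in M. x \<in> A \<longrightarrow> f x \<le> t"
      then have "AE x in M. g x \<le> ereal t" by eventually_elim (simp add: g_def)
      then show False using esssup_I[OF meas(1)] t(2) by (metis not_le)
    next
      assume "AE x in M. x \<in> A \<longrightarrow> t < f x"
      then have "AE x in M. g' x \<le> ereal (- t)" by eventually_elim (auto simp: g'_def)
      then have "esssup M g' \<le> - ereal t" using esssup_I[OF meas(2)] by simp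
      then have "ereal t \<le> - esssup M g'"
        using ereal_minus_le_minus[of "- ereal t" "esssup M g'"] by simp
      then show False using t(1) by simp
    qed
  qed
  have eq: "AE x in M. x \<in> A \<longrightarrow> ereal (f x) = esssup M g"
    using esssup_AE[of g' M] esssup_AE[of g M]
  proof eventually_elim
    case (elim x)
    show ?case
    proof
      assume "x \<in> A"
      then have "- ereal (f x) \<le> esssup M g'" "ereal (f x) \<le> esssup M g"
        using elim by (simp_all add: g_def g'_def)
      moreover from this(1) have "- esssup M g' \<le> ereal (f x)"
        by (subst ereal_uminus_le_reorder)
      ultimately show "ereal (f x) = esssup M g"
        using le by (meson order_antisym order_trans)
    qed
  qed
  have "\<exists>x. x \<in> A \<and> ereal (f x) = esssup M g"
  proof (rule ccontr)
    assume "\<not> ?thesis"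
    then have "AE x in M. x \<notin> A" using eq by (auto elim: eventually_mono)
    then show False using A_pos AE_iff_null_sets[OF A_sets] by blast
  qed
  then obtain y where y: "ereal (f y) = esssup M g" by blast
  have "AE x in M. x \<in> A \<longrightarrow> f x = f y"
    using eq by eventually_elim (metis y ereal.inject)
  then show ?thesis by blast
qed

section \<open>Classes of functions\<close>

text \<open>What \<open>L\<^sub>1\<close> and \<open>L\<^sub>\<infinity>\<close> have in common apart from the norm.\<close>

definition is_class_space :: "'a measure \<Rightarrow> ('a \<Rightarrow> real) set nspace \<Rightarrow> bool" where
  "is_class_space M X \<longleftrightarrow> carr X \<subseteq> ae_class M ` borel_measurable M \<and>
     vadd X = (\<lambda>A B. ae_class M (\<lambda>x. repr A x + repr B x)) \<and> vzero X = ae_class M (\<lambda>x. 0) \<and>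
     vscale X = (\<lambda>c A. ae_class M (\<lambda>x. c * repr A x))"

lemma class_space_L1: "is_class_space M (L1_space M)"
  and class_space_Linf: "is_class_space M (Linf_space M)"
  by (auto simp: is_class_space_def L1_space_def Linf_space_def)

lemma zero_scaling_class_space: "is_class_space M X \<Longrightarrow> zero_scaling X"
  by (simp add: zero_scaling_def is_class_space_def)

lemma repr_ae_class:
  assumes "f \<in> borel_measurable M"
  shows "repr (ae_class M f) \<in> borel_measurable M" "AE x in M. repr (ae_class M f) x = f x"
proof -
  have "f \<in> ae_class M f" using assms by (simp add: ae_class_def)
  then have "repr (ae_class M f) \<in> ae_class M f" unfolding repr_def by (rule someI[of "\<lambda>g. g \<in> ae_class M f"])
  then show "repr (ae_class M f) \<in> borel_measurable M" "AE x in M. repr (ae_class M f) x = f x"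
    by (auto simp: ae_class_def)
qed

lemma ae_class_cong:
  assumes "AE x in M. f x = g x"
  shows "ae_class M f = ae_class M g"
proof -
  have "(AE x in M. h x = f x) \<longleftrightarrow> (AE x in M. h x = g x)" for h
  proof
    assume "AE x in M. h x = f x"
    then show "AE x in M. h x = g x" using assms by eventually_elim simp
  next
    assume "AE x in M. h x = g x"
    then show "AE x in M. h x = f x" using assms by eventually_elim simp
  qed
  then show ?thesis by (simp add: ae_class_def)
qed

lemma lsum_class_space:
  assumes X: "is_class_space M X" and f: "\<And>i. f i \<in> borel_measurable M" "\<And>i. u i = ae_class M (f i)"
  shows "lsum X a u m = ae_class M (\<lambda>x. \<Sum>i<m. a i * f i x)"
proof (induction m)
  case 0
  then show ?case using X by (simp add: is_class_space_def)
next
  case (Suc m)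
  have s: "(\<lambda>x. \<Sum>i<m. a i * f i x) \<in> borel_measurable M" using f(1) by simp
  have t: "(\<lambda>x. a m * repr (u m) x) \<in> borel_measurable M"
    unfolding f(2) using repr_ae_class(1)[OF f(1)] by simp
  have "AE x in M. repr (ae_class M (\<lambda>x. \<Sum>i<m. a i * f i x)) x + repr (ae_class M (\<lambda>x. a m * repr (u m) x)) x
     = (\<Sum>i<Suc m. a i * f i x)"
    using repr_ae_class(2)[OF s] repr_ae_class(2)[OF t] repr_ae_class(2)[OF f(1)[of m]]
    by eventually_elim (simp add: f(2))
  then show ?case using X Suc by (simp add: is_class_space_def ae_class_cong)
qed

text \<open>The coordinates of a class are its constant values on the finitely many atoms.\<close>

lemma class_space_finite:
  assumes X: "is_class_space M X" and F: "finite F" "\<And>A. A \<in> F \<Longrightarrow> atom_of M A" "space M - \<Union>F \<in> null_sets M"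
  shows "finite_dimensional X"
proof (rule finite_dimensionalI[OF F(1), of X "\<lambda>B A. SOME c. AE x in M. x \<in> A \<longrightarrow> repr B x = c"])
  fix u :: "nat \<Rightarrow> ('a \<Rightarrow> real) set" and a :: "nat \<Rightarrow> real" and m
  let ?v = "\<lambda>B A. SOME c. AE x in M. x \<in> A \<longrightarrow> repr B x = c"
  assume u: "\<And>i. u i \<in> carr X" and 0: "\<And>A. A \<in> F \<Longrightarrow> (\<Sum>i<m. a i * ?v (u i) A) = 0"
  have "\<exists>f. f \<in> borel_measurable M \<and> u i = ae_class M f" for i
    using X u[of i] unfolding is_class_space_def by blast
  then obtain f where f: "\<And>i. f i \<in> borel_measurable M" "\<And>i. u i = ae_class M (f i)" by metis
  have v: "AE x in M. x \<in> A \<longrightarrow> repr (u i) x = ?v (u i) A" if "A \<in> F" for i A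
    using someI_ex[OF atom_AE_const[OF F(2)[OF that] repr_ae_class(1)[OF f(1)[of i]]]] f(2) by simp
  have "AE x in M. \<forall>i\<in>{..<m}. \<forall>A\<in>F. x \<in> A \<longrightarrow> repr (u i) x = ?v (u i) A"
    using v F(1) by (intro AE_finite_allI) auto
  moreover have "AE x in M. \<forall>i\<in>{..<m}. repr (u i) x = f i x"
    using repr_ae_class(2)[OF f(1)] f(2) by (intro AE_finite_allI) auto
  moreover have "AE x in M. x \<in> \<Union>F" by (rule AE_I'[OF F(3)]) auto
  ultimately have "AE x in M. (\<Sum>i<m. a i * f i x) = 0"
  proof eventually_elim
    case (elim x)
    then obtain A where A: "A \<in> F" "x \<in> A" by blast
    have "(\<Sum>i<m. a i * f i x) = (\<Sum>i<m. a i * ?v (u i) A)"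
      using elim A by (intro sum.cong refl) auto
    then show ?case using 0[OF A(1)] by simp
  qed
  then have "ae_class M (\<lambda>x. \<Sum>i<m. a i * f i x) = ae_class M (\<lambda>x. 0)" by (rule ae_class_cong)
  then show "lsum X a u m = vzero X"
    using lsum_class_space[OF X f] X by (simp add: is_class_space_def)
qed

text \<open>Functions with values \<open>1\<close> and \<open>-1\<close> that are constant on each \<open>A i\<close>, where the \<open>k\<close>-th one
  takes its sign from the \<open>k\<close>-th binary digit of \<open>i\<close>.\<close>

lemma Linf_has_ell1:
  assumes A: "\<And>i::nat. A i \<in> sets M" "\<And>i. A i \<notin> null_sets M" "\<And>i j. i \<noteq> j \<Longrightarrow> A i \<inter> A j = {}"
  shows "has_ell1_sequence (Linf_space M)"
proof -
  define B where "B k = (\<Union>i. if k \<in> set_decode i then A i else {})" for k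
  define f :: "nat \<Rightarrow> 'a \<Rightarrow> real" where "f k = (\<lambda>x. if x \<in> B k then 1 else -1)" for k
  have [measurable]: "B k \<in> sets M" for k
    unfolding B_def by (intro sets.countable_UN) (use A(1) in auto)
  have f[measurable]: "f k \<in> borel_measurable M" for k unfolding f_def by measurable
  have f_A: "f k x = (if k \<in> set_decode i then 1 else -1)" if "x \<in> A i" for k i x
  proof -
    have uniq: "j = i" if "x \<in> A j" for j using A(3)[of j i] that \<open>x \<in> A i\<close> by auto
    have "x \<in> B k \<longleftrightarrow> (\<exists>j. k \<in> set_decode j \<and> x \<in> A j)"
      unfolding B_def by (auto split: if_splits)
    also have "\<dots> \<longleftrightarrow> k \<in> set_decode i" using uniq that by metis
    finally have "x \<in> B k \<longleftrightarrow> k \<in> set_decode i" .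
    then show ?thesis by (simp add: f_def)
  qed
  define u where "u k = ae_class M (f k)" for k
  have norm_le: "esssup M (\<lambda>x. ereal \<bar>repr (ae_class M g) x\<bar>) \<le> ereal b"
    if g: "g \<in> borel_measurable M" "\<And>x. \<bar>g x\<bar> \<le> b" for g b
  proof (rule esssup_I)
    show "(\<lambda>x. ereal \<bar>repr (ae_class M g) x\<bar>) \<in> borel_measurable M"
      using repr_ae_class(1)[OF g(1)] by simp
    show "AE x in M. ereal \<bar>repr (ae_class M g) x\<bar> \<le> ereal b"
      using repr_ae_class(2)[OF g(1)] by eventually_elim (simp add: g)
  qed
  have norm_ge: "ereal b \<le> esssup M (\<lambda>x. ereal \<bar>repr (ae_class M g) x\<bar>)"
    if g: "g \<in> borel_measurable M" "\<And>x. x \<in> A i \<Longrightarrow> b \<le> \<bar>g x\<bar>" for g b i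
  proof (rule ccontr)
    assume "\<not> ?thesis"
    then have lt: "esssup M (\<lambda>x. ereal \<bar>repr (ae_class M g) x\<bar>) < ereal b" by simp
    have "AE x in M. x \<notin> A i"
      using esssup_AE[of "\<lambda>x. ereal \<bar>repr (ae_class M g) x\<bar>" M] repr_ae_class(2)[OF g(1)]
    proof eventually_elim
      case (elim x)
      then have "ereal \<bar>g x\<bar> < ereal b" using le_less_trans[OF elim(1) lt] by simp
      then show ?case using g(2)[of x] by auto
    qed
    then show False using A(1,2)[of i] AE_iff_null_sets[OF A(1)] by blast
  qed
  have f1: "\<bar>f k x\<bar> \<le> 1" for k x by (simp add: f_def)
  have g: "(\<lambda>x. \<Sum>k<m. a k * f k x) \<in> borel_measurable M" "\<bar>\<Sum>k<m. a k * f k x\<bar> \<le> (\<Sum>k<m. \<bar>a k\<bar>)" for a m x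
    using f1 by (auto intro!: order_trans[OF sum_abs] sum_mono simp: abs_mult mult_left_le)
  have real_le: "real_of_ereal e \<le> b" if "e \<le> ereal b" "0 \<le> b" for e b
    using that by (cases e) auto
  show ?thesis
    unfolding has_ell1_sequence_def
  proof (rule exI[of _ u], rule exI[of _ 1], rule exI[of _ 1], intro conjI allI)
    fix k
    have "esssup M (\<lambda>x. ereal \<bar>f k x\<bar>) \<le> 1" by (rule esssup_I) (auto simp: f1)
    then have "esssup M (\<lambda>x. ereal \<bar>f k x\<bar>) < \<infinity>" by (rule le_less_trans) simp
    then show "u k \<in> carr (Linf_space M)" by (auto simp: Linf_space_def u_def)
    have "esssup M (\<lambda>x. ereal \<bar>repr (u k) x\<bar>) \<le> ereal 1" unfolding u_def by (rule norm_le) (auto simp: f1)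
    then show "vnorm (Linf_space M) (u k) \<le> 1" by (simp add: Linf_space_def real_le)
  next
    fix a :: "nat \<Rightarrow> real" and m
    define h where "h = (\<lambda>x. \<Sum>k<m. a k * f k x)"
    define i where "i = set_encode {k. k < m \<and> 0 \<le> a k}"
    have i: "set_decode i = {k. k < m \<and> 0 \<le> a k}" by (simp add: i_def)
    have "h x = (\<Sum>k<m. \<bar>a k\<bar>)" if "x \<in> A i" for x
      unfolding h_def by (intro sum.cong refl) (auto simp: f_A[OF that] i)
    then have lo: "ereal (\<Sum>k<m. \<bar>a k\<bar>) \<le> esssup M (\<lambda>x. ereal \<bar>repr (ae_class M h) x\<bar>)"
      using g(1) by (intro norm_ge[of h i]) (auto simp: h_def)
    have hi: "esssup M (\<lambda>x. ereal \<bar>repr (ae_class M h) x\<bar>) \<le> ereal (\<Sum>k<m. \<bar>a k\<bar>)"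
      using g by (intro norm_le) (auto simp: h_def)
    have "lsum (Linf_space M) a u m = ae_class M h"
      unfolding h_def by (rule lsum_class_space[OF class_space_Linf]) (auto simp: u_def)
    then show "1 * (\<Sum>k<m. \<bar>a k\<bar>) \<le> vnorm (Linf_space M) (lsum (Linf_space M) a u m)"
      using order_antisym[OF hi lo] by (simp add: Linf_space_def)
  qed simp
qed

text \<open>Normalised indicators of disjoint sets, after passing to subsets of finite measure.\<close>

lemma L1_has_ell1:
  assumes "sigma_finite_measure M"
    and A0: "\<And>i::nat. A i \<in> sets M" "\<And>i. A i \<notin> null_sets M" "\<And>i j. i \<noteq> j \<Longrightarrow> A i \<inter> A j = {}"
  shows "has_ell1_sequence (L1_space M)"
proof -
  interpret sigma_finite_measure M by fact
  have "\<exists>B\<in>sets M. B \<subseteq> A i \<and> 0 < measure M B \<and> emeasure M B < \<infinity>" for i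
  proof -
    have "emeasure M (A i) \<noteq> 0" using A0(1,2) by auto
    then have pos: "0 < emeasure M (A i)" by (simp add: zero_less_iff_neq_zero)
    have "\<exists>B. B \<in> sets M \<and> B \<subseteq> A i \<and> 0 < emeasure M B \<and> emeasure M B < \<infinity>"
    proof (cases "emeasure M (A i) = \<infinity>")
      case True
      from approx_PInf_emeasure_with_finite[OF A0(1) this, of 0] show ?thesis by auto
    next
      case False
      then show ?thesis using pos A0(1) by (intro exI[of _ "A i"]) (auto simp: less_top)
    qed
    then obtain B where B: "B \<in> sets M" "B \<subseteq> A i" "0 < emeasure M B" "emeasure M B < \<infinity>"
      by blast
    then show ?thesis by (auto simp: measure_def enn2real_positive_iff)
  qed
  then obtain B where B: "\<And>i. B i \<in> sets M" "\<And>i. B i \<subseteq> A i" "\<And>i. 0 < measure M (B i)" "\<And>i. emeasure M (B i) < \<infinity>"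
    by metis
  have disj: "B i \<inter> B j = {}" if "i \<noteq> j" for i j using B(2)[of i] B(2)[of j] A0(3)[OF that] by blast
  define f where "f i = (\<lambda>x. indicator (B i) x / measure M (B i))" for i
  have f_int: "integrable M (f i)" "(\<integral>x. f i x \<partial>M) = 1" for i
    unfolding f_def using B(3)[of i] integrable_real_indicator[OF B(1,4)[of i]]
    by (auto simp: sets.Int_space_eq2[OF B(1)])
  have f[measurable]: "f i \<in> borel_measurable M" for i using f_int(1) by auto
  define u where "u i = ae_class M (f i)" for i
  have norm: "vnorm (L1_space M) (ae_class M h) = (\<integral>x. \<bar>h x\<bar> \<partial>M)" if h: "h \<in> borel_measurable M" for h
  proof -
    have "AE x in M. \<bar>repr (ae_class M h) x\<bar> = \<bar>h x\<bar>"
      using repr_ae_class(2)[OF h] by eventually_elim simp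
    then show ?thesis
      using repr_ae_class(1)[OF h] h by (simp add: L1_space_def) (rule integral_cong_AE, auto)
  qed
  show ?thesis
    unfolding has_ell1_sequence_def
  proof (rule exI[of _ u], rule exI[of _ 1], rule exI[of _ 1], intro conjI allI)
    fix k
    show "u k \<in> carr (L1_space M)" using f_int(1)[of k] by (auto simp: L1_space_def u_def)
    have "\<bar>f k x\<bar> = f k x" for x using B(3)[of k] by (simp add: f_def)
    then show "vnorm (L1_space M) (u k) \<le> 1" using f_int(2)[of k] by (simp add: u_def norm)
  next
    fix a :: "nat \<Rightarrow> real" and m
    define h where "h x = (\<Sum>k<m. a k * f k x)" for x
    have [measurable]: "h \<in> borel_measurable M" unfolding h_def by measurable
    have abs_h: "\<bar>h x\<bar> = (\<Sum>k<m. \<bar>a k\<bar> * f k x)" for x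
    proof (cases "\<exists>k<m. x \<in> B k")
      case True
      then obtain k where k: "k < m" "x \<in> B k" by blast
      have "f j x = 0" if "j \<noteq> k" for j using disj[OF that] k(2) by (auto simp: f_def indicator_def)
      then have "(\<Sum>j<m. c j * f j x) = c k * f k x" for c :: "nat \<Rightarrow> real"
        using k(1) by (subst sum.remove[of _ k]) auto
      moreover have "0 \<le> f k x" using B(3)[of k] by (simp add: f_def)
      ultimately show ?thesis by (simp add: h_def abs_mult)
    next
      case False
      then have "f k x = 0" if "k < m" for k using that by (simp add: f_def)
      then show ?thesis by (simp add: h_def)
    qed
    have "(\<integral>x. \<bar>h x\<bar> \<partial>M) = (\<Sum>k<m. \<bar>a k\<bar> * (\<integral>x. f k x \<partial>M))"
      unfolding abs_h using f_int(1) by (subst Bochner_Integration.integral_sum) auto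
    then have "(\<integral>x. \<bar>h x\<bar> \<partial>M) = (\<Sum>k<m. \<bar>a k\<bar>)" by (simp add: f_int(2))
    moreover have "lsum (L1_space M) a u m = ae_class M h"
      unfolding h_def by (rule lsum_class_space[OF class_space_L1]) (auto simp: u_def)
    ultimately show "1 * (\<Sum>k<m. \<bar>a k\<bar>) \<le> vnorm (L1_space M) (lsum (L1_space M) a u m)"
      by (simp add: norm)
  qed simp
qed

lemma Linf_dichotomy: "\<not> finite_dimensional (Linf_space M) \<Longrightarrow> has_ell1_sequence (Linf_space M)"
  by (rule atoms_or_disjoint_sequence[of M])
     (use class_space_finite[OF class_space_Linf] Linf_has_ell1 in blast)+

lemma L1_dichotomy:
  "sigma_finite_measure M \<Longrightarrow> \<not> finite_dimensional (L1_space M) \<Longrightarrow> has_ell1_sequence (L1_space M)"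
  by (rule atoms_or_disjoint_sequence[of M])
     (use class_space_finite[OF class_space_L1] L1_has_ell1 in blast)+

section \<open>Surjections onto the space of summable sequences\<close>

theorem theorem5p10:
  fixes n :: nat
  assumes "infinite_dimensional TYPE('e::banach)"
    and "(locally_compact_space (euclidean :: 'y::t2_space topology) \<and>
            is_iterated_dual TYPE('u) n (C0_space TYPE('y)) (type_space TYPE('e)))
       \<or> (\<exists>M :: 'a measure. sigma_finite_measure M \<and>
            is_iterated_dual TYPE('u) n (Linf_space M) (type_space TYPE('e)))
       \<or> (compact (UNIV :: 'k::t2_space set) \<and>
            is_predual (type_space TYPE('e)) (type_space TYPE('k \<Rightarrow>\<^sub>C real)))
       \<or> (\<exists>M :: 'a measure. sigma_finite_measure M \<and> type_space TYPE('e) \<cong>\<^sub>i L1_space M)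
       \<or> (infinite_dimensional TYPE('y1::real_normed_vector) \<and>
            contains_copy (type_space TYPE('z1::banach)) c0_space \<and>
            type_space TYPE('e) \<cong>\<^sub>i type_space TYPE('y1 \<Rightarrow>\<^sub>L 'z1))
       \<or> (infinite_dimensional TYPE('y2::banach) \<and> infinite_dimensional TYPE('w2::banach) \<and>
            infinite_dimensional TYPE('z2::banach) \<and>
            contains_copy (type_space TYPE('z2)) c0_space \<and>
            type_space TYPE('e) \<cong>\<^sub>i Bil_space TYPE('y2) TYPE('w2) TYPE('z2))
       \<or> (\<exists>e :: 'm::metric_space.
            is_iterated_dual TYPE('u) n (Lip0_space e) (type_space TYPE('e)))
       \<or> (\<exists>e :: 'm::metric_space. type_space TYPE('e) \<cong>\<^sub>i free_space e)"
  shows "\<exists>T. bounded_linear_map (Lip0_space (0::'e)) ell1_space T \<and>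
             T ` carr (Lip0_space (0::'e)) = carr ell1_space"
proof -
  note inf = assms(1)
  have "has_ell1_sequence (type_space TYPE('e)) \<or> has_c0_sequence (type_space TYPE('e))"
    using assms(2)
  proof (elim disjE conjE exE)
    assume lc: "locally_compact_space (euclidean :: 'y topology)"
      and iter: "is_iterated_dual TYPE('u) n (C0_space TYPE('y)) (type_space TYPE('e))"
    show ?thesis
      using iterated_dual_has_sequence[OF inf iter zero_scaling_C0] C0_space_finite C0_space_has_c0[OF lc] by blast
  next
    fix M :: "'a measure"
    assume "is_iterated_dual TYPE('u) n (Linf_space M) (type_space TYPE('e))"
    from iterated_dual_has_sequence[OF inf this zero_scaling_class_space[OF class_space_Linf]]
    show ?thesis using Linf_dichotomy by blast
  next
    assume "compact (UNIV :: 'k set)" "is_predual (type_space TYPE('e)) (type_space TYPE('k \<Rightarrow>\<^sub>C real))"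
    then show ?thesis using predual_C_has_ell1[OF inf] by blast
  next
    fix M :: "'a measure"
    assume M: "sigma_finite_measure M" and iso: "type_space TYPE('e) \<cong>\<^sub>i L1_space M"
    note transfer = isometric_transfer[OF normed_space_type_space zero_scaling_class_space[OF class_space_L1] iso]
    show ?thesis
      using transfer(1,3) L1_dichotomy[OF M] infinite_dimensional_type_space[OF inf] by blast
  next
    assume "infinite_dimensional TYPE('y1)" "contains_copy (type_space TYPE('z1)) c0_space"
      and iso: "type_space TYPE('e) \<cong>\<^sub>i type_space TYPE('y1 \<Rightarrow>\<^sub>L 'z1)"
    then have "has_c0_sequence (type_space TYPE('y1 \<Rightarrow>\<^sub>L 'z1))"
      using operators_have_c0 contains_copy_has_c0 by blast
    then show ?thesis
      using isometric_transfer(2)[OF normed_space_type_space _ iso]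
        normed_space.zero_scaling[OF normed_space_type_space] by blast
  next
    assume "infinite_dimensional TYPE('y2)" "infinite_dimensional TYPE('w2)"
      "contains_copy (type_space TYPE('z2)) c0_space"
      and iso: "type_space TYPE('e) \<cong>\<^sub>i Bil_space TYPE('y2) TYPE('w2) TYPE('z2)"
    then have "has_c0_sequence (Bil_space TYPE('y2) TYPE('w2) TYPE('z2))"
      using bilinear_maps_have_c0 contains_copy_has_c0 by blast
    then show ?thesis
      using isometric_transfer(2)[OF normed_space_type_space zero_scaling_Bil iso] by blast
  next
    fix e :: 'm
    assume "is_iterated_dual TYPE('u) n (Lip0_space e) (type_space TYPE('e))"
    from iterated_dual_has_sequence[OF inf this normed_space.zero_scaling[OF normed_space_Lip0]]
    show ?thesis using Lip0_finite Lip0_has_ell1 by blast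
  next
    fix e :: 'm
    assume iso: "type_space TYPE('e) \<cong>\<^sub>i free_space e"
    note transfer = isometric_transfer[OF normed_space_type_space zero_scaling_free iso]
    show ?thesis
      using transfer(1,3) free_space_finite free_space_has_ell1 infinite_dimensional_type_space[OF inf] by blast
  qed
  then show ?thesis by (rule Lip0_onto_ell1_if_sequence)
qed

end
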